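(* Let $W_-,W_0,W_+$, the twelve-dimensional subspace $V_0\subset W_0$, and the two-loop Hamiltonian $\mathbf{H}$ on $W_0$ (depending on the formal parameter $N$ and on $k$) be as in the context. Then $\mathbf{H}$ preserves $V_0$, and the characteristic polynomial in $\gamma$ of $\mathbf{H}|_{V_0}$ is $$\gamma^8\left(\gamma-20\frac{N^2-1}{k^2}\right)\left(\gamma-6\frac{N^2}{k^2}\right)\left(\gamma^2+2\frac{10-7N^2}{k^2}\gamma+4\frac{24-54N^2+12N^4}{k^4}\right).$$ The roots of the last factor are $$\gamma_\pm(N)=\frac{7N^2-10\pm\sqrt{N^4+76N^2+4}}{k^2},$$ where $\gamma_-$ has a first-order zero at $N=2$ and $\gamma_-(N)\neq0$ for all real $N>2$. Moreover, for all $a,b\in\{1,2\}$ the vector $$\begin{aligned}\mathcal{O}^a_b(N)={}&\tfrac{10}{7}\left[\epsilon^{cd}\,\mathrm{Tr}(\phi_c\bar\phi^a)\mathrm{Tr}(\phi_b\bar\psi_d)-\epsilon_{cd}\,\mathrm{Tr}(\phi_b\bar\phi^c)\mathrm{Tr}(\psi^a\bar\phi^d)\right]\\&-\tfrac{6N^2+2-k^2\gamma_-(N)}{7}\,\epsilon_{cd}\,\mathrm{Tr}(\bar\phi^a\phi_b)\mathrm{Tr}(\bar\phi^c\psi^d)+\tfrac{6N^2-8-k^2\gamma_-(N)}{7}\,\epsilon^{cd}\,\mathrm{Tr}(\phi_b\bar\phi^a)\mathrm{Tr}(\phi_c\bar\psi_d)\\&-\tfrac{16N^2-8-k^2\gamma_-(N)}{14N}\Big[\epsilon_{cd}\mathrm{Tr}(\psi^c\bar\phi^d\phi_b\bar\phi^a)+\epsilon_{cd}\mathrm{Tr}(\psi^c\bar\phi^a\phi_b\bar\phi^d)\\&\qquad\qquad-\epsilon^{cd}\mathrm{Tr}(\bar\psi_c\phi_d\bar\phi^a\phi_b)-\epsilon^{cd}\mathrm{Tr}(\bar\psi_c\phi_b\bar\phi^a\phi_d)\Big]\end{aligned}$$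 satisfies $\mathbf{H}\,\mathcal{O}^a_b(N)=\gamma_-(N)\,\mathcal{O}^a_b(N)$.
   Context: Repeated flavour indices are summed over $\{1,2\}$; $\epsilon^{ab},\epsilon_{ab}$ are antisymmetric with $\epsilon^{12}=\epsilon_{12}=1$. $k$ is a nonzero real parameter. Letters and words. Unbarred letters: bosons $\phi_a$, $D\phi_a$ and fermions $\psi^a$. Barred letters: bosons $\bar\phi^a$, $D\bar\phi^a$ and fermions $\bar\psi_a$ ($a\in\{1,2\}$). A single-trace word is a cyclic word with alternating unbarred and barred letters, modulo cyclic rotation with the usual fermionic sign. Multi-trace words are graded-commutative products of single-trace words, treated formally (no trace relations). Spaces. $W_-$ is the span of all words $\mathrm{Tr}(\phi_aD\bar\phi^b)$, $\mathrm{Tr}(D\phi_a\bar\phi^b)$, $\mathrm{Tr}(\psi^a\bar\psi_b)$. $W_0$ is the span of all (single- and double-trace) words with two unbarred and two barred letters, none of them differentiated, exactly one of the four being a fermion. $W_+$ is the span of all multi-trace words with three letters $\phi_a$ and three letters $\bar\phi^a$. $V_0\subset W_0$ is the span of the twelve words $\mathrm{Tr}(\phi_1\bar\phi^1\phi_2\bar\psi_1)$, $\mathrm{Tr}(\phi_1\bar\phi^1\psi^1\bar\phi^2)$, $\mathrm{Tr}(\phi_1\bar\phi^1\psi^2\bar\phi^1)$, $\mathrm{Tr}(\phi_1\bar\phi^2\psi^1\bar\phi^1)$, $\mathrm{Tr}(\phi_1\bar\psi_1\phi_2\bar\phi^1)$, $\mathrm{Tr}(\phi_1\bar\phi^1\phi_1\bar\psi_2)$,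 $\mathrm{Tr}(\phi_1\bar\phi^1)\mathrm{Tr}(\phi_1\bar\psi_2)$, $\mathrm{Tr}(\phi_1\bar\phi^1)\mathrm{Tr}(\phi_2\bar\psi_1)$, $\mathrm{Tr}(\phi_1\bar\phi^1)\mathrm{Tr}(\psi^1\bar\phi^2)$, $\mathrm{Tr}(\phi_1\bar\phi^1)\mathrm{Tr}(\psi^2\bar\phi^1)$, $\mathrm{Tr}(\phi_1\bar\phi^2)\mathrm{Tr}(\psi^1\bar\phi^1)$, $\mathrm{Tr}(\phi_1\bar\psi_1)\mathrm{Tr}(\phi_2\bar\phi^1)$ (the sector with spin $J=\tfrac12$ and $\mathrm{SO}(6)$ Cartan charges $(H_1,H_2,H_3)=(2,1,0)$). Supercharge. $Q$ is the odd derivation (graded Leibniz rule inside words and on products of traces) determined by $Q\phi_a=0$, $Q\bar\phi^a=0$, $Q\psi^a=\epsilon^{bc}\phi_b\bar\phi^a\phi_c$, $Q\bar\psi_a=\epsilon_{bc}\bar\phi^b\phi_a\bar\phi^c$, $Q(D\phi_e)=\phi_e\Lambda-\tilde\Lambda\phi_e$, $Q(D\bar\phi^e)=\bar\phi^e\tilde\Lambda-\Lambda\bar\phi^e$, with $\Lambda=\epsilon^{ab}\bar\psi_a\phi_b-\epsilon_{ab}\bar\phi^a\psi^b$ and $\tilde\Lambda=\epsilon_{ab}\psi^a\bar\phi^b-\epsilon^{ab}\phi_a\bar\psi_b$. It restricts to linear maps $W_-\to W_0\to W_+$ with matrices independent of $N$. Gram matrices. For integer $N$, replace letters by $N\times N$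 matrices of independent (bosonic or fermionic) components, regarded as creation operators on a Fock space, with $\langle X_{ij},Y_{kl}\rangle=\delta_{XY}\delta_{ik}\delta_{jl}\,\frac{2}{k}c_X$, where $c_X=1$ for $X\in\{\phi_a,\bar\phi^a,\psi^a,\bar\psi_a\}$ and $c_X=\tfrac12$ for $X\in\{D\phi_a,D\bar\phi^a\}$; inner products of monomials are given by Wick's theorem (sum over pairings, with fermionic signs). The inner product of two words is the value at $N$ of a polynomial in $N$; these polynomials define Gram matrices $\mathbf{G}_-,\mathbf{G}_0,\mathbf{G}_+$ on $W_-,W_0,W_+$ for formal $N$, which are invertible over the field of rational functions of $N$. Hamiltonian. With $Q^\dagger$ the adjoint of $Q$ with respect to these Gram matrices (e.g. on $W_+\to W_0$ its matrix is $\mathbf{G}_0^{-1}\mathbf{Q}^{\dagger}\mathbf{G}_+$, where $\mathbf{Q}^\dagger$ is the conjugate transpose of the matrix of $Q$, and similarly $W_0\to W_-$), the Hamiltonian on $W_0$ is $\mathbf{H}=\tfrac14(QQ^\dagger+Q^\dagger Q)$. Its entries are rational functions of $N$, and the claims are identities in the formal parameter $N$ (for the eigenvector, over the field extended by $\sqrt{N^4+76N^2+4}$). *)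

theory Defs
  imports
    "HOL-Combinatorics.Permutations"
    "HOL-Computational_Algebra.Computational_Algebra"
    "HOL-Algebra.Algebraic_Closure_Type"
    "Jordan_Normal_Form.Matrix_Kernel"
    "Jordan_Normal_Form.Char_Poly"
begin

datatype flav = A1 | A2

fun eps :: "flav \<Rightarrow> flav \<Rightarrow> int" where
  "eps A1 A2 = 1"
| "eps A2 A1 = -1"
| "eps _ _ = 0"

text \<open>The suffix \<open>b\<close> marks the barred letters; \<open>DPhi\<close> and \<open>DPhib\<close> are the
  differentiated scalars.\<close>

datatype letter =
  Phi flav | DPhi flav | Psi flav | Phib flav | DPhib flav | Psib flav

fun fermion :: "letter \<Rightarrow> bool" where
  "fermion (Psi _) = True"
| "fermion (Psib _) = True"
| "fermion _ = False"

type_synonym trace = "letter list"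
type_synonym mword = "trace list"

definition nferm :: "letter list \<Rightarrow> nat" where
  "nferm xs = length (filter fermion xs)"

definition koszul :: "letter list \<Rightarrow> letter list \<Rightarrow> int" where
  "koszul xs ys = (-1) ^ (nferm xs * nferm ys)"

text \<open>\<open>wrel w s v\<close> says that the relations (cyclic rotation inside a trace, graded
  commutativity of traces) identify \<open>w\<close> with \<open>s\<close> times \<open>v\<close>. Both moves can be undone by moves
  of the same kind and sign, so this is an equivalence relation.\<close>

inductive wrel :: "mword \<Rightarrow> int \<Rightarrow> mword \<Rightarrow> bool" for w :: mword where
  refl: "wrel w 1 w"
| rot: "wrel w s (us @ (x # t) # vs) \<Longrightarrow>
    wrel w (s * koszul [x] t) (us @ (t @ [x]) # vs)"
| swap: "wrel w s (us @ t # t' # vs) \<Longrightarrow>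
    wrel w (s * koszul t t') (us @ t' # t # vs)"

text \<open>\<open>cls w v\<close> is the coefficient of the word \<open>v\<close> in the class of the word \<open>w\<close>
  modulo the relations. A word identified with its own negative is zero.\<close>

definition cls :: "mword \<Rightarrow> mword \<Rightarrow> int" where
  "cls w v =
    (if wrel w 1 v \<and> \<not> wrel w (-1) v then 1
     else if wrel w (-1) v \<and> \<not> wrel w 1 v then -1
     else 0)"

text \<open>A basis of the span of the words in a list: drop the words that are zero or that are,
  up to sign, identified with a word already selected.\<close>

definition word_basis :: "mword list \<Rightarrow> mword list" where
  "word_basis ws =
    fold (\<lambda>w B. if cls w w = 0 \<or> (\<exists>b\<in>set B. cls w b \<noteq> 0) then B else B @ [w]) ws []"

text \<open>Every trace is rotated so that it starts with an unbarred letter.\<close>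

definition Wminus_basis :: "mword list" where
  "Wminus_basis = word_basis
    ([[[Phi a, DPhib b]]. a \<leftarrow> [A1, A2], b \<leftarrow> [A1, A2]] @
     [[[DPhi a, Phib b]]. a \<leftarrow> [A1, A2], b \<leftarrow> [A1, A2]] @
     [[[Psi a, Psib b]]. a \<leftarrow> [A1, A2], b \<leftarrow> [A1, A2]])"

definition W0_basis :: "mword list" where
  "W0_basis =
    (let us = [Phi A1, Phi A2, Psi A1, Psi A2];
         bs = [Phib A1, Phib A2, Psib A1, Psib A2]
     in word_basis (filter (\<lambda>w. nferm (concat w) = 1)
       ([[[u, v, u', v']]. u \<leftarrow> us, v \<leftarrow> bs, u' \<leftarrow> us, v' \<leftarrow> bs] @
        [[[u, v], [u', v']]. u \<leftarrow> us, v \<leftarrow> bs, u' \<leftarrow> us, v' \<leftarrow> bs])))"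

definition Wplus_basis :: "mword list" where
  "Wplus_basis =
    (let us = [Phi A1, Phi A2];
         bs = [Phib A1, Phib A2]
     in word_basis
       ([[[u, v, u', v', u'', v'']].
          u \<leftarrow> us, v \<leftarrow> bs, u' \<leftarrow> us, v' \<leftarrow> bs, u'' \<leftarrow> us, v'' \<leftarrow> bs] @
        [[[u, v, u', v'], [u'', v'']].
          u \<leftarrow> us, v \<leftarrow> bs, u' \<leftarrow> us, v' \<leftarrow> bs, u'' \<leftarrow> us, v'' \<leftarrow> bs] @
        [[[u, v], [u', v'], [u'', v'']].
          u \<leftarrow> us, v \<leftarrow> bs, u' \<leftarrow> us, v' \<leftarrow> bs, u'' \<leftarrow> us, v'' \<leftarrow> bs]))"

definition V0_words :: "mword list" where
  "V0_words =
   [[[Phi A1, Phib A1, Phi A2, Psib A1]],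
    [[Phi A1, Phib A1, Psi A1, Phib A2]],
    [[Phi A1, Phib A1, Psi A2, Phib A1]],
    [[Phi A1, Phib A2, Psi A1, Phib A1]],
    [[Phi A1, Psib A1, Phi A2, Phib A1]],
    [[Phi A1, Phib A1, Phi A1, Psib A2]],
    [[Phi A1, Phib A1], [Phi A1, Psib A2]],
    [[Phi A1, Phib A1], [Phi A2, Psib A1]],
    [[Phi A1, Phib A1], [Psi A1, Phib A2]],
    [[Phi A1, Phib A1], [Psi A2, Phib A1]],
    [[Phi A1, Phib A2], [Psi A1, Phib A1]],
    [[Phi A1, Psib A1], [Phi A2, Phib A1]]]"

text \<open>Formal linear combinations are lists of pairs of a coefficient and a word.\<close>

definition Lam :: "(int \<times> letter list) list" where
  "Lam =
    [(eps a b, [Psib a, Phi b]). a \<leftarrow> [A1, A2], b \<leftarrow> [A1, A2]] @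
    [(- eps a b, [Phib a, Psi b]). a \<leftarrow> [A1, A2], b \<leftarrow> [A1, A2]]"

definition Lamt :: "(int \<times> letter list) list" where
  "Lamt =
    [(eps a b, [Psi a, Phib b]). a \<leftarrow> [A1, A2], b \<leftarrow> [A1, A2]] @
    [(- eps a b, [Phi a, Psib b]). a \<leftarrow> [A1, A2], b \<leftarrow> [A1, A2]]"

fun Q_letter :: "letter \<Rightarrow> (int \<times> letter list) list" where
  "Q_letter (Phi a) = []"
| "Q_letter (Phib a) = []"
| "Q_letter (Psi a) =
    [(eps b c, [Phi b, Phib a, Phi c]). b \<leftarrow> [A1, A2], c \<leftarrow> [A1, A2]]"
| "Q_letter (Psib a) =
    [(eps b c, [Phib b, Phi a, Phib c]). b \<leftarrow> [A1, A2], c \<leftarrow> [A1, A2]]"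
| "Q_letter (DPhi e) =
    [(c, Phi e # l). (c, l) \<leftarrow> Lam] @ [(- c, l @ [Phi e]). (c, l) \<leftarrow> Lamt]"
| "Q_letter (DPhib e) =
    [(c, Phib e # l). (c, l) \<leftarrow> Lamt] @ [(- c, l @ [Phib e]). (c, l) \<leftarrow> Lam]"

primrec Q_trace :: "trace \<Rightarrow> (int \<times> trace) list" where
  "Q_trace [] = []"
| "Q_trace (x # t) =
    [(c, l @ t). (c, l) \<leftarrow> Q_letter x] @
    [((-1) ^ nferm [x] * c, x # t'). (c, t') \<leftarrow> Q_trace t]"

primrec Q_word :: "mword \<Rightarrow> (int \<times> mword) list" where
  "Q_word [] = []"
| "Q_word (t # w) =
    [(c, t' # w). (c, t') \<leftarrow> Q_trace t] @
    [((-1) ^ nferm t * c, t # w'). (c, w') \<leftarrow> Q_word w]"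

text \<open>Matrix components of the letters, \<open>(X, i, j)\<close> standing for \<open>X\<^sub>i\<^sub>j\<close>; they are the
  creation operators of the Fock space.\<close>

type_synonym comp = "letter \<times> nat \<times> nat"

fun letter_norm :: "letter \<Rightarrow> real" where
  "letter_norm (DPhi _) = 1/2"
| "letter_norm (DPhib _) = 1/2"
| "letter_norm _ = 1"

definition comp_ip :: "real \<Rightarrow> comp \<Rightarrow> comp \<Rightarrow> real" where
  "comp_ip k x y = (if x = y then 2 / k * letter_norm (fst x) else 0)"

definition pairing_sign :: "comp list \<Rightarrow> (nat \<Rightarrow> nat) \<Rightarrow> real" where
  "pairing_sign xs \<sigma> = (-1) ^ card {(i, j). i < j \<and> j < length xs \<and>
     fermion (fst (xs ! i)) \<and> fermion (fst (xs ! j)) \<and> \<sigma> j < \<sigma> i}"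

definition wick :: "real \<Rightarrow> comp list \<Rightarrow> comp list \<Rightarrow> real" where
  "wick k xs ys =
    (if length xs = length ys then
       (\<Sum>\<sigma> | \<sigma> permutes {..<length xs}.
          pairing_sign xs \<sigma> * (\<Prod>i<length xs. comp_ip k (xs ! i) (ys ! \<sigma> i)))
     else 0)"

text \<open>A trace of matrix products is the sum, over the assignments of index lists to the traces,
  of the monomials below: in a trace, the \<open>p\<close>-th letter has row index \<open>i\<^sub>p\<close> and column index
  \<open>i\<^sub>p\<^sub>+\<^sub>1\<close>, cyclically.\<close>

definition assignments :: "nat \<Rightarrow> mword \<Rightarrow> nat list list set" where
  "assignments N w =
    {iss. list_all2 (\<lambda>is t. length is = length t \<and> set is \<subseteq> {..<N}) iss w}"

definition monomial :: "mword \<Rightarrow> nat list list \<Rightarrow> comp list" where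
  "monomial w iss = concat (map2 (\<lambda>t is. zip t (zip is (rotate1 is))) w iss)"

definition word_ip :: "real \<Rightarrow> nat \<Rightarrow> mword \<Rightarrow> mword \<Rightarrow> real" where
  "word_ip k N v w =
    (\<Sum>iss\<in>assignments N v. \<Sum>jss\<in>assignments N w. wick k (monomial v iss) (monomial w jss))"

type_synonym ratfun = "real poly fract"

definition Nvar :: ratfun where
  "Nvar = to_fract [:0, 1:]"

definition const :: "real \<Rightarrow> ratfun" where
  "const c = to_fract [:c:]"

definition gram_poly :: "real \<Rightarrow> mword \<Rightarrow> mword \<Rightarrow> real poly" where
  "gram_poly k v w = (THE p. \<forall>N>0. poly p (real N) = word_ip k N v w)"

definition gram_mat :: "real \<Rightarrow> mword list \<Rightarrow> ratfun mat" where
  "gram_mat k B =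
    mat (length B) (length B) (\<lambda>(i, j). to_fract (gram_poly k (B ! i) (B ! j)))"

text \<open>\<open>Q_mat B C\<close> is the matrix of \<open>Q\<close> from the span of \<open>B\<close> to the span of \<open>C\<close>; components
  along words outside \<open>C\<close> would be dropped, but \<open>Q\<close> maps \<open>W\<^sub>-\<close> into \<open>W\<^sub>0\<close> and \<open>W\<^sub>0\<close> into \<open>W\<^sub>+\<close>.\<close>

definition Q_mat :: "mword list \<Rightarrow> mword list \<Rightarrow> ratfun mat" where
  "Q_mat B C =
    mat (length C) (length B)
      (\<lambda>(i, j). of_int (\<Sum>(c, w)\<leftarrow>Q_word (B ! j). c * cls w (C ! i)))"

text \<open>The matrix of \<open>Q\<close> has integer entries, so its conjugate transpose is its transpose.\<close>

definition Q_adjoint :: "real \<Rightarrow> mword list \<Rightarrow> mword list \<Rightarrow> ratfun mat" where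
  "Q_adjoint k B C =
    the (mat_inverse (gram_mat k B)) * transpose_mat (Q_mat B C) * gram_mat k C"

definition Ham :: "real \<Rightarrow> ratfun mat" where
  "Ham k = const (1/4) \<cdot>\<^sub>m
    (Q_mat Wminus_basis W0_basis * Q_adjoint k Wminus_basis W0_basis +
     Q_adjoint k W0_basis Wplus_basis * Q_mat W0_basis Wplus_basis)"

definition V0_mat :: "ratfun mat" where
  "V0_mat =
    mat (length W0_basis) (length V0_words) (\<lambda>(i, j). of_int (cls (V0_words ! j) (W0_basis ! i)))"

definition V0 :: "ratfun vec set" where
  "V0 = {V0_mat *\<^sub>v x |x. x \<in> carrier_vec (length V0_words)}"

text \<open>Used both for real \<open>N\<close> and in a field containing the rational functions of \<open>N\<close>;
  \<open>s\<close> is a square root of \<open>discr N\<close>.\<close>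

definition discr :: "'a::field \<Rightarrow> 'a" where
  "discr N = N ^ 4 + 76 * N ^ 2 + 4"

definition gamma_plus :: "'a::field \<Rightarrow> 'a \<Rightarrow> 'a \<Rightarrow> 'a" where
  "gamma_plus k N s = (7 * N ^ 2 - 10 + s) / k ^ 2"

definition gamma_minus :: "'a::field \<Rightarrow> 'a \<Rightarrow> 'a \<Rightarrow> 'a" where
  "gamma_minus k N s = (7 * N ^ 2 - 10 - s) / k ^ 2"

definition gamma_plus_real :: "real \<Rightarrow> real \<Rightarrow> real" where
  "gamma_plus_real k N = gamma_plus k N (sqrt (discr N))"

definition gamma_minus_real :: "real \<Rightarrow> real \<Rightarrow> real" where
  "gamma_minus_real k N = gamma_minus k N (sqrt (discr N))"

definition last_factor :: "'a::field \<Rightarrow> 'a \<Rightarrow> 'a poly" where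
  "last_factor k N =
    [: 4 * ((24 - 54 * N ^ 2 + 12 * N ^ 4) / k ^ 4), 2 * ((10 - 7 * N ^ 2) / k ^ 2), 1 :]"

text \<open>Coordinates of \<open>\<O>\<^sup>a\<^sub>b\<close> in the basis of \<open>W\<^sub>0\<close>.\<close>

definition Ovec :: "'a::field \<Rightarrow> 'a \<Rightarrow> 'a \<Rightarrow> flav \<Rightarrow> flav \<Rightarrow> 'a vec" where
  "Ovec k N s a b = vec (length W0_basis) (\<lambda>i.
    let e = (\<lambda>c d. of_int (eps c d) :: 'a);
        Tr = (\<lambda>w. of_int (cls w (W0_basis ! i)) :: 'a);
        g = k ^ 2 * gamma_minus k N s;
        S = (\<lambda>f :: flav \<Rightarrow> flav \<Rightarrow> 'a. \<Sum>c\<in>{A1, A2}. \<Sum>d\<in>{A1, A2}. f c d)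
    in 10 / 7 *
         (S (\<lambda>c d. e c d * Tr [[Phi c, Phib a], [Phi b, Psib d]]) -
          S (\<lambda>c d. e c d * Tr [[Phi b, Phib c], [Psi a, Phib d]]))
     - (6 * N ^ 2 + 2 - g) / 7 *
         S (\<lambda>c d. e c d * Tr [[Phib a, Phi b], [Phib c, Psi d]])
     + (6 * N ^ 2 - 8 - g) / 7 *
         S (\<lambda>c d. e c d * Tr [[Phi b, Phib a], [Phi c, Psib d]])
     - (16 * N ^ 2 - 8 - g) / (14 * N) *
         (S (\<lambda>c d. e c d * Tr [[Psi c, Phib d, Phi b, Phib a]]) +
          S (\<lambda>c d. e c d * Tr [[Psi c, Phib a, Phi b, Phib d]]) -
          S (\<lambda>c d. e c d * Tr [[Psib c, Phi d, Phib a, Phi b]]) -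
          S (\<lambda>c d. e c d * Tr [[Psib c, Phi b, Phib a, Phi d]])))"

end

(* By Wick's theorem the inner product of two words is a sum over matchings of equal letters; each
   matching contributes a power of N, the number of index classes left free. This makes the Gram
   polynomials computable. They are invariant under the relations between words, so the adjoints in
   the Hamiltonian never require an explicit basis of W_+, and an identity H x = y in W_0 becomes the finite
   system of polynomial identities obtained by pairing with all words of W_0 of the same charges;
   the Gram matrix of W_0 is invertible because its diagonal dominates at large N. On V_0 the
   resulting matrix has rank 4, and its characteristic polynomial follows from that of a 4x4 block
   matrix. The vector O^a_b is a combination of four vectors spanning an H-invariant subspace. *)

theory Submission
  imports
    Defs
    "HOL-Library.List_Lexorder"
begin

section \<open>Equivalence of words with at most one fermion\<close>

text \<open>Signs are the obstacle to evaluating the definitions. Every word of W_0 and W_+ carries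
  at most one fermion, so all its Koszul and pairing signs are 1 and its class is decided by a
  canonical form. Only W_- has words with two fermions; there each word is one unbarred and one
  barred letter, which fixes every matching, and the Gram matrix is diagonal. The other obstacle is
  the inverse Gram matrices. That of W_- contributes reciprocal norms and N^(-2), cleared by
  multiplication; that of W_0 is removed by applying G_0 to both sides, so every check is between
  integer polynomials in N. The integer tables \<open>V0_left\<close>, \<open>V0_right\<close> and
  \<open>O_matrix\<close> are certificates, confirmed by these evaluations. The factorisation
  through four dimensions replaces a 12 by 12 determinant by a 4 by 4 one and accounts for the
  factor gamma^8.\<close>

lemma nferm_simps [simp]:
  "nferm [] = 0" "nferm (x # xs) = (if fermion x then 1 else 0) + nferm xs"
  "nferm (xs @ ys) = nferm xs + nferm ys"
  by (auto simp: nferm_def)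

lemma nferm_mset: "mset xs = mset ys \<Longrightarrow> nferm xs = nferm ys"
  unfolding nferm_def by (metis mset_filter size_mset)

lemma wrel_mset: "wrel w s v \<Longrightarrow> mset (concat v) = mset (concat w)"
  by (induction rule: wrel.induct) (auto simp: ac_simps)

lemma wrel_nferm: "wrel w s v \<Longrightarrow> nferm (concat v) = nferm (concat w)"
  by (rule nferm_mset) (rule wrel_mset)

lemma koszul_1: "nferm xs + nferm ys \<le> 1 \<Longrightarrow> koszul xs ys = 1"
  by (cases "nferm xs"; cases "nferm ys") (auto simp: koszul_def)

text \<open>Moves do not change the multiset of letters, so at every stage at most one fermion is
  present and one factor in each Koszul exponent is zero.\<close>

lemma wrel_sign: "wrel w s v \<Longrightarrow> nferm (concat w) \<le> 1 \<Longrightarrow> s = 1"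
proof (induction rule: wrel.induct)
  case (rot s us x t vs)
  have "nferm (concat (us @ (x # t) # vs)) \<le> 1"
    using wrel_nferm[OF rot.hyps(1)] rot.prems by simp
  then show ?case using rot by (subst koszul_1) (auto split: if_splits)
next
  case (swap s us t t' vs)
  have "nferm (concat (us @ t # t' # vs)) \<le> 1"
    using wrel_nferm[OF swap.hyps(1)] swap.prems by simp
  then show ?case using swap by (subst koszul_1) auto
qed auto

lemma wrel_rotate:
  assumes "nferm (concat w) \<le> 1"
  shows "wrel w 1 (us @ t # vs) \<Longrightarrow> wrel w 1 (us @ rotate n t # vs)"
proof (induction n)
  case (Suc n)
  then have IH: "wrel w 1 (us @ rotate n t # vs)" by simp
  show ?case
  proof (cases "rotate n t")
    case Nil then show ?thesis using IH by simp
  next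
    case (Cons x u)
    have "wrel w (1 * koszul [x] u) (us @ (u @ [x]) # vs)"
      using wrel.rot[of w 1 us x u vs] IH Cons by simp
    then show ?thesis using wrel_sign[OF _ assms] Cons by simp metis
  qed
qed simp

definition trace_eq :: "trace \<Rightarrow> trace \<Rightarrow> bool" where
  "trace_eq t u \<longleftrightarrow> (\<exists>n. u = rotate n t)"

lemma wrel_list_all2:
  assumes "nferm (concat w) \<le> 1" "list_all2 trace_eq xs ys"
  shows "wrel w 1 (us @ xs) \<Longrightarrow> wrel w 1 (us @ ys)"
  using assms(2)
proof (induction xs ys arbitrary: us rule: list_all2_induct)
  case (Cons x xs y ys)
  then obtain n where "y = rotate n x" by (auto simp: trace_eq_def)
  then have "wrel w 1 ((us @ [y]) @ xs)"
    using wrel_rotate[OF assms(1) Cons.prems] by simp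
  then show ?case using Cons.IH[of "us @ [y]"] by simp
qed simp

lemma wrel_move:
  assumes "nferm (concat w) \<le> 1"
  shows "wrel w 1 (us @ xs @ x # vs) \<Longrightarrow> wrel w 1 (us @ x # xs @ vs)"
proof (induction xs arbitrary: vs rule: rev_induct)
  case (snoc y xs)
  have "wrel w (1 * koszul y x) ((us @ xs) @ x # y # vs)"
    using wrel.swap[of w 1 "us @ xs" y x vs] snoc.prems by simp
  then have "wrel w 1 (us @ xs @ x # y # vs)" using wrel_sign[OF _ assms] by simp metis
  then show ?case using snoc.IH[of "y # vs"] by simp
qed simp

text \<open>The first trace of \<open>ys\<close> is pulled to the front by adjacent swaps;
  generalising over the prefix \<open>us\<close> lets the induction leave it there.\<close>

lemma wrel_perm:
  assumes "nferm (concat w) \<le> 1"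
  shows "mset xs = mset ys \<Longrightarrow> wrel w 1 (us @ xs) \<Longrightarrow> wrel w 1 (us @ ys)"
proof (induction ys arbitrary: xs us)
  case (Cons y ys)
  then have "y \<in> set xs" by (metis list.set_intros(1) mset_eq_setD)
  then obtain as bs where xs: "xs = as @ y # bs" by (auto dest: split_list)
  then have "wrel w 1 ((us @ [y]) @ (as @ bs))"
    using wrel_move[OF assms, of us as y bs] Cons.prems by simp
  moreover have "mset (as @ bs) = mset ys" using Cons.prems xs by simp
  ultimately show ?case using Cons.IH[of "as @ bs" "us @ [y]"] by simp
qed simp

section \<open>Canonical forms of multi-trace words\<close>

fun letter_code :: "letter \<Rightarrow> int" where
  "letter_code (Phi A1) = 1" | "letter_code (Phi A2) = 2"
| "letter_code (DPhi A1) = 3" | "letter_code (DPhi A2) = 4"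
| "letter_code (Psi A1) = 5" | "letter_code (Psi A2) = 6"
| "letter_code (Phib A1) = 7" | "letter_code (Phib A2) = 8"
| "letter_code (DPhib A1) = 9" | "letter_code (DPhib A2) = 10"
| "letter_code (Psib A1) = 11" | "letter_code (Psib A2) = 12"

lemma inj_letter_code: "inj letter_code"
proof (rule injI)
  fix x y show "letter_code x = letter_code y \<Longrightarrow> x = y"
    by (cases x rule: letter_code.cases; cases y rule: letter_code.cases) simp_all
qed

primrec rotations :: "nat \<Rightarrow> 'a list \<Rightarrow> 'a list list" where
  "rotations 0 t = [t]"
| "rotations (Suc n) t = t # rotations n (rotate1 t)"

lemma set_rotations: "set (rotations n t) = (\<lambda>i. rotate i t) ` {..n}"
proof (induction n arbitrary: t)
  case (Suc n)
  have "{..Suc n} = insert 0 (Suc ` {..n})" by (metis atMost_Suc_eq_insert_0)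
  then show ?case by (simp add: Suc image_image rotate1_rotate_swap)
qed simp

primrec min_trace :: "int list \<Rightarrow> int list list \<Rightarrow> int list" where
  "min_trace m [] = m"
| "min_trace m (t # ts) = min_trace (if t < m then t else m) ts"

lemma min_trace: "min_trace m ts = Min (insert m (set ts))"
proof (induction ts arbitrary: m)
  case (Cons t ts)
  have "Min (insert (min m t) (set ts)) = Min (insert m (insert t (set ts)))"
    by (cases "ts = []") (simp_all add: min.assoc)
  moreover have "(if t < m then t else m) = min m t" by (auto simp: min_def)
  ultimately show ?case using Cons[of "min m t"] by simp
qed simp

text \<open>The lexicographically least rotation is a complete invariant of a cyclic word. Integer
  codes make it computable by rewriting; only the injectivity of the coding matters.\<close>

definition canon_trace :: "trace \<Rightarrow> int list" where
  "canon_trace t = (let c = map letter_code t in min_trace c (rotations (length c) c))"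

text \<open>Sorting makes the order of the traces irrelevant. All signs are forgotten, so the form
  is faithful only where no sign can arise.\<close>

definition canon :: "mword \<Rightarrow> int list list" where
  "canon w = sort (map canon_trace w)"

text \<open>Rotation depends on the amount modulo the length, so the finitely many rotations listed
  are all of them. In this form invariance under rotation becomes an equality of ranges.\<close>

lemma canon_trace_Min: "canon_trace t = Min (range (\<lambda>i. rotate i (map letter_code t)))"
proof -
  let ?c = "map letter_code t"
  have "range (\<lambda>i. rotate i ?c) = (\<lambda>i. rotate i ?c) ` {..length ?c}"
  proof (intro equalityI subsetI)
    fix x assume "x \<in> range (\<lambda>i. rotate i ?c)"
    then obtain i where x: "x = rotate i ?c" by auto
    show "x \<in> (\<lambda>i. rotate i ?c) ` {..length ?c}"
    proof (cases "?c = []")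
      case False
      have "x = rotate (i mod length ?c) ?c" unfolding x by (rule rotate_conv_mod)
      moreover have "i mod length ?c \<le> length ?c" using False by (meson length_greater_0_conv less_imp_le mod_less_divisor)
      ultimately show ?thesis by blast
    qed (auto simp: x)
  qed auto
  moreover have "?c \<in> (\<lambda>i. rotate i ?c) ` {..length ?c}" by (rule image_eqI[of _ _ 0]) auto
  ultimately show ?thesis
    by (simp add: canon_trace_def Let_def min_trace set_rotations insert_absorb)
qed

lemma canon_trace_rotate1 [simp]: "canon_trace (rotate1 t) = canon_trace t"
proof -
  have "range (\<lambda>i. rotate i (rotate1 u)) = range (\<lambda>i. rotate i u)" for u :: "int list"
  proof (intro equalityI subsetI)
    fix x assume "x \<in> range (\<lambda>i. rotate i (rotate1 u))"
    then obtain i where "x = rotate (Suc i) u" by (auto simp: rotate1_rotate_swap)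
    then show "x \<in> range (\<lambda>i. rotate i u)" by blast
  next
    fix x assume "x \<in> range (\<lambda>i. rotate i u)"
    then obtain i where x: "x = rotate i u" by auto
    \<comment> \<open>The remaining steps of a full turn undo the extra rotation.\<close>
    have "rotate (i + length u - 1) (rotate1 u) = x"
    proof (cases u)
      case (Cons a b)
      have "rotate (i + length u - 1) (rotate1 u) = rotate (i + length u) u"
        using Cons by (metis One_nat_def Suc_pred add_gr_0 length_Cons rotate1_rotate_swap rotate_Suc zero_less_Suc)
      also have "\<dots> = x" unfolding x by (metis mod_add_self2 rotate_conv_mod)
      finally show ?thesis .
    qed (simp add: x)
    then show "x \<in> range (\<lambda>i. rotate i (rotate1 u))" by blast
  qed
  then show ?thesis by (simp add: canon_trace_Min flip: rotate1_map)
qed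

lemma canon_trace_in: "\<exists>n. canon_trace t = map letter_code (rotate n t)"
proof -
  let ?R = "range (\<lambda>i. rotate i (map letter_code t))"
  have "?R \<subseteq> {xs. set xs \<subseteq> set (map letter_code t) \<and> length xs = length t}" by auto
  then have "finite ?R" by (rule finite_subset) (auto intro: finite_lists_length_eq)
  then have "Min ?R \<in> ?R" by (intro Min_in) auto
  then show ?thesis by (auto simp: canon_trace_Min rotate_map)
qed

lemma canon_trace_eqD:
  assumes "canon_trace t = canon_trace u" shows "trace_eq t u"
proof -
  obtain m n where "map letter_code (rotate m t) = map letter_code (rotate n u)"
    using canon_trace_in[of t] canon_trace_in[of u] assms by metis
  then have eq: "rotate m t = rotate n u"
    using inj_letter_code by (simp add: inj_map_eq_map)
  show ?thesis
  proof (cases "u = []")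
    case True then show ?thesis using eq by (auto simp: trace_eq_def)
  next
    case False
    \<comment> \<open>Completing the turn begun by \<open>rotate n\<close> returns to
      \<open>u\<close>; only \<open>n mod length u\<close> counts.\<close>
    have "rotate (length u - n mod length u) (rotate n u) = u"
    proof -
      have lt: "n mod length u < length u" using False by simp
      have "rotate (length u - n mod length u) (rotate n u)
        = rotate (length u - n mod length u + n mod length u) u"
        by (metis rotate_conv_mod rotate_rotate)
      then show ?thesis using lt by simp
    qed
    then show ?thesis unfolding trace_eq_def using eq by (metis rotate_rotate)
  qed
qed

lemma canon_wrel: "wrel w s v \<Longrightarrow> canon v = canon w"
proof (induction rule: wrel.induct)
  case (rot s us x t vs)
  then show ?case using canon_trace_rotate1[of "x # t"] by (simp add: canon_def)
next
  case (swap s us t t' vs)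
  have "mset (map canon_trace (us @ t' # t # vs)) = mset (map canon_trace (us @ t # t' # vs))"
    by simp
  then show ?case using swap unfolding canon_def
    by (metis properties_for_sort sorted_sort mset_sort)
qed simp

text \<open>Turns equality of the multisets of canonical traces into a reordering of the traces
  themselves.\<close>

lemma mset_map_eq_obtain:
  "mset (map f xs) = mset ys \<Longrightarrow> \<exists>zs. mset zs = mset xs \<and> map f zs = ys"
proof (induction ys arbitrary: xs)
  case (Cons y ys)
  then have "y \<in> set (map f xs)" by (metis list.set_intros(1) mset_eq_setD)
  then obtain x as bs where xs: "xs = as @ x # bs" and y: "y = f x" by (auto dest!: split_list)
  have "mset (map f (as @ bs)) = mset ys" using Cons.prems xs y by simp
  then obtain zs where "mset zs = mset (as @ bs)" "map f zs = ys" using Cons.IH by blast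
  then show ?case using xs y by (intro exI[of _ "x # zs"]) simp
qed simp

text \<open>Invariance and completeness of the canonical form give the two directions. The sign is
  never -1, so no such word is zero and \<open>cls\<close> reduces to a comparison of canonical
  forms.\<close>

lemma wrel_iff_canon:
  assumes "nferm (concat w) \<le> 1"
  shows "wrel w s v \<longleftrightarrow> s = 1 \<and> canon w = canon v"
proof
  assume "wrel w s v" then show "s = 1 \<and> canon w = canon v"
    using wrel_sign[OF _ assms] canon_wrel by metis
next
  assume *: "s = 1 \<and> canon w = canon v"
  then have "mset (map canon_trace w) = mset (map canon_trace v)"
    unfolding canon_def by (metis mset_sort)
  then obtain u where u: "mset u = mset w" "map canon_trace u = map canon_trace v"
    using mset_map_eq_obtain by blast
  have "list_all2 trace_eq u v"
    unfolding list_all2_conv_all_nth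
    using u(2) by (metis canon_trace_eqD length_map nth_map)
  moreover have "wrel w 1 u" using wrel_perm[OF assms, of w u "[]"] u wrel.refl[of w] by simp
  ultimately show "wrel w s v" using wrel_list_all2[OF assms, of u v "[]"] * by simp
qed

lemma cls_canon:
  assumes "nferm (concat w) \<le> 1"
  shows "cls w v = (if canon w = canon v then 1 else 0)"
  using assms by (simp add: cls_def wrel_iff_canon)

section \<open>Inner products as sums over letter matchings\<close>

primrec position_lists :: "nat \<Rightarrow> mword \<Rightarrow> nat list list" where
  "position_lists i [] = []"
| "position_lists i (t # w) = [i..<i + length t] # position_lists (i + length t) w"

text \<open>With the letters numbered through the whole word, \<open>succs w ! p\<close> is the
  position following \<open>p\<close> cyclically within its trace. The column index of letter
  \<open>p\<close> is the row index of its successor, so one flat index list determines a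
  monomial.\<close>

definition succs :: "mword \<Rightarrow> nat list" where
  "succs w = concat (map rotate1 (position_lists 0 w))"

lemma length_succs [simp]: "length (succs w) = length (concat w)"
proof -
  have "length (concat (map rotate1 (position_lists i w))) = length (concat w)" for i
    by (induction w arbitrary: i) auto
  then show ?thesis by (simp add: succs_def)
qed

lemma set_succs: "set (succs w) = {..<length (concat w)}"
proof -
  have "set (concat (map rotate1 (position_lists i w))) = {i..<i + length (concat w)}" for i
    by (induction w arbitrary: i) (auto simp: add.assoc)
  then show ?thesis by (simp add: succs_def lessThan_atLeast0)
qed

lemma succs_less: "p < length (concat w) \<Longrightarrow> succs w ! p < length (concat w)"
  using set_succs[of w] by (metis length_succs lessThan_iff nth_mem)

lemma concat_rotate1_succs:
  assumes "list_all2 (\<lambda>is t. length is = length t) iss w"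
  shows "concat (map rotate1 iss) = map ((!) (concat iss)) (succs w)"
proof -
  \<comment> \<open>Positions are global, so the induction over traces needs the indices of the
    earlier traces as a prefix that supplies the offset.\<close>
  have "concat (map rotate1 iss) =
      map ((!) (pre @ concat iss)) (concat (map rotate1 (position_lists (length pre) w)))" for pre
    using assms
  proof (induction iss w arbitrary: pre rule: list_all2_induct)
    case (Cons js iss t w)
    have "map ((!) (pre @ js @ concat iss)) [length pre..<length pre + length t] = js"
      using Cons.hyps by (intro nth_equalityI) (auto simp: nth_append)
    then have "map ((!) (pre @ js @ concat iss)) (rotate1 [length pre..<length pre + length t])
        = rotate1 js" by (simp flip: rotate1_map)
    then show ?case using Cons.IH[of "pre @ js"] Cons.hyps by simp
  qed simp
  from this[of "[]"] show ?thesis by (simp add: succs_def)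
qed

definition mono_of :: "mword \<Rightarrow> nat list \<Rightarrow> comp list" where
  "mono_of w l = zip (concat w) (zip l (map ((!) l) (succs w)))"

lemma monomial_mono_of:
  assumes "iss \<in> assignments N w" shows "monomial w iss = mono_of w (concat iss)"
proof -
  have len: "list_all2 (\<lambda>is t. length is = length t) iss w"
    using assms by (auto simp: assignments_def elim: list_all2_mono)
  then have "monomial w iss = zip (concat w) (zip (concat iss) (concat (map rotate1 iss)))"
  proof (induction iss w rule: list_all2_induct)
    case (Cons js iss t w)
    have "length (concat iss) = length (concat (map rotate1 iss))" by (induction iss) auto
    then show ?case using Cons by (simp add: monomial_def)
  qed (simp add: monomial_def)
  then show ?thesis using concat_rotate1_succs[OF len] by (simp add: mono_of_def)
qed

definition idxs :: "nat \<Rightarrow> nat \<Rightarrow> nat list set" where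
  "idxs N n = {l. set l \<subseteq> {..<N} \<and> length l = n}"

lemma finite_idxs [simp]: "finite (idxs N n)"
  unfolding idxs_def by (rule finite_lists_length_eq) simp

text \<open>The trace lengths prescribed by \<open>w\<close> make the splitting of a flat index list
  unique.\<close>

lemma bij_betw_concat_assignments:
  "bij_betw concat (assignments N w) (idxs N (length (concat w)))"
proof (induction w)
  case Nil then show ?case by (auto simp: assignments_def idxs_def bij_betw_def)
next
  case (Cons t w)
  show ?case unfolding bij_betw_def
  proof
    show "inj_on concat (assignments N (t # w))"
    proof (rule inj_onI)
      fix x y assume "x \<in> assignments N (t # w)" "y \<in> assignments N (t # w)" and eq: "concat x = concat y"
      then obtain a b c d where "x = a # b" "y = c # d" "length a = length t" "length c = length t"
        "b \<in> assignments N w" "d \<in> assignments N w"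
        by (auto simp: assignments_def list_all2_Cons2)
      then show "x = y" using Cons eq by (auto simp: bij_betw_def inj_on_def)
    qed
    show "concat ` assignments N (t # w) = idxs N (length (concat (t # w)))"
    proof (intro equalityI subsetI)
      fix l assume "l \<in> concat ` assignments N (t # w)"
      then obtain a b where "l = a @ concat b" "length a = length t" "set a \<subseteq> {..<N}"
        "b \<in> assignments N w"
        by (auto simp: assignments_def list_all2_Cons2)
      moreover from this(4) have "concat b \<in> idxs N (length (concat w))"
        using Cons by (auto simp: bij_betw_def)
      ultimately show "l \<in> idxs N (length (concat (t # w)))" by (auto simp: idxs_def)
    next
      fix l assume l: "l \<in> idxs N (length (concat (t # w)))"
      let ?a = "take (length t) l" and ?b = "drop (length t) l"
      have "?b \<in> idxs N (length (concat w))" using l by (auto simp: idxs_def dest: in_set_dropD)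
      then obtain b where b: "b \<in> assignments N w" "concat b = ?b"
        using Cons unfolding bij_betw_def by (metis imageE)
      have "?a # b \<in> assignments N (t # w)"
        using b l by (auto simp: assignments_def idxs_def dest: in_set_takeD)
      then show "l \<in> concat ` assignments N (t # w)"
        using b(2) by (intro image_eqI[of _ _ "?a # b"]) simp_all
    qed
  qed
qed

lemma word_ip_idxs:
  "word_ip k N v w = (\<Sum>l\<in>idxs N (length (concat v)). \<Sum>l'\<in>idxs N (length (concat w)).
     wick k (mono_of v l) (mono_of w l'))"
proof -
  have "word_ip k N v w = (\<Sum>iss\<in>assignments N v. \<Sum>jss\<in>assignments N w.
      wick k (mono_of v (concat iss)) (mono_of w (concat jss)))"
    unfolding word_ip_def by (intro sum.cong HOL.refl) (simp add: monomial_mono_of)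
  also have "\<dots> = (\<Sum>l\<in>idxs N (length (concat v)). \<Sum>jss\<in>assignments N w.
      wick k (mono_of v l) (mono_of w (concat jss)))"
    by (rule sum.reindex_bij_betw[OF bij_betw_concat_assignments])
  also have "\<dots> = (\<Sum>l\<in>idxs N (length (concat v)). \<Sum>l'\<in>idxs N (length (concat w)).
      wick k (mono_of v l) (mono_of w l'))"
    by (intro sum.cong HOL.refl) (rule sum.reindex_bij_betw[OF bij_betw_concat_assignments])
  finally show ?thesis .
qed

subsection \<open>Counting index assignments\<close>

text \<open>Connected components by relabelling: \<open>m ! p\<close> is the label of the class of
  position \<open>p\<close>, and an edge gives the class of its second end the label of its first.
  Starting from \<open>[0..<n]\<close>, where all classes are singletons, the surviving labels count
  the components.\<close>

definition merge :: "nat list \<Rightarrow> nat \<times> nat \<Rightarrow> nat list" where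
  "merge m e = (let x = m ! fst e; y = m ! snd e in map (\<lambda>z. if z = y then x else z) m)"

primrec merges :: "nat list \<Rightarrow> (nat \<times> nat) list \<Rightarrow> nat list" where
  "merges m [] = m"
| "merges m (e # es) = merges (merge m e) es"

definition num_classes :: "nat \<Rightarrow> (nat \<times> nat) list \<Rightarrow> nat" where
  "num_classes n es = length (remdups (merges [0..<n] es))"

definition label_resp :: "nat list \<Rightarrow> nat list \<Rightarrow> bool" where
  "label_resp m l \<longleftrightarrow> (\<forall>p<length m. \<forall>q<length m. m ! p = m ! q \<longrightarrow> l ! p = l ! q)"

lemma length_merge [simp]: "length (merge m e) = length m"
  by (simp add: merge_def Let_def)

lemma length_merges [simp]: "length (merges m es) = length m"
  by (induction es arbitrary: m) auto

lemma label_resp_merge: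
  assumes "a < length m" "b < length m"
  shows "label_resp (merge m (a, b)) l \<longleftrightarrow> label_resp m l \<and> l ! a = l ! b"
proof
  assume *: "label_resp (merge m (a, b)) l"
  have nth: "merge m (a, b) ! p = (if m ! p = m ! b then m ! a else m ! p)" if "p < length m" for p
    using that by (simp add: merge_def Let_def)
  show "label_resp m l \<and> l ! a = l ! b"
  proof
    have *: "l ! p = l ! q"
      if "p < length m" "q < length m" "merge m (a, b) ! p = merge m (a, b) ! q" for p q
      using * that unfolding label_resp_def length_merge by blast
    show "label_resp m l"
      unfolding label_resp_def
    proof (intro allI impI)
      fix p q assume "p < length m" "q < length m" "m ! p = m ! q"
      then show "l ! p = l ! q" by (intro *) (simp_all add: nth)
    qed
    show "l ! a = l ! b" using assms by (intro *) (simp_all add: nth)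
  qed
next
  assume *: "label_resp m l \<and> l ! a = l ! b"
  show "label_resp (merge m (a, b)) l"
    unfolding label_resp_def
  proof (intro allI impI)
    fix p q assume "p < length (merge m (a, b))" "q < length (merge m (a, b))"
      "merge m (a, b) ! p = merge m (a, b) ! q"
    then have pq: "p < length m" "q < length m"
      "(if m ! p = m ! b then m ! a else m ! p) = (if m ! q = m ! b then m ! a else m ! q)"
      by (auto simp: merge_def Let_def)
    have r: "\<And>i j. i < length m \<Longrightarrow> j < length m \<Longrightarrow> m ! i = m ! j \<Longrightarrow> l ! i = l ! j"
      using * unfolding label_resp_def by blast
    show "l ! p = l ! q"
    proof (cases "m ! p = m ! b")
      case p: True
      then have lp: "l ! p = l ! b" using r[of p b] pq assms by simp
      show ?thesis
      proof (cases "m ! q = m ! b")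
        case True
        then show ?thesis using lp r[of q b] pq assms by simp
      next
        case False
        then have "m ! a = m ! q" using p pq by simp
        from r[OF assms(1) pq(2) this] show ?thesis using lp * by simp
      qed
    next
      case p: False
      show ?thesis
      proof (cases "m ! q = m ! b")
        case True
        then have lq: "l ! q = l ! b" using r[of q b] pq assms by simp
        have "m ! p = m ! a" using True p pq by simp
        from r[OF pq(1) assms(1) this] show ?thesis using lq * by simp
      next
        case False
        then have "m ! p = m ! q" using p pq by simp
        from r[OF pq(1,2) this] show ?thesis .
      qed
    qed
  qed
qed

lemma label_resp_merges:
  assumes "\<forall>(a, b)\<in>set es. a < length m \<and> b < length m"
  shows "label_resp (merges m es) l \<longleftrightarrow> label_resp m l \<and> (\<forall>(a, b)\<in>set es. l ! a = l ! b)"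
  using assms
proof (induction es arbitrary: m)
  case (Cons e es)
  obtain a b where e: "e = (a, b)" by (cases e)
  show ?case using Cons by (auto simp: e label_resp_merge)
qed simp

text \<open>An index list constant on the classes is a function from the labels to the N index
  values, composed with \<open>m\<close>.\<close>

lemma card_label_resp:
  assumes "length m = n"
  shows "card {l \<in> idxs N n. label_resp m l} = N ^ card (set m)"
proof -
  let ?F = "set m \<rightarrow>\<^sub>E {..<N}"
  have "bij_betw (\<lambda>f. map f m) ?F {l \<in> idxs N n. label_resp m l}"
    unfolding bij_betw_def
  proof
    show "inj_on (\<lambda>f. map f m) ?F"
    proof (rule inj_onI)
      fix f g assume fg: "f \<in> ?F" "g \<in> ?F" and "map f m = map g m"
      then have "f x = g x" if "x \<in> set m" for x using that by simp
      then show "f = g" by (rule PiE_ext[OF fg])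
    qed
    show "(\<lambda>f. map f m) ` ?F = {l \<in> idxs N n. label_resp m l}"
    proof (intro equalityI subsetI)
      fix l assume "l \<in> (\<lambda>f. map f m) ` ?F"
      then obtain f where f: "f \<in> ?F" and l: "l = map f m" by blast
      have "set l \<subseteq> {..<N}" using PiE_mem[OF f] l by auto
      then show "l \<in> {l \<in> idxs N n. label_resp m l}"
        using assms l by (simp add: idxs_def label_resp_def)
    next
      fix l assume "l \<in> {l \<in> idxs N n. label_resp m l}"
      then have l: "set l \<subseteq> {..<N}" "length l = n" "label_resp m l" by (auto simp: idxs_def)
      \<comment> \<open>Any position carrying the label may be chosen, since \<open>l\<close> agrees
        on all of them.\<close>
      define f where "f = restrict (\<lambda>x. l ! (SOME p. p < n \<and> m ! p = x)) (set m)"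
      have f: "f (m ! p) = l ! p" if "p < n" for p
      proof -
        let ?q = "SOME q. q < n \<and> m ! q = m ! p"
        have "?q < n \<and> m ! ?q = m ! p" by (rule someI[of _ p]) (use that in simp)
        then have "l ! ?q = l ! p" using l(3) that assms unfolding label_resp_def by blast
        then show ?thesis using that assms by (simp add: f_def)
      qed
      have "map f m = l" using l assms by (intro nth_equalityI) (auto simp: f)
      moreover have "f \<in> ?F"
      proof (rule PiE_I)
        fix x assume "x \<in> set m"
        then obtain p where "p < n" "x = m ! p" using assms by (metis in_set_conv_nth)
        then have "f x \<in> set l" using f l(2) by simp
        then show "f x \<in> {..<N}" using l(1) by blast
      qed (simp add: f_def)
      ultimately show "l \<in> (\<lambda>f. map f m) ` ?F" by blast
    qed
  qed
  from bij_betw_same_card[OF this] show ?thesis by (simp add: card_PiE)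
qed

lemma card_idxs_equations:
  assumes "\<forall>(a, b)\<in>set es. a < n \<and> b < n"
  shows "card {l \<in> idxs N n. \<forall>(a, b)\<in>set es. l ! a = l ! b} = N ^ num_classes n es"
proof -
  have "{l \<in> idxs N n. \<forall>(a, b)\<in>set es. l ! a = l ! b} =
    {l \<in> idxs N n. label_resp (merges [0..<n] es) l}"
  proof -
    have "label_resp [0..<n] l" for l by (simp add: label_resp_def)
    then show ?thesis using label_resp_merges[of es "[0..<n]"] assms by simp
  qed
  then show ?thesis
    by (simp add: card_label_resp num_classes_def length_remdups_card_conv)
qed

subsection \<open>Matchings of letters\<close>

text \<open>Permutations are built as lists of positions in \<open>ys\<close>, letter by letter, so
  that those pairing different letters are never generated. Used positions are removed by number
  because letters repeat.\<close>

primrec matchings :: "'a list \<Rightarrow> (nat \<times> 'a) list \<Rightarrow> nat list list" where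
  "matchings [] ys = [[]]"
| "matchings (x # xs) ys = concat (map (\<lambda>y. if snd y = x
     then map ((#) (fst y)) (matchings xs (filter (\<lambda>z. fst z \<noteq> fst y) ys)) else []) ys)"

lemma set_matchings:
  "set (matchings xs ys) = {r. length r = length xs \<and> distinct r \<and>
     (\<forall>p<length xs. (r ! p, xs ! p) \<in> set ys)}"
proof (induction xs arbitrary: ys)
  case (Cons x xs)
  have "r \<in> set (matchings (x # xs) ys) \<longleftrightarrow> length r = length (x # xs) \<and> distinct r \<and>
     (\<forall>p<length (x # xs). (r ! p, (x # xs) ! p) \<in> set ys)" for r
  proof (cases r)
    case (Cons q r')
    have "r \<in> set (matchings (x # xs) ys) \<longleftrightarrow>
      (q, x) \<in> set ys \<and> r' \<in> set (matchings xs (filter (\<lambda>z. fst z \<noteq> q) ys))"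
      using Cons by force
    also have "\<dots> \<longleftrightarrow> (q, x) \<in> set ys \<and> length r' = length xs \<and> distinct r' \<and> q \<notin> set r' \<and>
        (\<forall>p<length xs. (r' ! p, xs ! p) \<in> set ys)"
      unfolding Cons.IH by (auto simp: in_set_conv_nth)
    also have "\<dots> \<longleftrightarrow> length r = length (x # xs) \<and> distinct r \<and>
     (\<forall>p<length (x # xs). (r ! p, (x # xs) ! p) \<in> set ys)"
      by (auto simp: Cons All_less_Suc2)
    finally show ?thesis .
  qed auto
  then show ?case by blast
qed auto

lemma distinct_matchings:
  "distinct (map fst ys) \<Longrightarrow> distinct (matchings xs ys)"
proof (induction xs arbitrary: ys)
  case (Cons x xs)
  have d: "distinct (matchings xs (filter (\<lambda>z. fst z \<noteq> q) ys))" for q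
    using Cons by (simp add: distinct_map_filter)
  have gen: "distinct (concat (map (\<lambda>y. if snd y = x
     then map ((#) (fst y)) (M (fst y)) else []) zs))"
    if "distinct (map fst zs)" "\<And>q. distinct (M q)" for zs :: "(nat \<times> 'a) list" and M
    using that(1)
  proof (induction zs)
    case (Cons z zs)
    then show ?case using that(2) by (auto simp: distinct_map inj_on_def)
  qed simp
  show ?case
    using gen[OF Cons.prems, of "\<lambda>q. matchings xs (filter (\<lambda>z. fst z \<noteq> q) ys)"] d by simp
qed simp

text \<open>These are the permutations in Wick's formula that pair equal letters, the only ones that
  can contribute.\<close>

lemma bij_betw_matchings:
  assumes "length xs = n" "length ys = n"
  shows "bij_betw (\<lambda>\<sigma>. map \<sigma> [0..<n]) {\<sigma>. \<sigma> permutes {..<n} \<and> (\<forall>p<n. xs ! p = ys ! \<sigma> p)}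
    (set (matchings xs (List.enumerate 0 ys)))"
  unfolding bij_betw_def
proof
  show "inj_on (\<lambda>\<sigma>. map \<sigma> [0..<n]) {\<sigma>. \<sigma> permutes {..<n} \<and> (\<forall>p<n. xs ! p = ys ! \<sigma> p)}"
  proof (rule inj_onI)
    fix \<sigma> \<tau> assume *: "\<sigma> \<in> {\<sigma>. \<sigma> permutes {..<n} \<and> (\<forall>p<n. xs ! p = ys ! \<sigma> p)}"
      "\<tau> \<in> {\<sigma>. \<sigma> permutes {..<n} \<and> (\<forall>p<n. xs ! p = ys ! \<sigma> p)}"
      and eq: "map \<sigma> [0..<n] = map \<tau> [0..<n]"
    show "\<sigma> = \<tau>"
    proof
      fix p show "\<sigma> p = \<tau> p"
      proof (cases "p < n")
        case True then show ?thesis using eq by simp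
      next
        case False then show ?thesis using * by (auto simp: permutes_def)
      qed
    qed
  qed
  have mem: "(q, y) \<in> set (List.enumerate 0 ys) \<longleftrightarrow> q < n \<and> y = ys ! q" for q y
    using assms by (auto simp: in_set_enumerate_eq)
  show "(\<lambda>\<sigma>. map \<sigma> [0..<n]) ` {\<sigma>. \<sigma> permutes {..<n} \<and> (\<forall>p<n. xs ! p = ys ! \<sigma> p)}
    = set (matchings xs (List.enumerate 0 ys))"
  proof (intro equalityI subsetI)
    fix r assume "r \<in> (\<lambda>\<sigma>. map \<sigma> [0..<n]) ` {\<sigma>. \<sigma> permutes {..<n} \<and> (\<forall>p<n. xs ! p = ys ! \<sigma> p)}"
    then obtain \<sigma> where s: "\<sigma> permutes {..<n}" "\<forall>p<n. xs ! p = ys ! \<sigma> p" "r = map \<sigma> [0..<n]"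
      by auto
    have "\<sigma> p < n" if "p < n" for p using s(1) that by (metis lessThan_iff permutes_in_image)
    moreover have "distinct r" using s(1,3) by (simp add: distinct_map permutes_inj_on)
    ultimately show "r \<in> set (matchings xs (List.enumerate 0 ys))"
      using s assms by (simp add: set_matchings mem)
  next
    fix r assume "r \<in> set (matchings xs (List.enumerate 0 ys))"
    then have r: "length r = n" "distinct r" "\<forall>p<n. r ! p < n \<and> xs ! p = ys ! (r ! p)"
      using assms by (auto simp: set_matchings mem)
    define \<sigma> where "\<sigma> p = (if p < n then r ! p else p)" for p
    have "\<sigma> permutes {..<n}"
    proof (rule bij_imp_permutes)
      have "inj_on \<sigma> {..<n}" using r by (auto simp: inj_on_def \<sigma>_def nth_eq_iff_index_eq)
      moreover have "\<sigma> ` {..<n} \<subseteq> {..<n}" using r by (auto simp: \<sigma>_def)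
      ultimately show "bij_betw \<sigma> {..<n} {..<n}"
        by (metis bij_betw_def endo_inj_surj finite_lessThan)
    qed (simp add: \<sigma>_def)
    moreover have "map \<sigma> [0..<n] = r" using r by (intro nth_equalityI) (auto simp: \<sigma>_def)
    ultimately show "r \<in> (\<lambda>\<sigma>. map \<sigma> [0..<n]) ` {\<sigma>. \<sigma> permutes {..<n} \<and> (\<forall>p<n. xs ! p = ys ! \<sigma> p)}"
      using r by (intro image_eqI[of _ _ \<sigma>]) (auto simp: \<sigma>_def)
  qed
qed

text \<open>A matching \<open>r\<close> eliminates the indices of \<open>v\<close> and leaves the equations below between
  those of \<open>w\<close>; every free index contributes a factor \<open>N\<close>.\<close>

definition gexps :: "mword \<Rightarrow> mword \<Rightarrow> nat list" where
  "gexps v w = (let s = succs v; t = succs w; n = length s in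
     if n = length t then
       map (\<lambda>r. num_classes n (zip (map ((!) r) s) (map ((!) t) r)))
         (matchings (concat v) (List.enumerate 0 (concat w)))
     else [])"

definition norms :: "letter list \<Rightarrow> real" where
  "norms xs = (\<Prod>x\<leftarrow>xs. letter_norm x)"

lemma prod_list_nth: "prod_list (map f xs) = (\<Prod>i<length xs. f (xs ! i))"
  for f :: "'a \<Rightarrow> 'b::comm_monoid_mult"
  by (induction xs) (simp_all add: prod.lessThan_Suc_shift del: prod.lessThan_Suc)

text \<open>Each pairing of components is a product of Kronecker deltas. Summed over the index lists
  of both words, a matching without sign contributes the constant from the norms and 2/k times the
  number of solutions of the delta equations.\<close>

lemma word_ip_gexps:
  assumes sign: "\<And>l \<sigma>. \<sigma> permutes {..<length (concat v)} \<Longrightarrow>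
    (\<forall>p<length (concat v). concat v ! p = concat w ! \<sigma> p) \<Longrightarrow> length l = length (concat v) \<Longrightarrow>
    pairing_sign (mono_of v l) \<sigma> = 1"
  shows "word_ip k N v w =
    (2 / k) ^ length (concat v) * norms (concat v) * (\<Sum>e\<leftarrow>gexps v w. real N ^ e)"
proof (cases "length (concat v) = length (concat w)")
  case False
  then have "wick k (mono_of v l) (mono_of w l') = 0"
    if "l \<in> idxs N (length (concat v))" "l' \<in> idxs N (length (concat w))" for l l'
    using that by (simp add: wick_def mono_of_def idxs_def)
  then show ?thesis using False by (simp add: word_ip_idxs gexps_def)
next
  case True
  define n where "n = length (concat v)"
  define U where "U = concat v"
  define Y where "Y = concat w"
  define s where "s = succs v"
  define t where "t = succs w"
  define K where "K = (2 / k) ^ n * norms U"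
  have lens [simp]: "length U = n" "length Y = n" "length s = n" "length t = n"
    using True by (auto simp: n_def U_def Y_def s_def t_def)
  define S where "S = {\<sigma>. \<sigma> permutes {..<n}}"
  define M where "M = {\<sigma>. \<sigma> permutes {..<n} \<and> (\<forall>p<n. U ! p = Y ! \<sigma> p)}"
  have MS: "M = {\<sigma> \<in> S. \<forall>p<n. U ! p = Y ! \<sigma> p}" by (auto simp: M_def S_def)
  have fS [simp]: "finite S" by (auto simp: S_def finite_permutations)
  then have fM [simp]: "finite M" by (simp add: MS)
  have less: "\<sigma> p < n" if "\<sigma> \<in> S" "p < n" for \<sigma> p
    using that by (metis S_def lessThan_iff mem_Collect_eq permutes_in_image)
  have sless: "s ! p < n" "t ! p < n" if "p < n" for p
    using that succs_less[of p v] succs_less[of p w] True by (auto simp: s_def t_def n_def)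
  \<comment> \<open>\<open>E\<close> says that the deltas of the matching are satisfied for all row
    and column indices.\<close>
  define E where "E l l' \<sigma> \<longleftrightarrow> (\<forall>p<n. l ! p = l' ! \<sigma> p \<and> l ! (s ! p) = l' ! (t ! \<sigma> p))"
    for l l' :: "nat list" and \<sigma>
  have K: "K = (\<Prod>p<n. 2 / k * letter_norm (U ! p))"
    unfolding K_def norms_def prod_list_nth by (simp add: prod.distrib prod_dividef power_divide)
  have wick: "wick k (mono_of v l) (mono_of w l') = (\<Sum>\<sigma>\<in>M. if E l l' \<sigma> then K else 0)"
    if l: "l \<in> idxs N n" and l': "l' \<in> idxs N n" for l l'
  proof -
    have ll [simp]: "length l = n" "length l' = n" using l l' by (auto simp: idxs_def)
    have len: "length (mono_of v l) = n" "length (mono_of w l') = n"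
      unfolding mono_of_def by (auto simp flip: U_def Y_def s_def t_def)
    have nth: "mono_of v l ! p = (U ! p, l ! p, l ! (s ! p))"
      "mono_of w l' ! p = (Y ! p, l' ! p, l' ! (t ! p))" if "p < n" for p
      using that unfolding mono_of_def by (auto simp flip: U_def Y_def s_def t_def)
    have "wick k (mono_of v l) (mono_of w l') = (\<Sum>\<sigma>\<in>S. pairing_sign (mono_of v l) \<sigma> *
        (\<Prod>i<n. comp_ip k (mono_of v l ! i) (mono_of w l' ! \<sigma> i)))"
      by (simp add: wick_def len S_def)
    also have "\<dots> = (\<Sum>\<sigma>\<in>S. if (\<forall>p<n. U ! p = Y ! \<sigma> p) then (if E l l' \<sigma> then K else 0) else 0)"
    proof (intro sum.cong HOL.refl)
      fix \<sigma> assume \<sigma>: "\<sigma> \<in> S"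
      show "pairing_sign (mono_of v l) \<sigma> *
        (\<Prod>i<n. comp_ip k (mono_of v l ! i) (mono_of w l' ! \<sigma> i)) =
        (if (\<forall>p<n. U ! p = Y ! \<sigma> p) then (if E l l' \<sigma> then K else 0) else 0)"
      proof (cases "(\<forall>p<n. U ! p = Y ! \<sigma> p) \<and> E l l' \<sigma>")
        case True
        have "pairing_sign (mono_of v l) \<sigma> = 1"
          using sign[of \<sigma> l] True \<sigma> l unfolding S_def idxs_def by (simp flip: U_def Y_def n_def)
        moreover have "(\<Prod>i<n. comp_ip k (mono_of v l ! i) (mono_of w l' ! \<sigma> i)) = K"
          unfolding K using True \<sigma> by (intro prod.cong HOL.refl) (auto simp: nth less comp_ip_def E_def)
        ultimately show ?thesis using True by simp
      next
        case False
        then obtain p where p: "p < n" "U ! p \<noteq> Y ! \<sigma> p \<or> l ! p \<noteq> l' ! \<sigma> p \<or> l ! (s ! p) \<noteq> l' ! (t ! \<sigma> p)"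
          by (auto simp: E_def)
        then have "comp_ip k (mono_of v l ! p) (mono_of w l' ! \<sigma> p) = 0"
          using \<sigma> by (auto simp: nth less comp_ip_def)
        then have "(\<Prod>i<n. comp_ip k (mono_of v l ! i) (mono_of w l' ! \<sigma> i)) = 0"
          using p by (intro prod_zero) auto
        then show ?thesis using False by auto
      qed
    qed
    also have "\<dots> = (\<Sum>\<sigma>\<in>M. if E l l' \<sigma> then K else 0)"
      unfolding MS by (rule sum.inter_filter[symmetric]) simp
    finally show ?thesis .
  qed
  have count: "(\<Sum>l\<in>idxs N n. \<Sum>l'\<in>idxs N n. if E l l' \<sigma> then K else 0) =
      K * real N ^ num_classes n (zip (map ((!) (map \<sigma> [0..<n])) s) (map ((!) t) (map \<sigma> [0..<n])))"
    if \<sigma>: "\<sigma> \<in> M" for \<sigma>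
  proof -
    have \<sigma>S: "\<sigma> \<in> S" using \<sigma> by (simp add: MS)
    \<comment> \<open>The row deltas give \<open>l ! q = l' ! \<sigma> q\<close>; inserted at
      \<open>q = s ! p\<close> into the column deltas they leave these equations between entries of
      \<open>l'\<close> alone.\<close>
    let ?es = "zip (map ((!) (map \<sigma> [0..<n])) s) (map ((!) t) (map \<sigma> [0..<n]))"
    have "?es = map (\<lambda>p. (\<sigma> (s ! p), t ! \<sigma> p)) [0..<n]"
      by (intro nth_equalityI) (simp_all add: sless)
    then have esp: "(\<forall>(a, b)\<in>set ?es. P a b) \<longleftrightarrow> (\<forall>p<n. P (\<sigma> (s ! p)) (t ! \<sigma> p))" for P
      by auto
    have inner: "(\<Sum>l\<in>idxs N n. if E l l' \<sigma> then K else 0) =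
        (if \<forall>(a, b)\<in>set ?es. l' ! a = l' ! b then K else 0)" if l': "l' \<in> idxs N n" for l'
    proof -
      \<comment> \<open>The only \<open>l\<close> compatible with \<open>l'\<close>, so the inner
        sum has at most one nonzero term.\<close>
      define l0 where "l0 = map (\<lambda>p. l' ! \<sigma> p) [0..<n]"
      have l0: "l0 \<in> idxs N n"
        using l' \<sigma>S by (auto simp: idxs_def l0_def) (metis less lessThan_iff nth_mem subsetD)
      have "E l l' \<sigma> \<longleftrightarrow> l = l0 \<and> (\<forall>(a, b)\<in>set ?es. l' ! a = l' ! b)" if "l \<in> idxs N n" for l
      proof -
        have "l = l0 \<longleftrightarrow> (\<forall>p<n. l ! p = l' ! \<sigma> p)"
          using that by (auto simp: idxs_def l0_def list_eq_iff_nth_eq)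
        then show ?thesis unfolding esp E_def by (auto simp: sless)
      qed
      then have "(\<Sum>l\<in>idxs N n. if E l l' \<sigma> then K else 0) =
        (\<Sum>l\<in>idxs N n. if l = l0 then (if \<forall>(a, b)\<in>set ?es. l' ! a = l' ! b then K else 0) else 0)"
        by (intro sum.cong HOL.refl) auto
      then show ?thesis using l0 by simp
    qed
    have "(\<Sum>l\<in>idxs N n. \<Sum>l'\<in>idxs N n. if E l l' \<sigma> then K else 0) =
      (\<Sum>l'\<in>idxs N n. \<Sum>l\<in>idxs N n. if E l l' \<sigma> then K else 0)" by (rule sum.swap)
    also have "\<dots> = (\<Sum>l'\<in>idxs N n. if \<forall>(a, b)\<in>set ?es. l' ! a = l' ! b then K else 0)"
      by (intro sum.cong HOL.refl inner)
    also have "\<dots> = (\<Sum>l'\<in>{l \<in> idxs N n. \<forall>(a, b)\<in>set ?es. l ! a = l ! b}. K)"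
      by (rule sum.inter_filter[symmetric]) simp
    also have "\<dots> = K * real (card {l \<in> idxs N n. \<forall>(a, b)\<in>set ?es. l ! a = l ! b})" by simp
    also have "card {l \<in> idxs N n. \<forall>(a, b)\<in>set ?es. l ! a = l ! b} = N ^ num_classes n ?es"
    proof (rule card_idxs_equations)
      show "\<forall>(a, b)\<in>set ?es. a < n \<and> b < n" unfolding esp using \<sigma>S by (auto intro: less sless)
    qed
    finally show ?thesis by simp
  qed
  have "word_ip k N v w = (\<Sum>l\<in>idxs N n. \<Sum>l'\<in>idxs N n. \<Sum>\<sigma>\<in>M. if E l l' \<sigma> then K else 0)"
    unfolding word_ip_idxs True[symmetric] n_def[symmetric] by (intro sum.cong HOL.refl wick)
  also have "\<dots> = (\<Sum>l\<in>idxs N n. \<Sum>\<sigma>\<in>M. \<Sum>l'\<in>idxs N n. if E l l' \<sigma> then K else 0)"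
    by (intro sum.cong HOL.refl sum.swap)
  also have "\<dots> = (\<Sum>\<sigma>\<in>M. \<Sum>l\<in>idxs N n. \<Sum>l'\<in>idxs N n. if E l l' \<sigma> then K else 0)"
    by (rule sum.swap)
  also have "\<dots> = (\<Sum>\<sigma>\<in>M. (\<lambda>r. K * real N ^ num_classes n (zip (map ((!) r) s) (map ((!) t) r)))
      (map \<sigma> [0..<n]))"
    by (intro sum.cong HOL.refl count)
  also have "\<dots> = (\<Sum>r\<in>set (matchings U (List.enumerate 0 Y)).
      K * real N ^ num_classes n (zip (map ((!) r) s) (map ((!) t) r)))"
    unfolding M_def by (rule sum.reindex_bij_betw[OF bij_betw_matchings]) simp_all
  also have "\<dots> = (\<Sum>r\<leftarrow>matchings U (List.enumerate 0 Y).
      K * real N ^ num_classes n (zip (map ((!) r) s) (map ((!) t) r)))"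
    by (subst sum_list_distinct_conv_sum_set) (auto simp: distinct_matchings)
  also have "\<dots> = K * (\<Sum>e\<leftarrow>gexps v w. real N ^ e)"
    using True by (simp add: gexps_def Let_def sum_list_const_mult o_def
        flip: U_def Y_def s_def t_def n_def)
  finally show ?thesis by (simp add: K_def U_def n_def)
qed

section \<open>Gram polynomials\<close>

lemma nferm_le_1_unique:
  assumes "nferm xs \<le> 1" "i < length xs" "j < length xs" "fermion (xs ! i)" "fermion (xs ! j)"
  shows "i = j"
proof -
  have "nferm xs = card {i. i < length xs \<and> fermion (xs ! i)}"
    by (simp add: nferm_def length_filter_conv_card)
  then have "card {i. i < length xs \<and> fermion (xs ! i)} \<le> 1" using assms(1) by simp
  moreover have "{i, j} \<subseteq> {i. i < length xs \<and> fermion (xs ! i)}" using assms by auto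
  moreover have "finite {i. i < length xs \<and> fermion (xs ! i)}" by simp
  ultimately have "card {i, j} \<le> 1" by (meson card_mono le_trans)
  then show ?thesis by (cases "i = j") auto
qed

lemma pairing_sign_1:
  assumes "nferm (map fst xs) \<le> 1" shows "pairing_sign xs \<sigma> = 1"
proof -
  have "{(i, j). i < j \<and> j < length xs \<and> fermion (fst (xs ! i)) \<and> fermion (fst (xs ! j))
     \<and> \<sigma> j < \<sigma> i} = {}"
  proof -
    have False if "i < j" "j < length xs" "fermion (fst (xs ! i))" "fermion (fst (xs ! j))" for i j
      using nferm_le_1_unique[OF assms, of i j] that by simp
    then show ?thesis by blast
  qed
  then show ?thesis unfolding pairing_sign_def by (simp only: card.empty power_0)
qed

text \<open>Absence of signs is kept as a condition on a pair of words because it has two sources: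
  at most one fermion, or the two-letter words of W_-, where two fermions occur.\<close>

definition sign_free :: "mword \<Rightarrow> mword \<Rightarrow> bool" where
  "sign_free v w \<longleftrightarrow> (\<forall>l \<sigma>. \<sigma> permutes {..<length (concat v)} \<longrightarrow>
    (\<forall>p<length (concat v). concat v ! p = concat w ! \<sigma> p) \<longrightarrow> length l = length (concat v) \<longrightarrow>
    pairing_sign (mono_of v l) \<sigma> = 1)"

lemma map_fst_mono_of: "length l = length (concat v) \<Longrightarrow> map fst (mono_of v l) = concat v"
  by (simp add: mono_of_def)

lemma sign_free_nferm: "nferm (concat v) \<le> 1 \<Longrightarrow> sign_free v w"
  by (simp add: sign_free_def pairing_sign_1 map_fst_mono_of)

text \<open>A matching that exchanges the two letters would send \<open>a\<close> to
  \<open>d\<close>; so it fixes both positions and has no inversion, even for two fermions.\<close>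

lemma sign_free_pair:
  assumes "a \<noteq> d" shows "sign_free [[a, b]] [[c, d]]"
  unfolding sign_free_def
proof (intro allI impI)
  fix l :: "nat list" and \<sigma> assume \<sigma>: "\<sigma> permutes {..<length (concat [[a, b]])}"
    "\<forall>p<length (concat [[a, b]]). concat [[a, b]] ! p = concat [[c, d]] ! \<sigma> p"
    and l: "length l = length (concat [[a, b]])"
  have "a = [c, d] ! \<sigma> 0" using \<sigma>(2)[rule_format, of 0] by simp
  moreover have "\<sigma> 0 < 2" using permutes_in_image[OF \<sigma>(1), of 0] by (simp add: numeral_2_eq_2)
  ultimately have s0: "\<sigma> 0 = 0" using assms by (cases "\<sigma> 0") auto
  have len: "length (mono_of [[a, b]] l) = 2" using l by (simp add: mono_of_def)
  have "{(i, j). i < j \<and> j < length (mono_of [[a, b]] l) \<and> fermion (fst (mono_of [[a, b]] l ! i)) \<and>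
      fermion (fst (mono_of [[a, b]] l ! j)) \<and> \<sigma> j < \<sigma> i} = {}"
    unfolding len using s0 by (auto simp: less_2_cases_iff)
  then show "pairing_sign (mono_of [[a, b]] l) \<sigma> = 1"
    unfolding pairing_sign_def by (simp only: card.empty power_0)
qed

text \<open>The Gram polynomial without its powers of 2/k and letter norms; its coefficients are
  nonnegative integers independent of \<open>k\<close>.\<close>

definition matching_poly :: "mword \<Rightarrow> mword \<Rightarrow> real poly" where
  "matching_poly v w = (\<Sum>e\<leftarrow>gexps v w. monom 1 e)"

lemma poly_eqI_nat:
  fixes p q :: "real poly"
  assumes "\<And>N. N > 0 \<Longrightarrow> poly p (real N) = poly q (real N)"
  shows "p = q"
proof (rule ccontr)
  assume "p \<noteq> q"
  then have "finite {x. poly (p - q) x = 0}" by (intro poly_roots_finite) simp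
  moreover have "real ` {0<..} \<subseteq> {x. poly (p - q) x = 0}" using assms by auto
  ultimately have "finite (real ` {0<..})" by (rule finite_subset[rotated])
  then have "finite {0::nat<..}" by (rule finite_imageD) (simp add: inj_on_def)
  then show False by (simp add: infinite_Ioi)
qed

text \<open>Polynomials agreeing at all positive integers are equal, so the definite description in
  \<open>gram_poly\<close> has exactly this solution.\<close>

lemma gram_poly_matching:
  assumes "sign_free v w"
  shows "gram_poly k v w = smult ((2 / k) ^ length (concat v) * norms (concat v)) (matching_poly v w)"
proof -
  let ?q = "smult ((2 / k) ^ length (concat v) * norms (concat v)) (matching_poly v w)"
  have "poly (\<Sum>e\<leftarrow>es. monom 1 e) x = (\<Sum>e\<leftarrow>es. x ^ e)" for es and x :: real
    by (induction es) (simp_all add: poly_monom)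
  then have q: "poly ?q (real N) = word_ip k N v w" for N
    using assms by (subst word_ip_gexps) (auto simp: sign_free_def matching_poly_def)
  show ?thesis unfolding gram_poly_def
  proof (rule the_equality)
    show "\<forall>N>0. poly ?q (real N) = word_ip k N v w" using q by blast
    fix p assume "\<forall>N>0. poly p (real N) = word_ip k N v w"
    then show "p = ?q" using q by (intro poly_eqI_nat) metis
  qed
qed

subsection \<open>Invariance under the relations\<close>

lemma wick_no_sign:
  assumes "nferm (map fst xs) \<le> 1" "length xs = length ys"
  shows "wick k xs ys = (\<Sum>\<sigma> | \<sigma> permutes {..<length xs}.
    \<Prod>i<length xs. comp_ip k (xs ! i) (ys ! \<sigma> i))"
  using assms by (simp add: wick_def pairing_sign_1)

lemma wick_sym:
  assumes "nferm (map fst xs) \<le> 1" "nferm (map fst ys) \<le> 1"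
  shows "wick k xs ys = wick k ys xs"
proof (cases "length xs = length ys")
  case True
  define n where "n = length xs"
  have "wick k xs ys = (\<Sum>\<sigma> | \<sigma> permutes {..<n}. \<Prod>i<n. comp_ip k (xs ! i) (ys ! inv_into UNIV \<sigma> i))"
    using True assms unfolding n_def by (simp add: wick_no_sign) (rule sum_permutations_inverse)
  also have "\<dots> = (\<Sum>\<sigma> | \<sigma> permutes {..<n}. \<Prod>i<n. comp_ip k (ys ! i) (xs ! \<sigma> i))"
  proof (intro sum.cong HOL.refl)
    fix \<sigma> assume "\<sigma> \<in> {\<sigma>. \<sigma> permutes {..<n}}"
    then have \<sigma>: "\<sigma> permutes {..<n}" by simp
    have "(\<Prod>i<n. comp_ip k (xs ! i) (ys ! inv_into UNIV \<sigma> i)) =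
        (\<Prod>i<n. comp_ip k (xs ! \<sigma> i) (ys ! inv_into UNIV \<sigma> (\<sigma> i)))"
      using prod.permute[OF \<sigma>, of "\<lambda>i. comp_ip k (xs ! i) (ys ! inv_into UNIV \<sigma> i)"] by (simp add: o_def)
    also have "\<dots> = (\<Prod>i<n. comp_ip k (ys ! i) (xs ! \<sigma> i))"
      using \<sigma> by (intro prod.cong HOL.refl) (auto simp: permutes_inverses comp_ip_def)
    finally show "(\<Prod>i<n. comp_ip k (xs ! i) (ys ! inv_into UNIV \<sigma> i)) =
      (\<Prod>i<n. comp_ip k (ys ! i) (xs ! \<sigma> i))" .
  qed
  also have "\<dots> = wick k ys xs" using True assms by (simp add: wick_no_sign n_def)
  finally show ?thesis .
qed (simp add: wick_def)

lemma wick_mset: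
  assumes "nferm (map fst xs) \<le> 1" "mset xs = mset xs'"
  shows "wick k xs ys = wick k xs' ys"
proof (cases "length xs = length ys")
  case True
  define n where "n = length xs'"
  have n: "length xs = n" using assms(2) by (metis n_def size_mset)
  obtain \<tau> where \<tau>: "\<tau> permutes {..<n}" "permute_list \<tau> xs' = xs"
    using assms(2) mset_eq_permutation[of xs xs'] unfolding n_def by metis
  have nth: "xs ! i = xs' ! \<tau> i" if "i < n" for i
    using \<tau> that by (metis n_def permute_list_nth)
  have f': "nferm (map fst xs') \<le> 1"
    using assms nferm_mset[of "map fst xs" "map fst xs'"] by simp
  have "wick k xs ys = (\<Sum>\<sigma> | \<sigma> permutes {..<n}. \<Prod>i<n. comp_ip k (xs' ! \<tau> i) (ys ! \<sigma> i))"
    using True assms by (simp add: wick_no_sign n nth)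
  also have "\<dots> = (\<Sum>\<sigma> | \<sigma> permutes {..<n}. \<Prod>i<n. comp_ip k (xs' ! \<tau> i) (ys ! (\<sigma> \<circ> \<tau>) i))"
    by (rule sum_permutations_compose_right[OF \<tau>(1)])
  also have "\<dots> = (\<Sum>\<sigma> | \<sigma> permutes {..<n}. \<Prod>i<n. comp_ip k (xs' ! i) (ys ! \<sigma> i))"
  proof (intro sum.cong HOL.refl)
    fix \<sigma>
    show "(\<Prod>i<n. comp_ip k (xs' ! \<tau> i) (ys ! (\<sigma> \<circ> \<tau>) i)) =
        (\<Prod>i<n. comp_ip k (xs' ! i) (ys ! \<sigma> i))"
      using prod.permute[OF \<tau>(1), of "\<lambda>i. comp_ip k (xs' ! i) (ys ! \<sigma> i)"] by (simp add: o_def)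
  qed
  also have "\<dots> = wick k xs' ys" using True f' n by (simp add: wick_no_sign n_def)
  finally show ?thesis .
next
  case False
  moreover have "length xs' = length xs" using assms(2) by (metis size_mset)
  ultimately show ?thesis by (simp add: wick_def)
qed

text \<open>With at most one fermion, Wick's formula sees a monomial only as a multiset of
  components. A word is then a sum over commutative monomials, for which rotating a trace and
  swapping traces are mere reindexings.\<close>

definition monomial_sum :: "nat \<Rightarrow> mword \<Rightarrow> (comp multiset \<Rightarrow> real) \<Rightarrow> real" where
  "monomial_sum N w f = (\<Sum>iss\<in>assignments N w. f (mset (monomial w iss)))"

lemma monomial_sum_Cons:
  "monomial_sum N (t # w) f = (\<Sum>l\<in>idxs N (length t).
     monomial_sum N w (\<lambda>m. f (mset (zip t (zip l (rotate1 l))) + m)))"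
proof -
  have "assignments N (t # w) = (\<lambda>(l, iss). l # iss) ` (idxs N (length t) \<times> assignments N w)"
  proof (intro equalityI subsetI)
    fix x assume "x \<in> assignments N (t # w)"
    then obtain z zs where "x = z # zs" "z \<in> idxs N (length t)" "zs \<in> assignments N w"
      unfolding assignments_def idxs_def list_all2_Cons2 by blast
    then show "x \<in> (\<lambda>(l, iss). l # iss) ` (idxs N (length t) \<times> assignments N w)"
      by (intro image_eqI[of _ _ "(z, zs)"]) simp_all
  qed (auto simp: assignments_def idxs_def)
  moreover have "inj_on (\<lambda>(l, iss). l # iss) (idxs N (length t) \<times> assignments N w)"
    by (auto simp: inj_on_def)
  ultimately have "monomial_sum N (t # w) f = (\<Sum>p\<in>idxs N (length t) \<times> assignments N w.
      f (mset (monomial (t # w) (fst p # snd p))))"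
    unfolding monomial_sum_def by (simp only: sum.reindex o_def split_def)
  also have "\<dots> = (\<Sum>l\<in>idxs N (length t). \<Sum>iss\<in>assignments N w.
      f (mset (monomial (t # w) (l # iss))))"
    by (simp only: sum.cartesian_product split_def)
  also have "\<dots> = (\<Sum>l\<in>idxs N (length t).
     monomial_sum N w (\<lambda>m. f (mset (zip t (zip l (rotate1 l))) + m)))"
    unfolding monomial_sum_def by (intro sum.cong HOL.refl) (simp add: monomial_def)
  finally show ?thesis .
qed

lemma monomial_sum_prefix:
  assumes "\<And>f. monomial_sum N v f = monomial_sum N w f"
  shows "monomial_sum N (us @ v) f = monomial_sum N (us @ w) f"
  by (induction us arbitrary: f) (simp_all add: assms monomial_sum_Cons)

lemma bij_betw_rotate1_idxs: "bij_betw rotate1 (idxs N n) (idxs N n)"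
proof -
  have "xs = ys" if "rotate1 xs = rotate1 ys" for xs ys :: "nat list"
    using that by (cases xs; cases ys) auto
  then have "inj_on rotate1 (idxs N n)" unfolding inj_on_def by blast
  moreover have "rotate1 ` idxs N n \<subseteq> idxs N n" by (auto simp: idxs_def)
  ultimately show ?thesis by (simp add: bij_betw_def endo_inj_surj)
qed

lemma zip_rotate1:
  assumes "length xs = length ys" shows "zip (rotate1 xs) (rotate1 ys) = rotate1 (zip xs ys)"
  using assms by (cases xs; cases ys) auto

lemma monomial_sum_rotate1:
  "monomial_sum N (rotate1 t # w) f = monomial_sum N (t # w) f"
proof -
  have zip: "mset (zip (rotate1 t) (zip (rotate1 l) (rotate1 (rotate1 l)))) =
      mset (zip t (zip l (rotate1 l)))" if "length l = length t" for l :: "nat list"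
  proof -
    have "mset (rotate1 xs) = mset xs" for xs :: "comp list" by (cases xs) simp_all
    then show ?thesis using that by (simp add: zip_rotate1)
  qed
  have "monomial_sum N (rotate1 t # w) f = (\<Sum>l\<in>idxs N (length t).
     monomial_sum N w (\<lambda>m. f (mset (zip (rotate1 t) (zip (rotate1 l) (rotate1 (rotate1 l)))) + m)))"
    unfolding monomial_sum_Cons length_rotate1
    by (rule sum.reindex_bij_betw[OF bij_betw_rotate1_idxs, symmetric])
  also have "\<dots> = monomial_sum N (t # w) f"
    unfolding monomial_sum_Cons by (intro sum.cong HOL.refl) (simp add: zip idxs_def)
  finally show ?thesis .
qed

lemma monomial_sum_swap: "monomial_sum N (t # t' # w) f = monomial_sum N (t' # t # w) f"
proof -
  have "a + (b + m) = b + (a + m)" for a b m :: "comp multiset" by (simp add: ac_simps)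
  then show ?thesis unfolding monomial_sum_Cons by (subst sum.swap) (simp only:)
qed

lemma monomial_sum_wrel: "wrel w s v \<Longrightarrow> monomial_sum N v f = monomial_sum N w f"
proof (induction rule: wrel.induct)
  case (rot s us x t vs)
  then show ?case
    using monomial_sum_prefix[of N "rotate1 (x # t) # vs" "(x # t) # vs" us f]
    by (simp add: monomial_sum_rotate1[of N "x # t", simplified])
next
  case (swap s us t t' vs)
  then show ?case
    using monomial_sum_prefix[of N "t' # t # vs" "t # t' # vs" us f] monomial_sum_swap by metis
qed simp

lemma map_fst_monomial:
  assumes "iss \<in> assignments N w" shows "map fst (monomial w iss) = concat w"
proof -
  have "concat iss \<in> idxs N (length (concat w))"
    using bij_betw_apply[OF bij_betw_concat_assignments assms] .
  then show ?thesis unfolding monomial_mono_of[OF assms]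
    by (intro map_fst_mono_of) (simp add: idxs_def)
qed

lemma word_ip_left_canon:
  assumes "canon v = canon v'" "nferm (concat v) \<le> 1"
  shows "word_ip k N v w = word_ip k N v' w"
proof -
  \<comment> \<open>A function of multisets defined through an arbitrary ordering of the components;
    \<open>wick_mset\<close> makes the choice irrelevant.\<close>
  define F where "F m = (\<Sum>jss\<in>assignments N w. wick k (SOME xs. mset xs = m) (monomial w jss))" for m
  have F: "F (mset xs) = (\<Sum>jss\<in>assignments N w. wick k xs (monomial w jss))"
    if "nferm (map fst xs) \<le> 1" for xs
  proof -
    have "mset (SOME ys. mset ys = mset xs) = mset xs" by (rule someI) (rule HOL.refl)
    then have "wick k xs ys = wick k (SOME ys. mset ys = mset xs) ys" for ys
      using wick_mset[OF that] by metis
    then show ?thesis unfolding F_def by (intro sum.cong HOL.refl) metis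
  qed
  have *: "word_ip k N u w = monomial_sum N u F" if "nferm (concat u) \<le> 1" for u
    unfolding word_ip_def monomial_sum_def
    by (intro sum.cong HOL.refl F[symmetric]) (use that in \<open>simp add: map_fst_monomial\<close>)
  have wr: "wrel v 1 v'" using assms by (simp add: wrel_iff_canon)
  then show ?thesis
    using *[of v] *[of v'] assms(2) wrel_nferm[OF wr] monomial_sum_wrel[OF wr] by simp
qed

lemma word_ip_sym:
  assumes "nferm (concat v) \<le> 1" "nferm (concat w) \<le> 1"
  shows "word_ip k N v w = word_ip k N w v"
  unfolding word_ip_def
  by (subst sum.swap) (intro sum.cong HOL.refl wick_sym; use assms in \<open>simp add: map_fst_monomial\<close>)

lemma gram_poly_sym:
  assumes "nferm (concat v) \<le> 1" "nferm (concat w) \<le> 1"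
  shows "gram_poly k v w = gram_poly k w v"
  unfolding gram_poly_def by (simp add: word_ip_sym[OF assms])

lemma gram_poly_left_canon:
  assumes "canon v = canon v'" "nferm (concat v) \<le> 1"
  shows "gram_poly k v w = gram_poly k v' w"
  unfolding gram_poly_def by (simp add: word_ip_left_canon[OF assms])

lemma canon_nferm:
  assumes "canon v = canon w" "nferm (concat v) \<le> 1" shows "nferm (concat w) = nferm (concat v)"
proof -
  have "wrel v 1 w" using assms by (simp add: wrel_iff_canon)
  then show ?thesis by (rule wrel_nferm)
qed

lemma gram_poly_right_canon:
  assumes "canon w = canon w'" "nferm (concat v) \<le> 1" "nferm (concat w) \<le> 1"
  shows "gram_poly k v w = gram_poly k v w'"
proof -
  have "nferm (concat w') \<le> 1" using canon_nferm[OF assms(1,3)] assms(3) by simp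
  then have "gram_poly k v w' = gram_poly k w' v" using assms(2) by (intro gram_poly_sym)
  moreover have "gram_poly k v w = gram_poly k w v" using assms by (intro gram_poly_sym)
  ultimately show ?thesis using gram_poly_left_canon[OF assms(1,3)] by simp
qed

section \<open>Bases and linear combinations of words\<close>

text \<open>Carries the canonical forms already met instead of testing \<open>cls\<close> against
  the selected words, so that it can be evaluated.\<close>

primrec canon_basis :: "int list list list \<Rightarrow> mword list \<Rightarrow> mword list" where
  "canon_basis seen [] = []"
| "canon_basis seen (w # ws) = (let c = canon w in
     if c \<in> set seen then canon_basis seen ws else w # canon_basis (c # seen) ws)"

lemma set_canon_basis: "set (canon_basis seen ws) \<subseteq> set ws"
  by (induction ws arbitrary: seen) (auto simp: Let_def)

lemma canon_canon_basis: "canon ` set (canon_basis seen ws) = canon ` set ws - set seen"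
  by (induction ws arbitrary: seen) (auto simp: Let_def)

lemma distinct_canon_basis: "distinct (map canon (canon_basis seen ws))"
proof (induction ws arbitrary: seen)
  case (Cons w ws)
  have "canon w \<notin> canon ` set (canon_basis (canon w # seen) ws)"
    unfolding canon_canon_basis by simp
  then show ?case using Cons by (simp add: Let_def)
qed simp

lemma word_basis_canon:
  assumes "\<And>w. w \<in> set ws \<Longrightarrow> nferm (concat w) \<le> 1"
  shows "word_basis ws = canon_basis [] ws"
proof -
  define f where
    "f = (\<lambda>w B. if cls w w = 0 \<or> (\<exists>b\<in>set B. cls w b \<noteq> 0) then B else B @ [w])"
  have "fold f ws B = B @ canon_basis seen ws" if "set seen = canon ` set B" for B seen
    using assms that
  proof (induction ws arbitrary: B seen)
    case (Cons w ws)
    have w: "nferm (concat w) \<le> 1" by (rule Cons.prems(1)) simp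
    have IH: "fold f ws B' = B' @ canon_basis seen' ws" if "set seen' = canon ` set B'" for B' seen'
      using Cons.prems(1) that by (intro Cons.IH) simp_all
    show ?case
    proof (cases "canon w \<in> set seen")
      case True
      then have "f w B = B" using Cons.prems(2) by (auto simp: f_def cls_canon[OF w])
      then show ?thesis using True IH[OF Cons.prems(2)] by (simp add: Let_def)
    next
      case False
      then have "f w B = B @ [w]" using Cons.prems(2) by (auto simp: f_def cls_canon[OF w])
      then show ?thesis using False IH[of "canon w # seen" "B @ [w]"] Cons.prems(2)
        by (simp add: Let_def)
    qed
  qed simp
  from this[of "[]" "[]"] show ?thesis by (simp add: word_basis_def f_def)
qed

text \<open>\<open>cls w\<close> vanishes on every basis word except the representative of
  \<open>w\<close>. This is how sums over a basis are eliminated: expanding \<open>w\<close> and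
  applying a class function \<open>h\<close> returns the value of \<open>h\<close> at
  \<open>w\<close> itself.\<close>

lemma sum_cls_basis:
  fixes h :: "mword \<Rightarrow> 'a::comm_ring_1"
  assumes "distinct (map canon C)" "nferm (concat w) \<le> 1" "canon w \<in> canon ` set C"
    and h: "\<And>c. c \<in> set C \<Longrightarrow> canon w = canon c \<Longrightarrow> h c = h w"
  shows "(\<Sum>i<length C. of_int (cls w (C ! i)) * h (C ! i)) = h w"
proof -
  obtain c where c: "c \<in> set C" "canon w = canon c" using assms(3) by auto
  obtain i where i: "i < length C" "C ! i = c" using c(1) by (auto simp: in_set_conv_nth)
  have eq: "canon w = canon (C ! j) \<longleftrightarrow> j = i" if "j < length C" for j
    using assms(1) that i c(2) by (auto simp: distinct_conv_nth)
  then have "(\<Sum>j<length C. of_int (cls w (C ! j)) * h (C ! j)) =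
      (\<Sum>j<length C. if j = i then h w else 0)"
  proof (intro sum.cong HOL.refl)
    fix j assume "j \<in> {..<length C}"
    moreover have "h (C ! i) = h w" using h[OF c] i(2) by simp
    ultimately show "of_int (cls w (C ! j)) * h (C ! j) = (if j = i then h w else 0)"
      using eq[of j] by (simp add: cls_canon[OF assms(2)])
  qed
  then show ?thesis using i by simp
qed

text \<open>Polynomials in \<open>N\<close> with integer coefficients are represented by coefficient lists, so that
  identities between inner products can be checked by rewriting.\<close>

fun padd :: "int list \<Rightarrow> int list \<Rightarrow> int list" where
  "padd [] q = q"
| "padd (a # p) [] = a # p"
| "padd (a # p) (b # q) = (a + b) # padd p q"

primrec pmul :: "int list \<Rightarrow> int list \<Rightarrow> int list" where
  "pmul [] q = []"
| "pmul (a # p) q = padd (map ((*) a) q) (if p = [] then [] else 0 # pmul p q)"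

primrec psum :: "int list list \<Rightarrow> int list" where
  "psum [] = []"
| "psum (p # ps) = padd p (psum ps)"

text \<open>Trailing zeros make coefficient lists non-unique, so equality is tested on the
  difference.\<close>

definition peq :: "int list \<Rightarrow> int list \<Rightarrow> bool" where
  "peq p q \<longleftrightarrow> list_all ((=) 0) (padd p (map uminus q))"

primrec peval :: "'a::comm_ring_1 \<Rightarrow> int list \<Rightarrow> 'a" where
  "peval x [] = 0"
| "peval x (a # p) = of_int a + x * peval x p"

lemma peval_padd [simp]: "peval x (padd p q) = peval x p + peval x q"
  by (induction p q rule: padd.induct) (simp_all add: algebra_simps)

lemma peval_scale [simp]: "peval x (map ((*) a) p) = of_int a * peval x p"
  by (induction p) (simp_all add: algebra_simps)

lemma peval_uminus [simp]: "peval x (map uminus p) = - peval x p"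
  by (induction p) (simp_all add: algebra_simps)

lemma peval_pmul [simp]: "peval x (pmul p q) = peval x p * peval x q"
  by (induction p) (simp_all add: algebra_simps)

lemma peval_psum: "peval x (psum ps) = (\<Sum>p\<leftarrow>ps. peval x p)"
  by (induction ps) simp_all

lemma peval_peq: "peq p q \<Longrightarrow> peval x p = peval x q"
proof -
  have "list_all ((=) 0) r \<Longrightarrow> peval x r = 0" for r by (induction r) auto
  moreover assume "peq p q"
  ultimately have "peval x (padd p (map uminus q)) = 0" unfolding peq_def by blast
  then show ?thesis by simp
qed

section \<open>Linear combinations of words without reduction to a basis\<close>

definition gram_coeffs :: "mword \<Rightarrow> mword \<Rightarrow> int list" where
  "gram_coeffs v w = psum (map (\<lambda>e. replicate e 0 @ [1]) (gexps v w))"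

type_synonym lincomb = "(int list \<times> mword) list"

definition gram_lin :: "lincomb \<Rightarrow> lincomb \<Rightarrow> int list" where
  "gram_lin xs ys =
     psum (map (\<lambda>(p, v). pmul p (psum (map (\<lambda>(q, w). pmul q (gram_coeffs v w)) ys))) xs)"

text \<open>Discarding the terms with a vanishing epsilon keeps later evaluations short.\<close>

definition Q_lin :: "lincomb \<Rightarrow> lincomb" where
  "Q_lin xs = concat (map (\<lambda>(p, v). map (\<lambda>(c, w). (map ((*) c) p, w))
     (filter (\<lambda>(c, w). c \<noteq> 0) (Q_word v))) xs)"

text \<open>A combination enters only through its values under such linear extensions, so equivalent
  words in it need not be identified.\<close>

definition lin :: "(mword \<Rightarrow> ratfun) \<Rightarrow> lincomb \<Rightarrow> ratfun" where
  "lin h xs = (\<Sum>(p, w)\<leftarrow>xs. peval Nvar p * h w)"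

lemma lin_simps [simp]: "lin h [] = 0" "lin h ((p, w) # xs) = peval Nvar p * h w + lin h xs"
  "lin h (xs @ ys) = lin h xs + lin h ys"
  by (simp_all add: lin_def)

lemma lin_cong: "(\<And>p w. (p, w) \<in> set xs \<Longrightarrow> h w = h' w) \<Longrightarrow> lin h xs = lin h' xs"
  unfolding lin_def by (intro arg_cong[of _ _ sum_list] map_cong) auto

lemma lin_sum: "(\<Sum>i\<in>I. a i * lin (h i) xs) = lin (\<lambda>w. \<Sum>i\<in>I. a i * h i w) xs"
proof (induction xs)
  case (Cons x xs)
  obtain p w where x: "x = (p, w)" by (cases x)
  have "(\<Sum>i\<in>I. a i * lin (h i) (x # xs)) =
      peval Nvar p * (\<Sum>i\<in>I. a i * h i w) + (\<Sum>i\<in>I. a i * lin (h i) xs)"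
    by (simp add: x sum_distrib_left sum.distrib algebra_simps)
  then show ?case using Cons by (simp add: x)
qed simp

definition gram_fract :: "mword \<Rightarrow> mword \<Rightarrow> ratfun" where
  "gram_fract v w = to_fract (matching_poly v w)"

lemma to_fract_power: "to_fract (p ^ n) = to_fract p ^ n"
  by (induction n) (simp_all add: to_fract_mult)

lemma gram_fract_coeffs: "peval Nvar (gram_coeffs v w) = gram_fract v w"
proof -
  have e: "peval Nvar (replicate e 0 @ [1]) = Nvar ^ e" for e by (induction e) simp_all
  have "to_fract (\<Sum>e\<leftarrow>es. monom 1 e) = (\<Sum>e\<leftarrow>es. Nvar ^ e)" for es
    by (induction es) (simp_all add: Nvar_def monom_altdef to_fract_power to_fract_add)
  then show ?thesis
    by (simp add: gram_coeffs_def gram_fract_def matching_poly_def peval_psum o_def e)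
qed

lemma peval_gram_lin: "peval Nvar (gram_lin xs ys) = lin (\<lambda>v. lin (gram_fract v) ys) xs"
proof -
  have "peval Nvar (psum (map (\<lambda>(q, w). pmul q (gram_coeffs v w)) ys)) = lin (gram_fract v) ys" for v
    by (induction ys) (auto simp: gram_fract_coeffs)
  then show ?thesis unfolding gram_lin_def by (induction xs) auto
qed

lemma lin_Q_word:
  "(\<Sum>(c, w)\<leftarrow>Q_word v. of_int c * h w) = lin h (Q_lin [([1], v)])"
proof -
  have "(\<Sum>(c, w)\<leftarrow>xs. of_int c * h w) =
      lin h (map (\<lambda>(c, w). (map ((*) c) [1], w)) (filter (\<lambda>(c, w). c \<noteq> 0) xs))" for xs
    by (induction xs) auto
  then show ?thesis by (simp add: Q_lin_def)
qed

lemma lin_Q_lin: "lin h (Q_lin xs) = lin (\<lambda>v. lin h (Q_lin [([1], v)])) xs"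
proof (induction xs)
  case (Cons x xs)
  obtain p v where x: "x = (p, v)" by (cases x)
  have "lin h (map (\<lambda>(c, w). (map ((*) c) p, w)) ys) =
      peval Nvar p * lin h (map (\<lambda>(c, w). (map ((*) c) [1], w)) ys)" for ys
    by (induction ys) (auto simp: algebra_simps)
  then have "lin h (Q_lin [(p, v)]) = peval Nvar p * lin h (Q_lin [([1], v)])"
    by (simp add: Q_lin_def)
  moreover have "lin h (Q_lin (x # xs)) = lin h (Q_lin [(p, v)]) + lin h (Q_lin xs)"
    by (simp add: Q_lin_def x)
  ultimately show ?case using Cons by (simp add: x)
qed (simp add: Q_lin_def)

section \<open>Explicit bases\<close>

text \<open>The result of the basis selection, written out once so that later evaluations can use it
  directly: 32 single-trace and 32 double-trace words.\<close>

definition W0_words :: "mword list" where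
  "W0_words =
   [
    [[Phi A1, Phib A1, Phi A1, Psib A1]], [[Phi A1, Phib A1, Phi A1, Psib A2]],
    [[Phi A1, Phib A1, Phi A2, Psib A1]], [[Phi A1, Phib A1, Phi A2, Psib A2]],
    [[Phi A1, Phib A1, Psi A1, Phib A1]], [[Phi A1, Phib A1, Psi A1, Phib A2]],
    [[Phi A1, Phib A1, Psi A2, Phib A1]], [[Phi A1, Phib A1, Psi A2, Phib A2]],
    [[Phi A1, Phib A2, Phi A1, Psib A1]], [[Phi A1, Phib A2, Phi A1, Psib A2]],
    [[Phi A1, Phib A2, Phi A2, Psib A1]], [[Phi A1, Phib A2, Phi A2, Psib A2]],
    [[Phi A1, Phib A2, Psi A1, Phib A1]], [[Phi A1, Phib A2, Psi A1, Phib A2]],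
    [[Phi A1, Phib A2, Psi A2, Phib A1]], [[Phi A1, Phib A2, Psi A2, Phib A2]],
    [[Phi A1, Psib A1, Phi A2, Phib A1]], [[Phi A1, Psib A1, Phi A2, Phib A2]],
    [[Phi A1, Psib A2, Phi A2, Phib A1]], [[Phi A1, Psib A2, Phi A2, Phib A2]],
    [[Phi A2, Phib A1, Phi A2, Psib A1]], [[Phi A2, Phib A1, Phi A2, Psib A2]],
    [[Phi A2, Phib A1, Psi A1, Phib A1]], [[Phi A2, Phib A1, Psi A1, Phib A2]],
    [[Phi A2, Phib A1, Psi A2, Phib A1]], [[Phi A2, Phib A1, Psi A2, Phib A2]],
    [[Phi A2, Phib A2, Phi A2, Psib A1]], [[Phi A2, Phib A2, Phi A2, Psib A2]],
    [[Phi A2, Phib A2, Psi A1, Phib A1]], [[Phi A2, Phib A2, Psi A1, Phib A2]],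
    [[Phi A2, Phib A2, Psi A2, Phib A1]], [[Phi A2, Phib A2, Psi A2, Phib A2]],
    [[Phi A1, Phib A1], [Phi A1, Psib A1]], [[Phi A1, Phib A1], [Phi A1, Psib A2]],
    [[Phi A1, Phib A1], [Phi A2, Psib A1]], [[Phi A1, Phib A1], [Phi A2, Psib A2]],
    [[Phi A1, Phib A1], [Psi A1, Phib A1]], [[Phi A1, Phib A1], [Psi A1, Phib A2]],
    [[Phi A1, Phib A1], [Psi A2, Phib A1]], [[Phi A1, Phib A1], [Psi A2, Phib A2]],
    [[Phi A1, Phib A2], [Phi A1, Psib A1]], [[Phi A1, Phib A2], [Phi A1, Psib A2]],
    [[Phi A1, Phib A2], [Phi A2, Psib A1]], [[Phi A1, Phib A2], [Phi A2, Psib A2]],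
    [[Phi A1, Phib A2], [Psi A1, Phib A1]], [[Phi A1, Phib A2], [Psi A1, Phib A2]],
    [[Phi A1, Phib A2], [Psi A2, Phib A1]], [[Phi A1, Phib A2], [Psi A2, Phib A2]],
    [[Phi A1, Psib A1], [Phi A2, Phib A1]], [[Phi A1, Psib A1], [Phi A2, Phib A2]],
    [[Phi A1, Psib A2], [Phi A2, Phib A1]], [[Phi A1, Psib A2], [Phi A2, Phib A2]],
    [[Phi A2, Phib A1], [Phi A2, Psib A1]], [[Phi A2, Phib A1], [Phi A2, Psib A2]],
    [[Phi A2, Phib A1], [Psi A1, Phib A1]], [[Phi A2, Phib A1], [Psi A1, Phib A2]],
    [[Phi A2, Phib A1], [Psi A2, Phib A1]], [[Phi A2, Phib A1], [Psi A2, Phib A2]],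
    [[Phi A2, Phib A2], [Phi A2, Psib A1]], [[Phi A2, Phib A2], [Phi A2, Psib A2]],
    [[Phi A2, Phib A2], [Psi A1, Phib A1]], [[Phi A2, Phib A2], [Psi A1, Phib A2]],
    [[Phi A2, Phib A2], [Psi A2, Phib A1]], [[Phi A2, Phib A2], [Psi A2, Phib A2]]]"

definition Wminus_words :: "mword list" where
  "Wminus_words =
    [[[Phi a, DPhib b]]. a \<leftarrow> [A1, A2], b \<leftarrow> [A1, A2]] @
    [[[DPhi a, Phib b]]. a \<leftarrow> [A1, A2], b \<leftarrow> [A1, A2]] @
    [[[Psi a, Psib b]]. a \<leftarrow> [A1, A2], b \<leftarrow> [A1, A2]]"

definition Wplus_words :: "mword list" where
  "Wplus_words =
    (let us = [Phi A1, Phi A2];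
         bs = [Phib A1, Phib A2]
     in [[[u, v, u', v', u'', v'']].
          u \<leftarrow> us, v \<leftarrow> bs, u' \<leftarrow> us, v' \<leftarrow> bs, u'' \<leftarrow> us, v'' \<leftarrow> bs] @
        [[[u, v, u', v'], [u'', v'']].
          u \<leftarrow> us, v \<leftarrow> bs, u' \<leftarrow> us, v' \<leftarrow> bs, u'' \<leftarrow> us, v'' \<leftarrow> bs] @
        [[[u, v], [u', v'], [u'', v'']].
          u \<leftarrow> us, v \<leftarrow> bs, u' \<leftarrow> us, v' \<leftarrow> bs, u'' \<leftarrow> us, v'' \<leftarrow> bs])"

lemma canon_basis_W0: "canon_basis []
   (let us = [Phi A1, Phi A2, Psi A1, Psi A2];
        bs = [Phib A1, Phib A2, Psib A1, Psib A2]
    in filter (\<lambda>w. nferm (concat w) = 1)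
      ([[[u, v, u', v']]. u \<leftarrow> us, v \<leftarrow> bs, u' \<leftarrow> us, v' \<leftarrow> bs] @
       [[[u, v], [u', v']]. u \<leftarrow> us, v \<leftarrow> bs, u' \<leftarrow> us, v' \<leftarrow> bs])) = W0_words"
  by code_simp

lemma W0_basis_eq: "W0_basis = W0_words"
proof -
  have "nferm (concat w) \<le> 1" if "w \<in> set (filter (\<lambda>w. nferm (concat w) = 1) ws)" for w ws
    using that by simp
  then show ?thesis unfolding W0_basis_def canon_basis_W0[symmetric] Let_def
    by (intro word_basis_canon)
qed

lemma Wplus_words_nferm: "w \<in> set Wplus_words \<Longrightarrow> nferm (concat w) = 0"
  by (auto simp: Wplus_words_def Let_def)

lemma Wplus_basis_eq: "Wplus_basis = canon_basis [] Wplus_words"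
proof -
  have "Wplus_basis = word_basis Wplus_words"
    by (simp only: Wplus_basis_def Wplus_words_def Let_def)
  then show ?thesis using word_basis_canon[of Wplus_words] Wplus_words_nferm by simp
qed

lemma Q_lin_W0:
  "list_all (\<lambda>b. list_all (\<lambda>(p, w). nferm (concat w) = 0 \<and> canon w \<in> set (map canon Wplus_words))
     (Q_lin [([1], b)])) W0_words"
proof -
  \<comment> \<open>The \<open>let\<close> is there to share the list of canonical forms among all
    words tested.\<close>
  have "(let P = map canon Wplus_words in list_all (\<lambda>b. list_all (\<lambda>(p, w).
      nferm (concat w) = 0 \<and> canon w \<in> set P) (Q_lin [([1], b)])) W0_words)"
    by code_simp
  then show ?thesis by (simp only: Let_def)
qed

lemma Q_lin_Wminus:
  "list_all (\<lambda>m. list_all (\<lambda>(p, w). nferm (concat w) = 1 \<and> canon w \<in> set (map canon W0_words))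
     (Q_lin [([1], m)])) Wminus_words"
proof -
  have "(let P = map canon W0_words in list_all (\<lambda>m. list_all (\<lambda>(p, w).
      nferm (concat w) = 1 \<and> canon w \<in> set P) (Q_lin [([1], m)])) Wminus_words)"
    by code_simp
  then show ?thesis by (simp only: Let_def)
qed

lemma W0_words_nferm: "list_all (\<lambda>w. nferm (concat w) = 1) W0_words"
  by code_simp

lemma W0_words_length: "list_all (\<lambda>w. length (concat w) = 4) W0_words"
  by code_simp

text \<open>The exponent 4 occurs exactly on the diagonal: the Gram matrix is invertible since its
  determinant is dominated by the diagonal at large \<open>N\<close>.\<close>

lemma gexps_W0_offdiag:
  "list_all (\<lambda>v. list_all (\<lambda>w. v = w \<or> list_all (\<lambda>e. e < 4) (gexps v w)) W0_words) W0_words"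
  by code_simp

lemma gexps_W0_diag: "list_all (\<lambda>v. 4 \<in> set (gexps v v) \<and> list_all (\<lambda>e. e \<le> 4) (gexps v v)) W0_words"
  by code_simp

section \<open>Inverting the Gram matrices\<close>

text \<open>Words of W_- can carry two fermions, where the canonical form loses signs. The orbit of
  a two-letter trace is small enough to be listed, and the two signs of a full turn cancel.\<close>

lemma wrel_pair:
  "wrel [[x, y]] s v \<Longrightarrow> v = [[x, y]] \<and> s = 1 \<or> v = [[y, x]] \<and> s = koszul [x] [y]"
proof (induction rule: wrel.induct)
  case (rot s us z t vs)
  have kk: "koszul [x] [y] * koszul [y] [x] = 1"
    by (simp add: koszul_def)
  have "us = [] \<and> vs = [] \<and> (z # t = [x, y] \<and> s = 1 \<or> z # t = [y, x] \<and> s = koszul [x] [y])"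
    using rot.IH by (cases us) auto
  then show ?case using kk by auto
next
  case (swap s us t t' vs)
  then show ?case by (cases us) auto
qed simp

lemma cls_pair:
  assumes "x \<noteq> y" "x \<noteq> y'"
  shows "cls [[x, y]] [[x', y']] = (if x = x' \<and> y = y' then 1 else 0)"
proof -
  have "wrel [[x, y]] 1 [[x, y]]" by (rule wrel.refl)
  moreover have "\<not> wrel [[x, y]] s [[x', y']]" if "x \<noteq> x' \<or> y \<noteq> y'" for s
    using wrel_pair[of x y s "[[x', y']]"] that assms by auto
  moreover have "\<not> wrel [[x, y]] (- 1) [[x, y]]"
    using wrel_pair[of x y "- 1" "[[x, y]]"] assms by auto
  ultimately show ?thesis by (auto simp: cls_def)
qed

text \<open>All these words start with the unbarred letter, so no two of them are proper rotations
  of each other.\<close>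

definition is_pair :: "mword \<Rightarrow> bool" where
  "is_pair w \<longleftrightarrow> (\<exists>a b. w \<in> {[[Phi a, DPhib b]], [[DPhi a, Phib b]], [[Psi a, Psib b]]})"

lemma Wminus_words_pair: "w \<in> set Wminus_words \<Longrightarrow> is_pair w"
  by (auto simp: Wminus_words_def is_pair_def)

lemma cls_is_pair:
  assumes "is_pair v" "is_pair w" shows "cls v w = (if v = w then 1 else 0)"
  using assms unfolding is_pair_def by (elim exE insertE emptyE) (auto simp: cls_pair)

lemma distinct_Wminus_words: "distinct Wminus_words"
  by (simp add: Wminus_words_def)

lemma Wminus_basis_eq: "Wminus_basis = Wminus_words"
proof -
  define f where
    "f = (\<lambda>w B. if cls w w = 0 \<or> (\<exists>b\<in>set B. cls w b \<noteq> 0) then B else B @ [w])"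
  have "fold f ws B = B @ ws" if "distinct (B @ ws)" "\<forall>w\<in>set (B @ ws). is_pair w" for B ws
    using that
  proof (induction ws arbitrary: B)
    case (Cons w ws)
    have w: "is_pair w" "\<forall>b\<in>set B. is_pair b \<and> w \<noteq> b" using Cons.prems by auto
    then have "\<forall>b\<in>set B. cls w b = 0" by (metis cls_is_pair)
    then have "f w B = B @ [w]" using w(1) unfolding f_def by (simp add: cls_is_pair)
    then show ?case using Cons by simp
  qed simp
  from this[of "[]" Wminus_words] have "fold f Wminus_words [] = Wminus_words"
    using distinct_Wminus_words Wminus_words_pair by simp
  moreover have "Wminus_basis = word_basis Wminus_words"
    by (simp only: Wminus_basis_def Wminus_words_def)
  ultimately show ?thesis by (simp add: word_basis_def f_def)
qed

text \<open>The reciprocal of the product of letter norms: a word of W_- without fermions has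
  exactly one differentiated letter, of norm 1/2. Being an integer, it can enter the coefficient
  lists.\<close>

definition minus_weight :: "mword \<Rightarrow> int" where
  "minus_weight m = (if nferm (concat m) = 0 then 2 else 1)"

lemma norms_simps [simp]: "norms [] = 1" "norms (x # xs) = letter_norm x * norms xs"
  by (simp_all add: norms_def)

lemma minus_weight_norms:
  assumes "is_pair m" shows "norms (concat m) * of_int (minus_weight m) = 1"
  using assms by (auto simp: is_pair_def minus_weight_def)

lemma gexps_Wminus:
  "list_all (\<lambda>v. list_all (\<lambda>w. gexps v w = (if v = w then [2] else [])) Wminus_words) Wminus_words"
  by code_simp

lemma sign_free_is_pair: "is_pair v \<Longrightarrow> is_pair w \<Longrightarrow> sign_free v w"
  unfolding is_pair_def by (elim exE insertE emptyE) (auto intro!: sign_free_pair)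

lemma const_mult: "const (a * b) = const a * const b"
  by (simp add: const_def flip: to_fract_mult)

lemma const_1 [simp]: "const 1 = 1"
  by (simp add: const_def flip: to_fract_1)

lemma const_0_iff [simp]: "const a = 0 \<longleftrightarrow> a = 0"
  by (simp add: const_def to_fract_eq_0_iff)

lemma const_power: "const (a ^ n) = const a ^ n"
  by (induction n) (simp_all add: const_mult)


lemma const_of_int: "const (of_int a) = of_int a"
proof -
  have add: "const (x + y) = const x + const y" for x y
    by (simp add: const_def flip: to_fract_add)
  have zero: "const 0 = 0" by (simp add: const_def)
  have nat: "const (of_nat n) = of_nat n" for n
    by (induction n) (simp_all add: add zero)
  have "const (- of_nat n) = - of_nat n" for n
    using add[of "- of_nat n" "of_nat n"] zero by (simp add: nat eq_neg_iff_add_eq_0)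
  then show ?thesis by (cases a) (simp_all add: nat del: of_nat_Suc)
qed

lemma Nvar_nonzero [simp]: "Nvar \<noteq> 0"
  by (simp add: Nvar_def to_fract_eq_0_iff)

lemma to_fract_gram_poly:
  assumes "sign_free v w"
  shows "to_fract (gram_poly k v w) =
    const ((2 / k) ^ length (concat v) * norms (concat v)) * gram_fract v w"
  by (simp add: gram_poly_matching[OF assms] const_def gram_fract_def flip: to_fract_mult)

lemma invertible_mat_inverse:
  fixes G :: "'a::field mat"
  assumes G: "G \<in> carrier_mat n n" and inj: "\<And>v. v \<in> carrier_vec n \<Longrightarrow> G *\<^sub>v v = 0\<^sub>v n \<Longrightarrow> v = 0\<^sub>v n"
  shows "the (mat_inverse G) \<in> carrier_mat n n" "G * the (mat_inverse G) = 1\<^sub>m n"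
    "the (mat_inverse G) * G = 1\<^sub>m n"
proof -
  have "det G \<noteq> 0" using inj det_0_iff_vec_prod_zero_field[OF G] by blast
  then have "G \<in> Units (ring_mat TYPE('a) n ())" by (rule det_non_zero_imp_unit[OF G])
  then obtain B where B: "mat_inverse G = Some B"
    using mat_inverse(1)[OF G, where b = "()"] by (cases "mat_inverse G") auto
  from mat_inverse(2)[OF G this] B
  show "the (mat_inverse G) \<in> carrier_mat n n" "G * the (mat_inverse G) = 1\<^sub>m n"
    "the (mat_inverse G) * G = 1\<^sub>m n" by auto
qed

lemma smult_mat_mult_vec:
  fixes c :: "'a::comm_ring_1"
  assumes "A \<in> carrier_mat n m" "v \<in> carrier_vec m"
  shows "(c \<cdot>\<^sub>m A) *\<^sub>v v = c \<cdot>\<^sub>v (A *\<^sub>v v)"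
  using assms by (intro eq_vecI) (auto simp: scalar_prod_def sum_distrib_left mult.assoc)

lemma mult_mat_vec_nth:
  assumes "A \<in> carrier_mat n m" "v \<in> carrier_vec m" "i < n"
  shows "(A *\<^sub>v v) $ i = (\<Sum>j<m. A $$ (i, j) * v $ j)"
  using assms by (auto simp: scalar_prod_def lessThan_atLeast0 intro!: sum.cong)

text \<open>Different words of W_- have no matching and each word has a single one with itself, so
  the Gram matrix is diagonal with entries (2/k)^2 N^2 times the letter norms, and its inverse acts
  entrywise.\<close>

lemma gram_minus_inverse:
  assumes k: "k \<noteq> 0"
  defines "Gi \<equiv> the (mat_inverse (gram_mat k Wminus_basis))"
  shows "Gi \<in> carrier_mat 12 12"
    and "v \<in> carrier_vec 12 \<Longrightarrow> i < 12 \<Longrightarrow> (Gi *\<^sub>v v) $ i =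
      const (inverse ((2 / k)\<^sup>2)) * of_int (minus_weight (Wminus_words ! i)) / Nvar\<^sup>2 * v $ i"
proof -
  let ?G = "gram_mat k Wminus_basis"
  have len: "length Wminus_words = 12" by (simp add: Wminus_words_def)
  have pair: "is_pair (Wminus_words ! i)" if "i < 12" for i
    using that len Wminus_words_pair by simp
  define d where "d i = const ((2 / k)\<^sup>2 * norms (concat (Wminus_words ! i))) * Nvar\<^sup>2" for i
  have G: "?G \<in> carrier_mat 12 12" by (simp add: gram_mat_def Wminus_basis_eq len)
  have entry: "?G $$ (i, j) = (if i = j then d i else 0)" if "i < 12" "j < 12" for i j
  proof -
    have "gexps (Wminus_words ! i) (Wminus_words ! j) = (if i = j then [2] else [])"
      using gexps_Wminus that len distinct_Wminus_words
      unfolding list_all_length by (simp add: nth_eq_iff_index_eq)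
    then have "gram_fract (Wminus_words ! i) (Wminus_words ! j) = (if i = j then Nvar\<^sup>2 else 0)"
      by (simp add: gram_fract_def matching_poly_def Nvar_def monom_altdef to_fract_power)
    moreover have "length (concat (Wminus_words ! i)) = 2"
      using pair[OF that(1)] by (auto simp: is_pair_def)
    ultimately show ?thesis
      using that by (simp add: gram_mat_def Wminus_basis_eq len d_def
          to_fract_gram_poly[OF sign_free_is_pair[OF pair pair]])
  qed
  have Gv: "(?G *\<^sub>v v) $ i = d i * v $ i" if "v \<in> carrier_vec 12" "i < 12" for v i
  proof -
    have "(?G *\<^sub>v v) $ i = (\<Sum>j<12. if j = i then d i * v $ i else 0)"
      unfolding mult_mat_vec_nth[OF G that] by (intro sum.cong HOL.refl) (simp add: entry that)
    then show ?thesis using that by simp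
  qed
  have dw: "d i * (const (inverse ((2 / k)\<^sup>2)) * of_int (minus_weight (Wminus_words ! i)) / Nvar\<^sup>2) = 1"
    if "i < 12" for i
  proof -
    have "d i * (const (inverse ((2 / k)\<^sup>2)) * of_int (minus_weight (Wminus_words ! i)) / Nvar\<^sup>2) =
      const ((2 / k)\<^sup>2 * norms (concat (Wminus_words ! i)) * inverse ((2 / k)\<^sup>2) *
        of_int (minus_weight (Wminus_words ! i)))"
      by (simp add: d_def const_mult const_of_int)
    also have "(2 / k)\<^sup>2 * norms (concat (Wminus_words ! i)) * inverse ((2 / k)\<^sup>2) *
        of_int (minus_weight (Wminus_words ! i)) =
      norms (concat (Wminus_words ! i)) * of_int (minus_weight (Wminus_words ! i))"
      using k by (simp add: field_simps)
    also have "\<dots> = 1" by (rule minus_weight_norms[OF pair[OF that]])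
    finally show ?thesis by (simp only: const_1)
  qed
  have inj: "v = 0\<^sub>v 12" if "v \<in> carrier_vec 12" "?G *\<^sub>v v = 0\<^sub>v 12" for v
  proof (rule eq_vecI)
    fix i assume "i < dim_vec (0\<^sub>v 12 :: ratfun vec)"
    then have i: "i < 12" by simp
    then have "d i * v $ i = 0" using Gv[OF that(1) i] that(2) by simp
    moreover have "d i \<noteq> 0" using dw[OF i] by (metis mult_zero_left zero_neq_one)
    ultimately show "v $ i = 0\<^sub>v 12 $ i" using i by simp
  qed (use that in simp)
  note inv = invertible_mat_inverse[OF G inj, folded Gi_def]
  show Gi: "Gi \<in> carrier_mat 12 12" by (rule inv(1))
  assume v: "v \<in> carrier_vec 12" and i: "i < 12"
  have u: "Gi *\<^sub>v v \<in> carrier_vec 12" using Gi v by simp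
  have "?G *\<^sub>v (Gi *\<^sub>v v) = v"
    using assoc_mult_mat_vec[OF G Gi v] inv(2) v by simp
  then have "v $ i = d i * (Gi *\<^sub>v v) $ i" using Gv[OF u i] by simp
  moreover have "c * (d i * y) = (d i * c) * y" for c y by (simp only: ac_simps)
  ultimately show "(Gi *\<^sub>v v) $ i =
      const (inverse ((2 / k)\<^sup>2)) * of_int (minus_weight (Wminus_words ! i)) / Nvar\<^sup>2 * v $ i"
    by (simp only: dw[OF i] mult_1)
qed

text \<open>In a polynomial kernel vector take an entry of maximal degree. In its row the diagonal
  term has larger degree than all the others, so the row cannot sum to zero.\<close>

lemma poly_mat_dominant_diagonal:
  fixes P :: "real poly mat"
  assumes P: "P \<in> carrier_mat n n"
    and off: "\<And>i j. i < n \<Longrightarrow> j < n \<Longrightarrow> i \<noteq> j \<Longrightarrow> degree (P $$ (i, j)) < e"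
    and diag: "\<And>i. i < n \<Longrightarrow> degree (P $$ (i, i)) = e \<and> P $$ (i, i) \<noteq> 0"
    and e: "e > 0"
  shows "det P \<noteq> 0"
proof
  assume "det P = 0"
  then obtain v where v: "v \<in> carrier_vec n" "v \<noteq> 0\<^sub>v n" "P *\<^sub>v v = 0\<^sub>v n"
    using det_0_iff_vec_prod_zero[OF P] by blast
  define I where "I = {i. i < n \<and> v $ i \<noteq> 0}"
  have "I \<noteq> {}"
  proof
    assume "I = {}"
    then have "v $ i = 0" if "i < n" for i using that unfolding I_def by blast
    then have "v = 0\<^sub>v n" using v(1) by (intro eq_vecI) simp_all
    then show False using v(2) by blast
  qed
  have "finite I" by (simp add: I_def)
  obtain i where i: "i \<in> I" and di: "(MAX j\<in>I. degree (v $ j)) = degree (v $ i)"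
    by (rule obtains_MAX[OF \<open>finite I\<close> \<open>I \<noteq> {}\<close>, of "\<lambda>j. degree (v $ j)"])
  have max: "degree (v $ j) \<le> degree (v $ i)" if "j \<in> I" for j
    unfolding di[symmetric] using that \<open>finite I\<close> by (intro Max_ge) auto
  let ?d = "degree (v $ i) + e"
  have i': "i < n" "v $ i \<noteq> 0" using i by (auto simp: I_def)
  have "coeff (P $$ (i, j) * v $ j) ?d = 0" if "j < n" "j \<noteq> i" for j
  proof (cases "v $ j = 0")
    case False
    then have "degree (v $ j) \<le> degree (v $ i)" using that by (intro max) (simp add: I_def)
    moreover have "degree (P $$ (i, j)) < e" using off[OF i'(1) that(1)] that(2) by blast
    ultimately have "degree (P $$ (i, j) * v $ j) < ?d"
      using degree_mult_le[of "P $$ (i, j)" "v $ j"] by linarith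
    then show ?thesis by (rule coeff_eq_0)
  qed simp
  then have "(\<Sum>j<n. coeff (P $$ (i, j) * v $ j) ?d) =
      (\<Sum>j<n. if j = i then coeff (P $$ (i, i) * v $ i) ?d else 0)"
    by (intro sum.cong HOL.refl) (simp split: if_split)
  moreover have "(\<Sum>j<n. coeff (P $$ (i, j) * v $ j) ?d) = coeff ((P *\<^sub>v v) $ i) ?d"
    by (simp add: mult_mat_vec_nth[OF P v(1) i'(1)] coeff_sum)
  ultimately have "coeff (P $$ (i, i) * v $ i) ?d = 0" using i' v(3) by simp
  moreover have "degree (P $$ (i, i) * v $ i) = ?d"
    using diag[OF i'(1)] i'(2) degree_mult_eq[of "P $$ (i, i)" "v $ i"] by linarith
  ultimately have "lead_coeff (P $$ (i, i) * v $ i) = 0" by (simp only:)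
  then have "P $$ (i, i) * v $ i = 0" by (simp only: leading_coeff_0_iff)
  then show False using diag[OF i'(1)] i'(2) by simp
qed

lemma coeff_sum_list_monom: "coeff (\<Sum>e\<leftarrow>es. monom (1::real) e) n = real (count_list es n)"
  by (induction es) auto

lemma length_W0_words: "length W0_words = 64"
  by (simp add: W0_words_def)

lemma distinct_canon_W0: "distinct (map canon W0_words)"
  unfolding canon_basis_W0[symmetric] by (rule distinct_canon_basis)

lemma distinct_W0_words: "distinct W0_words"
  using distinct_canon_W0 by (simp add: distinct_map)

lemma W0_nferm: "w \<in> set W0_words \<Longrightarrow> nferm (concat w) = 1"
  using W0_words_nferm by (simp add: list_all_iff)

lemma W0_words_undifferentiated:
  "list_all (\<lambda>w. list_all (\<lambda>x. case x of DPhi _ \<Rightarrow> False | DPhib _ \<Rightarrow> False | _ \<Rightarrow> True) (concat w)) W0_words"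
  by code_simp

lemma W0_words_norms:
  assumes "w \<in> set W0_words" shows "norms (concat w) = 1"
proof -
  have "norms xs = 1"
    if "list_all (\<lambda>x. case x of DPhi _ \<Rightarrow> False | DPhib _ \<Rightarrow> False | _ \<Rightarrow> True) xs" for xs
    using that by (induction xs) (auto split: letter.splits)
  then show ?thesis using assms W0_words_undifferentiated by (simp add: list_all_iff)
qed

lemma gram_W0_entry:
  assumes "i < 64" "j < 64"
  shows "gram_mat k W0_basis $$ (i, j) =
    const ((2 / k) ^ 4) * gram_fract (W0_words ! i) (W0_words ! j)"
proof -
  have mem: "W0_words ! i \<in> set W0_words" using assms by (simp add: length_W0_words)
  have "sign_free (W0_words ! i) (W0_words ! j)" using W0_nferm[OF mem] by (simp add: sign_free_nferm)
  moreover have "length (concat (W0_words ! i)) = 4"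
    using W0_words_length mem by (simp add: list_all_iff)
  ultimately show ?thesis
    using assms by (simp add: gram_mat_def W0_basis_eq length_W0_words to_fract_gram_poly W0_words_norms[OF mem])
qed

lemma gram_W0_inverse:
  assumes k: "k \<noteq> 0"
  defines "Gi \<equiv> the (mat_inverse (gram_mat k W0_basis))"
  shows "Gi \<in> carrier_mat 64 64" "gram_mat k W0_basis * Gi = 1\<^sub>m 64"
    "Gi * gram_mat k W0_basis = 1\<^sub>m 64"
proof -
  let ?G = "gram_mat k W0_basis"
  define P where "P = mat 64 64 (\<lambda>(i, j). matching_poly (W0_words ! i) (W0_words ! j))"
  have P: "P \<in> carrier_mat 64 64" by (simp add: P_def)
  have G: "?G \<in> carrier_mat 64 64" by (simp add: gram_mat_def W0_basis_eq length_W0_words)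
  have c: "coeff (matching_poly v w) n = real (count_list (gexps v w) n)" for v w n
    by (simp add: matching_poly_def coeff_sum_list_monom)
  have z: "count_list es n = 0" if "n \<notin> set es" for es :: "nat list" and n
    using that by (simp add: count_list_0_iff)
  have "det P \<noteq> 0"
  proof (rule poly_mat_dominant_diagonal[OF P])
    fix i j :: nat assume ij: "i < 64" "j < 64" "i \<noteq> j"
    then have "W0_words ! i \<noteq> W0_words ! j"
      using distinct_W0_words by (simp add: nth_eq_iff_index_eq length_W0_words)
    then have "\<forall>e\<in>set (gexps (W0_words ! i) (W0_words ! j)). e < 4"
      using gexps_W0_offdiag[unfolded list_all_length, rule_format, of i j] ij
      by (simp add: length_W0_words all_set_conv_all_nth)
    then have "n \<notin> set (gexps (W0_words ! i) (W0_words ! j))" if "n > 3" for n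
      using that by auto
    then have "degree (matching_poly (W0_words ! i) (W0_words ! j)) \<le> 3"
      by (intro degree_le allI impI) (simp add: c z)
    then show "degree (P $$ (i, j)) < 4" using ij by (simp add: P_def)
  next
    fix i :: nat assume i: "i < 64"
    let ?es = "gexps (W0_words ! i) (W0_words ! i)"
    have es: "4 \<in> set ?es" "\<forall>e\<in>set ?es. e \<le> 4"
      using gexps_W0_diag[unfolded list_all_length, rule_format, of i] i
      by (simp_all add: length_W0_words all_set_conv_all_nth)
    have "degree (matching_poly (W0_words ! i) (W0_words ! i)) \<le> 4"
    proof (intro degree_le allI impI)
      fix n :: nat assume "4 < n"
      then have "n \<notin> set ?es" using es(2) by auto
      then show "coeff (matching_poly (W0_words ! i) (W0_words ! i)) n = 0" by (simp add: c z)
    qed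
    moreover have "coeff (matching_poly (W0_words ! i) (W0_words ! i)) 4 \<noteq> 0"
      using es(1) by (simp add: c count_list_0_iff)
    ultimately have "degree (matching_poly (W0_words ! i) (W0_words ! i)) = 4 \<and>
        matching_poly (W0_words ! i) (W0_words ! i) \<noteq> 0"
      using le_degree[of "matching_poly (W0_words ! i) (W0_words ! i)" 4] by auto
    then show "degree (P $$ (i, i)) = 4 \<and> P $$ (i, i) \<noteq> 0" using i by (simp add: P_def)
  qed simp
  interpret to_fract: inj_comm_ring_hom "to_fract :: real poly \<Rightarrow> ratfun"
    by unfold_locales auto
  have det: "det (map_mat to_fract P) \<noteq> 0"
    using \<open>det P \<noteq> 0\<close> by (simp add: to_fract.hom_det to_fract_eq_0_iff)
  have P': "map_mat to_fract P \<in> carrier_mat 64 64" using P by simp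
  have GP: "?G = const ((2 / k) ^ 4) \<cdot>\<^sub>m map_mat to_fract P"
    using G P by (intro eq_matI) (auto simp: gram_W0_entry P_def gram_fract_def)
  have "v = 0\<^sub>v 64" if v: "v \<in> carrier_vec 64" and 0: "?G *\<^sub>v v = 0\<^sub>v 64" for v
  proof -
    have "const ((2 / k) ^ 4) \<cdot>\<^sub>v (map_mat to_fract P *\<^sub>v v) = 0\<^sub>v 64"
      using 0 unfolding GP smult_mat_mult_vec[OF P' v] .
    then have scaled: "(const ((2 / k) ^ 4) \<cdot>\<^sub>v (map_mat to_fract P *\<^sub>v v)) $ i = 0" if "i < 64" for i
      using that by simp
    have "map_mat to_fract P *\<^sub>v v = 0\<^sub>v 64"
    proof (rule eq_vecI)
      fix i assume "i < dim_vec (0\<^sub>v 64 :: ratfun vec)"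
      then have i: "i < 64" "i < dim_vec (map_mat to_fract P *\<^sub>v v)" using P by auto
      then have "const ((2 / k) ^ 4) * (map_mat to_fract P *\<^sub>v v) $ i = 0"
        using scaled[of i] by (simp only: index_smult_vec)
      then show "(map_mat to_fract P *\<^sub>v v) $ i = 0\<^sub>v 64 $ i"
        using k i(1) by (simp only: mult_eq_0_iff const_0_iff) simp
    qed (use P in simp)
    then show ?thesis using det det_0_iff_vec_prod_zero_field[OF P'] v by blast
  qed
  from invertible_mat_inverse[OF G this, folded Gi_def]
  show "Gi \<in> carrier_mat 64 64" "?G * Gi = 1\<^sub>m 64" "Gi * ?G = 1\<^sub>m 64" by auto
qed

section \<open>The action of the Hamiltonian\<close>

lemma canon_norms:
  assumes "canon v = canon w" "nferm (concat v) \<le> 1" shows "norms (concat v) = norms (concat w)"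
proof -
  have "wrel v 1 w" using assms by (simp add: wrel_iff_canon)
  then have "mset (concat w) = mset (concat v)" by (rule wrel_mset)
  moreover have "norms xs = prod_mset (image_mset letter_norm (mset xs))" for xs
    by (induction xs) simp_all
  ultimately show ?thesis by simp
qed

lemma letter_norm_pos: "letter_norm x > 0"
  by (cases x) simp_all

lemma norms_nonzero: "norms xs \<noteq> 0"
  by (induction xs) (use letter_norm_pos in \<open>auto simp: less_imp_neq[symmetric]\<close>)

lemma smult_inject: "smult c p = smult c q \<Longrightarrow> c \<noteq> 0 \<Longrightarrow> p = q" for c :: "'a::field"
  by (metis left_inverse smult_1_left smult_smult)

lemma gram_fract_left_canon:
  assumes "canon v = canon v'" "nferm (concat v) \<le> 1"
  shows "gram_fract v w = gram_fract v' w"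
proof -
  have "nferm (concat v') \<le> 1" using canon_nferm[OF assms] assms(2) by simp
  then have "smult (norms (concat v)) (matching_poly v w) =
      smult (norms (concat v')) (matching_poly v' w)"
    \<comment> \<open>At k = 2 the powers of 2/k are 1; what remains are the norms, which are
      nonzero and depend only on the class.\<close>
    using gram_poly_left_canon[OF assms, of 2 w] assms(2)
    by (simp add: gram_poly_matching sign_free_nferm)
  then have "matching_poly v w = matching_poly v' w"
    using canon_norms[OF assms] norms_nonzero[of "concat v"] smult_inject by metis
  then show ?thesis by (simp add: gram_fract_def)
qed

lemma gram_fract_right_canon:
  assumes "canon w = canon w'" "nferm (concat v) \<le> 1" "nferm (concat w) \<le> 1"
  shows "gram_fract v w = gram_fract v w'"
proof -
  have "smult (norms (concat v)) (matching_poly v w) = smult (norms (concat v)) (matching_poly v w')"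
    using gram_poly_right_canon[OF assms, of 2] assms(2)
    by (simp add: gram_poly_matching sign_free_nferm)
  then have "matching_poly v w = matching_poly v w'"
    using norms_nonzero[of "concat v"] smult_inject by metis
  then show ?thesis by (simp add: gram_fract_def)
qed

section \<open>Pairings of formal combinations in place of matrix products\<close>

definition spanned :: "mword list \<Rightarrow> lincomb \<Rightarrow> bool" where
  "spanned C xs \<longleftrightarrow>
     (\<forall>(p, w)\<in>set xs. nferm (concat w) \<le> 1 \<and> canon w \<in> canon ` set C)"

text \<open>A Gram entry depends only on the class of a word, so a Gram row times the coordinates is
  the pairing with the combination itself, in which the basis no longer appears.\<close>

lemma gram_lin_coords:
  assumes C: "distinct (map canon C)" and xs: "spanned C xs" and v: "nferm (concat v) \<le> 1"
  shows "(\<Sum>j<length C. gram_fract v (C ! j) * lin (\<lambda>w. of_int (cls w (C ! j))) xs) =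
    lin (gram_fract v) xs"
  unfolding lin_sum
proof (rule lin_cong)
  fix p w assume "(p, w) \<in> set xs"
  then have w: "nferm (concat w) \<le> 1" "canon w \<in> canon ` set C" using xs by (auto simp: spanned_def)
  have "(\<Sum>j<length C. of_int (cls w (C ! j)) * gram_fract v (C ! j)) = gram_fract v w"
    using gram_fract_right_canon[OF _ v w(1)] by (intro sum_cls_basis C w) simp
  then show "(\<Sum>j<length C. gram_fract v (C ! j) * of_int (cls w (C ! j))) = gram_fract v w"
    by (simp add: mult.commute)
qed

text \<open>The same with the coordinates on the left, as they occur when the transpose of Q is
  applied after a Gram matrix.\<close>

lemma coords_gram_lin:
  assumes C: "distinct (map canon C)" and xs: "spanned C xs"
  shows "(\<Sum>i<length C. lin (\<lambda>w. of_int (cls w (C ! i))) xs * lin (gram_fract (C ! i)) ys) =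
    lin (\<lambda>w. lin (gram_fract w) ys) xs"
proof -
  have "(\<Sum>i<length C. lin (gram_fract (C ! i)) ys * lin (\<lambda>w. of_int (cls w (C ! i))) xs) =
      lin (\<lambda>w. lin (gram_fract w) ys) xs"
    unfolding lin_sum
  proof (rule lin_cong)
    fix p w assume "(p, w) \<in> set xs"
    then have w: "nferm (concat w) \<le> 1" "canon w \<in> canon ` set C" using xs by (auto simp: spanned_def)
    have "(\<Sum>i<length C. of_int (cls w (C ! i)) * lin (gram_fract (C ! i)) ys) = lin (gram_fract w) ys"
    proof (intro sum_cls_basis C w)
      fix c assume "canon w = canon c"
      from gram_fract_left_canon[OF this w(1)]
      show "lin (gram_fract c) ys = lin (gram_fract w) ys" by (intro lin_cong) simp
    qed
    then show "(\<Sum>i<length C. lin (gram_fract (C ! i)) ys * of_int (cls w (C ! i))) =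
        lin (gram_fract w) ys"
      by (simp add: mult.commute)
  qed
  then show ?thesis by (simp add: mult.commute)
qed

lemma Q_mat_entry:
  assumes "i < length C" "j < length B"
  shows "Q_mat B C $$ (i, j) = lin (\<lambda>w. of_int (cls w (C ! i))) (Q_lin [([1], B ! j)])"
proof -
  have "of_int (\<Sum>(c, w)\<leftarrow>xs. c * cls w v) = (\<Sum>(c, w)\<leftarrow>xs. of_int c * (of_int (cls w v) :: ratfun))"
    for xs v
    by (induction xs) auto
  then show ?thesis using assms
    by (simp add: Q_mat_def lin_Q_word[of "\<lambda>w. of_int (cls w (C ! i))" "B ! j", symmetric])
qed

definition coords :: "lincomb \<Rightarrow> ratfun vec" where
  "coords xs = vec 64 (\<lambda>i. lin (\<lambda>w. of_int (cls w (W0_words ! i))) xs)"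

lemma coords_carrier [simp]: "coords xs \<in> carrier_vec 64"
  by (simp add: coords_def)

lemma coords_nth: "i < 64 \<Longrightarrow> coords xs $ i = lin (\<lambda>w. of_int (cls w (W0_words ! i))) xs"
  by (simp add: coords_def)

lemma gram_W0_carrier: "gram_mat k W0_basis \<in> carrier_mat 64 64"
  by (simp add: gram_mat_def W0_basis_eq length_W0_words)

lemma W0_nth_nferm: "i < 64 \<Longrightarrow> nferm (concat (W0_words ! i)) = 1"
  using W0_nferm by (simp add: length_W0_words)

lemma gram_W0_coords:
  assumes "spanned W0_words xs" "i < 64"
  shows "(gram_mat k W0_basis *\<^sub>v coords xs) $ i =
    const ((2 / k) ^ 4) * lin (gram_fract (W0_words ! i)) xs"
proof -
  have "(gram_mat k W0_basis *\<^sub>v coords xs) $ i =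
    (\<Sum>j<64. gram_mat k W0_basis $$ (i, j) * coords xs $ j)"
    by (rule mult_mat_vec_nth[OF gram_W0_carrier coords_carrier assms(2)])
  also have "\<dots> = const ((2 / k) ^ 4) * (\<Sum>j<64. gram_fract (W0_words ! i) (W0_words ! j) *
      lin (\<lambda>w. of_int (cls w (W0_words ! j))) xs)"
    using assms(2) by (simp add: gram_W0_entry coords_nth sum_distrib_left mult.assoc)
  also have "(\<Sum>j<64. gram_fract (W0_words ! i) (W0_words ! j) *
      lin (\<lambda>w. of_int (cls w (W0_words ! j))) xs) = lin (gram_fract (W0_words ! i)) xs"
    using gram_lin_coords[OF distinct_canon_W0 assms(1), of "W0_words ! i"] W0_nth_nferm[OF assms(2)]
    by (simp add: length_W0_words)
  finally show ?thesis .
qed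

lemma coords_gram_W0:
  assumes "spanned W0_words xs"
  shows "(\<Sum>i<64. lin (\<lambda>w. of_int (cls w (W0_words ! i))) xs * lin (gram_fract (W0_words ! i)) ys) =
    lin (\<lambda>w. lin (gram_fract w) ys) xs"
  using coords_gram_lin[OF distinct_canon_W0 assms] by (simp add: length_W0_words)

lemma spanned_W0:
  assumes "\<And>p w. (p, w) \<in> set xs \<Longrightarrow> w \<in> set W0_words"
  shows "spanned W0_words xs"
  using assms W0_nferm by (fastforce simp: spanned_def)

lemma spanned_Q_Wminus: "j < 12 \<Longrightarrow> spanned W0_words (Q_lin [([1], Wminus_words ! j)])"
proof -
  assume "j < 12"
  then have "Wminus_words ! j \<in> set Wminus_words" by (intro nth_mem) (simp add: Wminus_words_def)
  then show ?thesis using Q_lin_Wminus by (fastforce simp: spanned_def list_all_iff)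
qed

lemma canon_Wplus: "canon ` set Wplus_basis = set (map canon Wplus_words)"
  by (simp add: Wplus_basis_eq canon_canon_basis)

lemma spanned_Q_W0: "w \<in> set W0_words \<Longrightarrow> spanned Wplus_basis (Q_lin [([1], w)])"
  using Q_lin_W0 unfolding spanned_def canon_Wplus by (fastforce simp: list_all_iff)

lemma distinct_canon_Wplus: "distinct (map canon Wplus_basis)"
  by (simp add: Wplus_basis_eq distinct_canon_basis)

lemma Wplus_subset: "set Wplus_basis \<subseteq> set Wplus_words"
  by (simp add: Wplus_basis_eq set_canon_basis)

lemma Wplus_words_norms: "w \<in> set Wplus_words \<Longrightarrow> norms (concat w) = 1 \<and> length (concat w) = 6"
  by (auto simp: Wplus_words_def Let_def)

lemma gram_Wplus_entry:
  assumes "i < length Wplus_basis" "j < length Wplus_basis"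
  shows "gram_mat k Wplus_basis $$ (i, j) =
    const ((2 / k) ^ 6) * gram_fract (Wplus_basis ! i) (Wplus_basis ! j)"
proof -
  have mem: "Wplus_basis ! i \<in> set Wplus_words" using assms Wplus_subset by auto
  then have "sign_free (Wplus_basis ! i) (Wplus_basis ! j)"
    by (intro sign_free_nferm) (simp add: Wplus_words_nferm)
  then show ?thesis
    using assms Wplus_words_norms[OF mem] by (simp add: gram_mat_def to_fract_gram_poly)
qed

lemma spanned_Q_lin:
  assumes "\<And>p w. (p, w) \<in> set xs \<Longrightarrow> w \<in> set W0_words"
  shows "spanned Wplus_basis (Q_lin xs)"
proof -
  have "\<exists>q v. (q, v) \<in> set xs \<and> (\<exists>p'. (p', w) \<in> set (Q_lin [([1], v)]))"
    if "(p, w) \<in> set (Q_lin xs)" for p w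
    using that by (fastforce simp: Q_lin_def)
  then show ?thesis using spanned_Q_W0[unfolded spanned_def] assms
    unfolding spanned_def by fast
qed

text \<open>Charges conserved by \<open>Q\<close>: the numbers of \<open>\<phi>\<^sub>1, \<phi>\<^sub>2, \<phi>\<^sup>1, \<phi>\<^sup>2\<close> (the last two barred)
  that remain once \<open>Q\<close> has replaced all fermions.\<close>

fun letter_charges :: "letter \<Rightarrow> int list" where
  "letter_charges (Phi A1) = [1, 0, 0, 0]" | "letter_charges (Phi A2) = [0, 1, 0, 0]"
| "letter_charges (Phib A1) = [0, 0, 1, 0]" | "letter_charges (Phib A2) = [0, 0, 0, 1]"
| "letter_charges (Psi A1) = [1, 1, 1, 0]" | "letter_charges (Psi A2) = [1, 1, 0, 1]"
| "letter_charges (Psib A1) = [1, 0, 1, 1]" | "letter_charges (Psib A2) = [0, 1, 1, 1]"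
| "letter_charges _ = [0, 0, 0, 0]"

definition charges :: "mword \<Rightarrow> int list" where
  "charges w = map (\<lambda>i. \<Sum>x\<leftarrow>concat w. letter_charges x ! i) [0, 1, 2, 3]"

lemma charges_mset: "mset (concat v) = mset (concat w) \<Longrightarrow> charges v = charges w"
proof -
  assume eq: "mset (concat v) = mset (concat w)"
  have "sum_list (map f xs) = sum_mset (image_mset f (mset xs))" for f :: "letter \<Rightarrow> int" and xs
    by (induction xs) simp_all
  then show ?thesis unfolding charges_def by (simp only: eq)
qed

text \<open>A matching of all letters makes the two multisets of letters equal, hence also the
  charges; without a matching there is no term at all.\<close>

lemma gram_fract_charges:
  assumes "charges v \<noteq> charges w" shows "gram_fract v w = 0"
proof -
  have "gexps v w = []"
  proof (rule ccontr)
    assume "gexps v w \<noteq> []"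
    then have len: "length (concat v) = length (concat w)"
      and "matchings (concat v) (List.enumerate 0 (concat w)) \<noteq> []"
      by (auto simp: gexps_def Let_def split: if_splits)
    define r where "r = hd (matchings (concat v) (List.enumerate 0 (concat w)))"
    have "r \<in> set (matchings (concat v) (List.enumerate 0 (concat w)))"
      unfolding r_def by (rule hd_in_set) fact
    then have r: "length r = length (concat v)" "distinct r"
      "\<And>p. p < length (concat v) \<Longrightarrow> r ! p < length (concat w) \<and> concat v ! p = concat w ! (r ! p)"
    proof -
      assume "r \<in> set (matchings (concat v) (List.enumerate 0 (concat w)))"
      then have m: "length r = length (concat v)" "distinct r"
        "\<forall>p<length (concat v). (r ! p, concat v ! p) \<in> set (List.enumerate 0 (concat w))"
        unfolding set_matchings by blast+
      show "length r = length (concat v)" "distinct r" by (fact m)+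
      fix p assume "p < length (concat v)"
      with m(3) have "(r ! p, concat v ! p) \<in> set (List.enumerate 0 (concat w))" by blast
      then show "r ! p < length (concat w) \<and> concat v ! p = concat w ! (r ! p)"
        by (simp add: in_set_enumerate_eq)
    qed
    have "set r \<subseteq> {..<length (concat w)}"
    proof
      fix q assume "q \<in> set r"
      then obtain p where "p < length r" "q = r ! p" by (metis in_set_conv_nth)
      then show "q \<in> {..<length (concat w)}" using r(1) r(3)[of p] by simp
    qed
    moreover have "card (set r) = card {..<length (concat w)}"
      using r(1,2) len by (simp only: distinct_card card_lessThan)
    ultimately have "set r = {..<length (concat w)}" by (intro card_subset_eq) simp_all
    then have "mset r = mset [0..<length (concat w)]"
      using r(2) set_eq_iff_mset_eq_distinct[of r "[0..<length (concat w)]"]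
      by (simp add: lessThan_atLeast0)
    then have "mset (map ((!) (concat w)) r) = mset (map ((!) (concat w)) [0..<length (concat w)])"
      by (simp only: mset_map)
    moreover have "map ((!) (concat w)) r = concat v"
    proof (rule nth_equalityI)
      fix p assume "p < length (map ((!) (concat w)) r)"
      then have "p < length (concat v)" "p < length r" using r(1) by simp_all
      then show "map ((!) (concat w)) r ! p = concat v ! p" using r(3)[of p] by simp
    qed (simp add: r(1))
    ultimately have "charges v = charges w" by (intro charges_mset) (simp only: map_nth)
    then show False using assms by simp
  qed
  then show ?thesis by (simp add: gram_fract_def matching_poly_def)
qed

definition homogeneous :: "int list \<Rightarrow> lincomb \<Rightarrow> bool" where
  "homogeneous c xs \<longleftrightarrow> list_all (\<lambda>(p, w). charges w = c) xs"

lemma lin_0 [simp]: "lin (\<lambda>w. 0) xs = 0"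
  by (induction xs) auto

lemma lin_gram_fract_charges:
  assumes "homogeneous c xs" "charges v \<noteq> c" shows "lin (gram_fract v) xs = 0"
proof -
  have "lin (gram_fract v) xs = lin (\<lambda>w. 0) xs"
  proof (rule lin_cong)
    fix p w assume "(p, w) \<in> set xs"
    then have "charges w = c" using assms(1) by (auto simp: homogeneous_def list_all_iff)
    then show "gram_fract v w = 0" using assms(2) by (intro gram_fract_charges) blast
  qed
  then show ?thesis by simp
qed

lemma lin_lin_gram_fract_charges:
  assumes "homogeneous c xs" "homogeneous d ys" "c \<noteq> d"
  shows "lin (\<lambda>v. lin (gram_fract v) ys) xs = 0"
proof -
  have "lin (\<lambda>v. lin (gram_fract v) ys) xs = lin (\<lambda>w. 0) xs"
  proof (rule lin_cong)
    fix p w assume "(p, w) \<in> set xs"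
    then have "charges w = c" using assms(1) by (auto simp: homogeneous_def list_all_iff)
    then show "lin (gram_fract w) ys = 0" using assms(2,3) by (intro lin_gram_fract_charges) blast+
  qed
  then show ?thesis by simp
qed

lemma homogeneous_Q_W0: "list_all (\<lambda>b. homogeneous (charges b) (Q_lin [([1], b)])) W0_words"
  by code_simp

text \<open>Differentiated letters have only the default charges 0 in \<open>letter_charges\<close>,
  so the charges of the image are read off its first word instead of the argument.\<close>

lemma homogeneous_Q_Wminus:
  "list_all (\<lambda>m. let q = Q_lin [([1], m)] in homogeneous (charges (snd (hd q))) q) Wminus_words"
  by code_simp

lemma homogeneous_Q_lin:
  assumes "\<And>p w. (p, w) \<in> set xs \<Longrightarrow> charges w = c \<and> w \<in> set W0_words"
  shows "homogeneous c (Q_lin xs)"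
  using assms
proof (induction xs)
  case (Cons x xs)
  obtain p v where x: "x = (p, v)" by (cases x)
  have v: "charges v = c" "v \<in> set W0_words" using Cons.prems[of p v] x by simp_all
  have "homogeneous c (Q_lin [([1], v)])"
    using homogeneous_Q_W0[unfolded list_all_iff, rule_format, OF v(2)] v(1) by simp
  moreover have "homogeneous c (Q_lin [(p, v)]) \<longleftrightarrow> homogeneous c (Q_lin [([1], v)])"
    by (simp add: Q_lin_def homogeneous_def list_all_iff split_beta)
  moreover have "homogeneous c (Q_lin xs)"
  proof (rule Cons.IH)
    fix q w assume "(q, w) \<in> set xs"
    then show "charges w = c \<and> w \<in> set W0_words" by (intro Cons.prems[of q]) simp
  qed
  moreover have "Q_lin (x # xs) = Q_lin [(p, v)] @ Q_lin xs" by (simp add: Q_lin_def x)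
  ultimately show ?case by (simp add: homogeneous_def)
qed (simp add: Q_lin_def homogeneous_def)

text \<open>One component of the equation that k^2 H maps \<open>x\<close> to \<open>y\<close>,
  paired with the word \<open>b\<close>. The prefix \<open>0 # 0 #\<close> multiplies by N^2. The
  arguments \<open>tx\<close> and \<open>qx\<close> depend on \<open>x\<close> only and are computed
  once for all \<open>b\<close>; vanishing entries of \<open>tx\<close> are skipped to save Gram
  evaluations.\<close>

definition ham_eq :: "mword \<Rightarrow> lincomb \<Rightarrow> int list list \<Rightarrow> lincomb \<Rightarrow> bool" where
  "ham_eq b y tx qx \<longleftrightarrow> peq (0 # 0 # gram_lin [([1], b)] y)
     (padd (psum (map2 (\<lambda>m t. if list_all ((=) 0) t then []
         else pmul [minus_weight m] (pmul (gram_lin [([1], b)] (Q_lin [([1], m)])) t)) Wminus_words tx))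
       (0 # 0 # gram_lin (Q_lin [([1], b)]) qx))"

text \<open>The equation \<open>4 G\<^sub>0 y = Q G\<^sub>-\<inverse> Q\<^sup>\<dagger> G\<^sub>0 x + Q\<^sup>\<dagger> G\<^sub>+ Q x\<close>, cleared of the denominator \<open>N\<^sup>2\<close>
  of \<open>G\<^sub>-\<inverse>\<close> and of the powers of \<open>k\<close>.\<close>

definition ham_maps :: "int list \<Rightarrow> lincomb \<Rightarrow> lincomb \<Rightarrow> bool" where
  "ham_maps c x y \<longleftrightarrow>
     list_all (\<lambda>(p, w). charges w = c \<and> w \<in> set W0_words) (x @ y) \<and>
     (let tx = map (\<lambda>m. gram_lin (Q_lin [([1], m)]) x) Wminus_words; qx = Q_lin x
      in list_all (\<lambda>b. ham_eq b y tx qx) (filter (\<lambda>b. charges b = c) W0_words))"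

lemma length_Wminus_words: "length Wminus_words = 12"
  by (simp add: Wminus_words_def)

lemma ham_eq_eval:
  assumes "ham_eq b y (map (\<lambda>m. gram_lin (Q_lin [([1], m)]) x) Wminus_words) qx"
  shows "Nvar\<^sup>2 * lin (gram_fract b) y =
    (\<Sum>i<12. of_int (minus_weight (Wminus_words ! i)) *
       (lin (gram_fract b) (Q_lin [([1], Wminus_words ! i)]) *
        lin (\<lambda>v. lin (gram_fract v) x) (Q_lin [([1], Wminus_words ! i)]))) +
    Nvar\<^sup>2 * lin (\<lambda>v. lin (gram_fract v) qx) (Q_lin [([1], b)])"
proof -
  let ?f = "\<lambda>m t. if list_all ((=) 0) t then []
         else pmul [minus_weight m] (pmul (gram_lin [([1], b)] (Q_lin [([1], m)])) t)"
  let ?F = "\<lambda>m. of_int (minus_weight m) * (lin (gram_fract b) (Q_lin [([1], m)]) *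
        lin (\<lambda>v. lin (gram_fract v) x) (Q_lin [([1], m)]))"
  have z: "list_all ((=) 0) r \<Longrightarrow> peval Nvar r = 0" for r by (induction r) auto
  have f: "peval Nvar (?f m (gram_lin (Q_lin [([1], m)]) x)) = ?F m" for m
  proof (cases "list_all ((=) 0) (gram_lin (Q_lin [([1], m)]) x)")
    case True
    then have "lin (\<lambda>v. lin (gram_fract v) x) (Q_lin [([1], m)]) = 0"
      using z[OF True] by (simp add: peval_gram_lin)
    then show ?thesis using True by simp
  next
    case False
    then show ?thesis by (simp add: peval_gram_lin)
  qed
  have "peval Nvar (psum (map2 ?f ms (map (\<lambda>m. gram_lin (Q_lin [([1], m)]) x) ms))) =
      (\<Sum>m\<leftarrow>ms. ?F m)" for ms
    by (induction ms) (simp_all only: list.map zip_Cons_Cons zip_Nil prod.case psum.simps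
        peval_padd peval.simps sum_list.Cons sum_list.Nil f)
  moreover have "(\<Sum>m\<leftarrow>Wminus_words. ?F m) = (\<Sum>i<12. ?F (Wminus_words ! i))"
    unfolding sum_list_sum_nth length_map length_Wminus_words lessThan_atLeast0
    by (intro sum.cong HOL.refl) (simp only: nth_map length_Wminus_words atLeastLessThan_iff)
  ultimately show ?thesis
    using peval_peq[OF assms[unfolded ham_eq_def], of Nvar]
    by (simp add: peval_gram_lin power2_eq_square mult.assoc)
qed

text \<open>For words \<open>b\<close> of other charges both sides vanish by charge conservation,
  which is why \<open>ham_maps\<close> tests only those of charge \<open>c\<close>.\<close>

lemma ham_maps_eval:
  assumes xy: "ham_maps c x y" and b: "b \<in> set W0_words"
  shows "Nvar\<^sup>2 * lin (gram_fract b) y =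
    (\<Sum>i<12. of_int (minus_weight (Wminus_words ! i)) *
       (lin (gram_fract b) (Q_lin [([1], Wminus_words ! i)]) *
        lin (\<lambda>v. lin (gram_fract v) x) (Q_lin [([1], Wminus_words ! i)]))) +
    Nvar\<^sup>2 * lin (\<lambda>v. lin (gram_fract v) (Q_lin x)) (Q_lin [([1], b)])"
proof (cases "charges b = c")
  case True
  then show ?thesis using xy b by (intro ham_eq_eval) (simp add: ham_maps_def Let_def list_all_iff)
next
  case False
  have x: "homogeneous c x" and y: "homogeneous c y"
    using xy by (auto simp: ham_maps_def homogeneous_def list_all_iff)
  have "homogeneous (charges b) (Q_lin [([1], b)])"
    using homogeneous_Q_W0 b by (simp add: list_all_iff)
  moreover have "homogeneous c (Q_lin x)"
    using xy by (intro homogeneous_Q_lin) (auto simp: ham_maps_def list_all_iff)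
  ultimately have rhs: "lin (\<lambda>v. lin (gram_fract v) (Q_lin x)) (Q_lin [([1], b)]) = 0"
    using lin_lin_gram_fract_charges False by blast
  have minus: "lin (gram_fract b) (Q_lin [([1], Wminus_words ! i)]) *
        lin (\<lambda>v. lin (gram_fract v) x) (Q_lin [([1], Wminus_words ! i)]) = 0" if "i < 12" for i
  proof -
    have "Wminus_words ! i \<in> set Wminus_words" using that by (simp add: length_Wminus_words)
    then obtain d where d: "homogeneous d (Q_lin [([1], Wminus_words ! i)])"
      using homogeneous_Q_Wminus unfolding list_all_iff Let_def by blast
    show ?thesis
    \<comment> \<open>If the image of the W_- word has the charges of \<open>b\<close>, it cannot
      pair with \<open>x\<close>; otherwise it does not pair with \<open>b\<close>.\<close>
    proof (cases "charges b = d")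
      case True
      then show ?thesis using lin_lin_gram_fract_charges[OF d x] False by simp
    next
      case False
      then show ?thesis using lin_gram_fract_charges[OF d] by simp
    qed
  qed
  have "(\<Sum>i<12. of_int (minus_weight (Wminus_words ! i)) *
       (lin (gram_fract b) (Q_lin [([1], Wminus_words ! i)]) *
        lin (\<lambda>v. lin (gram_fract v) x) (Q_lin [([1], Wminus_words ! i)]))) = 0"
    by (intro sum.neutral ballI) (simp only: minus lessThan_iff mult_zero_right)
  then show ?thesis by (simp only: lin_gram_fract_charges[OF y False] rhs)
qed

text \<open>Bridge from the evaluated certificates to the Hamiltonian: each matrix factor applied to
  \<open>coords x\<close> is rewritten as a pairing of formal combinations, and the inverse of G_0
  is cancelled instead of computed.\<close>

lemma Ham_coords:
  assumes k: "k \<noteq> 0" and xy: "ham_maps c x y"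
  shows "Ham k *\<^sub>v coords x = const (1 / k\<^sup>2) \<cdot>\<^sub>v coords y"
proof -
  define n where "n = length Wplus_basis"
  define c4 where "c4 = const ((2 / k) ^ 4)"
  define c6 where "c6 = const ((2 / k) ^ 6)"
  define G0 where "G0 = gram_mat k W0_basis"
  define Gm where "Gm = the (mat_inverse (gram_mat k Wminus_basis))"
  define Gi where "Gi = the (mat_inverse G0)"
  define Gp where "Gp = gram_mat k Wplus_basis"
  define Q1 where "Q1 = Q_mat Wminus_basis W0_basis"
  define Q2 where "Q2 = Q_mat W0_basis Wplus_basis"
  note lenm = length_Wminus_words
  have xw: "w \<in> set W0_words" if "(p, w) \<in> set x" for p w
    using xy that by (auto simp: ham_maps_def list_all_iff)
  have yw: "w \<in> set W0_words" if "(p, w) \<in> set y" for p w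
    using xy that by (auto simp: ham_maps_def list_all_iff)
  note spx = spanned_W0[of x, OF xw] and spy = spanned_W0[of y, OF yw]
  have G0 [simp]: "G0 \<in> carrier_mat 64 64" by (simp add: G0_def gram_W0_carrier)
  have Gm [simp]: "Gm \<in> carrier_mat 12 12" unfolding Gm_def by (rule gram_minus_inverse(1)[OF k])
  have Gi [simp]: "Gi \<in> carrier_mat 64 64" and G0Gi: "G0 * Gi = 1\<^sub>m 64" and GiG0: "Gi * G0 = 1\<^sub>m 64"
    using gram_W0_inverse[OF k] by (simp_all add: Gi_def G0_def)
  have Gp [simp]: "Gp \<in> carrier_mat n n" by (simp add: Gp_def gram_mat_def n_def)
  have Q1 [simp]: "Q1 \<in> carrier_mat 64 12" "transpose_mat Q1 \<in> carrier_mat 12 64"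
    by (simp_all add: Q1_def Q_mat_def W0_basis_eq Wminus_basis_eq length_W0_words lenm)
  have Q2 [simp]: "Q2 \<in> carrier_mat n 64" "transpose_mat Q2 \<in> carrier_mat 64 n"
    by (simp_all add: Q2_def Q_mat_def W0_basis_eq length_W0_words n_def)
  have dims: "dim_row Q1 = 64" "dim_col Q1 = 12" "dim_row Q2 = n" "dim_col Q2 = 64" "dim_row G0 = 64"
    using carrier_matD[OF Q1(1)] carrier_matD[OF Q2(1)] carrier_matD[OF G0] by auto
  have Q1e: "Q1 $$ (i, j) = lin (\<lambda>w. of_int (cls w (W0_words ! i))) (Q_lin [([1], Wminus_words ! j)])"
    if "i < 64" "j < 12" for i j
    unfolding Q1_def using that Q_mat_entry[of i W0_basis j Wminus_basis]
    by (simp add: W0_basis_eq Wminus_basis_eq length_W0_words lenm)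
  have Q2e: "Q2 $$ (i, j) = lin (\<lambda>w. of_int (cls w (Wplus_basis ! i))) (Q_lin [([1], W0_words ! j)])"
    if "i < n" "j < 64" for i j
    unfolding Q2_def using that Q_mat_entry[of i Wplus_basis j W0_basis]
    by (simp add: W0_basis_eq length_W0_words n_def)

  \<comment> \<open>The half Q Q^dagger: \<open>coords x\<close> is pushed through its four matrix
    factors one at a time.\<close>
  define z where "z = G0 *\<^sub>v coords x"
  have z [simp]: "z \<in> carrier_vec 64" unfolding z_def by (rule mult_mat_vec_carrier[OF G0]) simp
  have ze: "z $ i = c4 * lin (gram_fract (W0_words ! i)) x" if "i < 64" for i
    unfolding z_def G0_def c4_def by (rule gram_W0_coords[OF spx that])
  define t where "t = transpose_mat Q1 *\<^sub>v z"
  have t [simp]: "t \<in> carrier_vec 12" unfolding t_def by (rule mult_mat_vec_carrier[OF Q1(2)]) simp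
  have te: "t $ m = c4 * lin (\<lambda>w. lin (gram_fract w) x) (Q_lin [([1], Wminus_words ! m)])"
    if m: "m < 12" for m
  proof -
    have "t $ m = (\<Sum>i<64. Q1 $$ (i, m) * z $ i)"
      unfolding t_def mult_mat_vec_nth[OF Q1(2) z m]
      using m by (intro sum.cong HOL.refl) (simp add: dims)
    also have "\<dots> = c4 * (\<Sum>i<64. lin (\<lambda>w. of_int (cls w (W0_words ! i))) (Q_lin [([1], Wminus_words ! m)]) *
        lin (gram_fract (W0_words ! i)) x)"
      by (simp add: ze Q1e m sum_distrib_left algebra_simps)
    also have "\<dots> = c4 * lin (\<lambda>w. lin (gram_fract w) x) (Q_lin [([1], Wminus_words ! m)])"
      by (simp only: coords_gram_W0[OF spanned_Q_Wminus[OF m]])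
    finally show ?thesis .
  qed
  define s where "s = Gm *\<^sub>v t"
  have s [simp]: "s \<in> carrier_vec 12" unfolding s_def by (rule mult_mat_vec_carrier[OF Gm t])
  have se: "s $ m = const (inverse ((2 / k)\<^sup>2)) * of_int (minus_weight (Wminus_words ! m)) / Nvar\<^sup>2 * t $ m"
    if "m < 12" for m
    unfolding s_def Gm_def by (rule gram_minus_inverse(2)[OF k t that])
  define u where "u = Q1 *\<^sub>v s"
  have u [simp]: "u \<in> carrier_vec 64" unfolding u_def by (rule mult_mat_vec_carrier[OF Q1(1) s])
  have G0u: "(G0 *\<^sub>v u) $ b = (\<Sum>m<12. s $ m *
      (c4 * lin (gram_fract (W0_words ! b)) (Q_lin [([1], Wminus_words ! m)])))" if b: "b < 64" for b
  proof -
    have ui: "u $ i = (\<Sum>m<12. Q1 $$ (i, m) * s $ m)" if "i < 64" for i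
      unfolding u_def by (rule mult_mat_vec_nth[OF Q1(1) s that])
    have "(G0 *\<^sub>v u) $ b = (\<Sum>i<64. G0 $$ (b, i) * u $ i)"
      by (rule mult_mat_vec_nth[OF G0 u b])
    also have "\<dots> = (\<Sum>i<64. \<Sum>m<12. s $ m * (G0 $$ (b, i) * Q1 $$ (i, m)))"
      by (intro sum.cong HOL.refl) (simp add: ui sum_distrib_left ac_simps)
    also have "\<dots> = (\<Sum>m<12. s $ m * (\<Sum>i<64. G0 $$ (b, i) * Q1 $$ (i, m)))"
      by (subst sum.swap) (simp only: sum_distrib_left)
    also have "\<dots> = (\<Sum>m<12. s $ m *
      (c4 * lin (gram_fract (W0_words ! b)) (Q_lin [([1], Wminus_words ! m)])))"
    proof (intro sum.cong HOL.refl arg_cong2[of _ _ _ _ "(*)"])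
      fix m :: nat assume "m \<in> {..<12}"
      then have m: "m < 12" by simp
      have "(G0 *\<^sub>v coords (Q_lin [([1], Wminus_words ! m)])) $ b = (\<Sum>i<64. G0 $$ (b, i) * Q1 $$ (i, m))"
        unfolding mult_mat_vec_nth[OF G0 coords_carrier b]
        by (intro sum.cong HOL.refl) (simp add: coords_nth Q1e m)
      then show "(\<Sum>i<64. G0 $$ (b, i) * Q1 $$ (i, m)) =
          c4 * lin (gram_fract (W0_words ! b)) (Q_lin [([1], Wminus_words ! m)])"
        using gram_W0_coords[OF spanned_Q_Wminus[OF m] b, where k = k] by (simp add: G0_def c4_def)
    qed
    finally show ?thesis .
  qed

  \<comment> \<open>The half Q^dagger Q, up to the final inverse of G_0.\<close>
  define p where "p = Q2 *\<^sub>v coords x"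
  have p [simp]: "p \<in> carrier_vec n" unfolding p_def by (rule mult_mat_vec_carrier[OF Q2(1)]) simp
  have pe: "p $ c = lin (\<lambda>w. of_int (cls w (Wplus_basis ! c))) (Q_lin x)" if c: "c < n" for c
  proof -
    let ?h = "\<lambda>v. lin (\<lambda>w. of_int (cls w (Wplus_basis ! c))) (Q_lin [([1], v)])"
    have "p $ c = (\<Sum>j<64. ?h (W0_words ! j) * lin (\<lambda>w. of_int (cls w (W0_words ! j))) x)"
      unfolding p_def mult_mat_vec_nth[OF Q2(1) coords_carrier c]
      by (intro sum.cong HOL.refl) (simp add: coords_nth Q2e c)
    also have "\<dots> = lin ?h x"
      unfolding lin_sum
    proof (rule lin_cong)
      fix q w assume "(q, w) \<in> set x"
      then have w: "w \<in> set W0_words" by (rule xw)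
      have "(\<Sum>j<length W0_words. of_int (cls w (W0_words ! j)) * ?h (W0_words ! j)) = ?h w"
      proof (rule sum_cls_basis[OF distinct_canon_W0])
        fix v assume "v \<in> set W0_words" "canon w = canon v"
        then have "v = w" using distinct_canon_W0 w by (auto simp: distinct_map inj_on_def)
        then show "?h v = ?h w" by simp
      qed (use W0_nferm[OF w] w in auto)
      then show "(\<Sum>j<64. ?h (W0_words ! j) * of_int (cls w (W0_words ! j))) = ?h w"
        by (simp add: length_W0_words mult.commute)
    qed
    also have "\<dots> = lin (\<lambda>w. of_int (cls w (Wplus_basis ! c))) (Q_lin x)" by (rule lin_Q_lin[symmetric])
    finally show ?thesis .
  qed
  define q where "q = Gp *\<^sub>v p"
  have q [simp]: "q \<in> carrier_vec n" unfolding q_def by (rule mult_mat_vec_carrier[OF Gp p])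
  have qe: "q $ c = c6 * lin (gram_fract (Wplus_basis ! c)) (Q_lin x)" if c: "c < n" for c
  proof -
    have nf: "nferm (concat (Wplus_basis ! c)) \<le> 1"
    proof -
      have "Wplus_basis ! c \<in> set Wplus_words" using c Wplus_subset by (auto simp: n_def)
      then show ?thesis using Wplus_words_nferm by simp
    qed
    have "q $ c = c6 * (\<Sum>j<n. gram_fract (Wplus_basis ! c) (Wplus_basis ! j) *
        lin (\<lambda>w. of_int (cls w (Wplus_basis ! j))) (Q_lin x))"
      unfolding q_def mult_mat_vec_nth[OF Gp p c] sum_distrib_left
      using c by (intro sum.cong HOL.refl) (simp add: pe Gp_def gram_Wplus_entry n_def c6_def)
    also have "\<dots> = c6 * lin (gram_fract (Wplus_basis ! c)) (Q_lin x)"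
      unfolding n_def using gram_lin_coords[OF distinct_canon_Wplus spanned_Q_lin[OF xw] nf] by simp
    finally show ?thesis .
  qed
  define r where "r = transpose_mat Q2 *\<^sub>v q"
  have r [simp]: "r \<in> carrier_vec 64" unfolding r_def by (rule mult_mat_vec_carrier[OF Q2(2) q])
  have re: "r $ b = c6 * lin (\<lambda>w. lin (gram_fract w) (Q_lin x)) (Q_lin [([1], W0_words ! b)])"
    if b: "b < 64" for b
  proof -
    have "r $ b = (\<Sum>c<n. Q2 $$ (c, b) * q $ c)"
      unfolding r_def mult_mat_vec_nth[OF Q2(2) q b]
      using b by (intro sum.cong HOL.refl) (simp add: dims)
    also have "\<dots> = c6 * (\<Sum>c<n. lin (\<lambda>w. of_int (cls w (Wplus_basis ! c))) (Q_lin [([1], W0_words ! b)]) *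
        lin (gram_fract (Wplus_basis ! c)) (Q_lin x))"
      by (simp add: qe Q2e b sum_distrib_left algebra_simps)
    also have "\<dots> = c6 * lin (\<lambda>w. lin (gram_fract w) (Q_lin x)) (Q_lin [([1], W0_words ! b)])"
      unfolding n_def
      using coords_gram_lin[OF distinct_canon_Wplus spanned_Q_W0[of "W0_words ! b"]] b
      by (simp add: length_W0_words)
    finally show ?thesis .
  qed

  have Ham: "Ham k *\<^sub>v coords x = const (1 / 4) \<cdot>\<^sub>v (u + Gi *\<^sub>v r)"
  proof -
    have c: "coords x \<in> carrier_vec 64" by simp
    have A1: "Gm * transpose_mat Q1 * G0 \<in> carrier_mat 12 64"
      by (rule mult_carrier_mat[OF mult_carrier_mat[OF Gm Q1(2)] G0])
    have A2: "Gi * transpose_mat Q2 * Gp \<in> carrier_mat 64 n"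
      by (rule mult_carrier_mat[OF mult_carrier_mat[OF Gi Q2(2)] Gp])
    have 1: "(Q1 * (Gm * transpose_mat Q1 * G0)) *\<^sub>v coords x = u"
      unfolding assoc_mult_mat_vec[OF Q1(1) A1 c] assoc_mult_mat_vec[OF mult_carrier_mat[OF Gm Q1(2)] G0 c]
        z_def[symmetric] assoc_mult_mat_vec[OF Gm Q1(2) z] t_def[symmetric] s_def[symmetric] u_def ..
    have 2: "(Gi * transpose_mat Q2 * Gp * Q2) *\<^sub>v coords x = Gi *\<^sub>v r"
      unfolding assoc_mult_mat_vec[OF A2 Q2(1) c] p_def[symmetric]
        assoc_mult_mat_vec[OF mult_carrier_mat[OF Gi Q2(2)] Gp p] q_def[symmetric]
        assoc_mult_mat_vec[OF Gi Q2(2) q] r_def ..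
    have B1: "Q1 * (Gm * transpose_mat Q1 * G0) \<in> carrier_mat 64 64"
      by (rule mult_carrier_mat[OF Q1(1) A1])
    have B2: "Gi * transpose_mat Q2 * Gp * Q2 \<in> carrier_mat 64 64"
      by (rule mult_carrier_mat[OF A2 Q2(1)])
    have "Ham k = const (1 / 4) \<cdot>\<^sub>m (Q1 * (Gm * transpose_mat Q1 * G0) + Gi * transpose_mat Q2 * Gp * Q2)"
      by (simp add: Ham_def Q_adjoint_def Q1_def Q2_def Gm_def Gi_def G0_def Gp_def)
    also have "\<dots> *\<^sub>v coords x = const (1 / 4) \<cdot>\<^sub>v
        ((Q1 * (Gm * transpose_mat Q1 * G0) + Gi * transpose_mat Q2 * Gp * Q2) *\<^sub>v coords x)"
      by (rule smult_mat_mult_vec[OF add_carrier_mat[OF B2] c])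
    also have "\<dots> = const (1 / 4) \<cdot>\<^sub>v (u + Gi *\<^sub>v r)"
      by (simp only: add_mult_distrib_mat_vec[OF B1 B2 c] 1 2)
    finally show ?thesis .
  qed
  have Gir [simp]: "Gi *\<^sub>v r \<in> carrier_vec 64" by (rule mult_mat_vec_carrier[OF Gi r])
  have G0Gir: "G0 *\<^sub>v (Gi *\<^sub>v r) = r"
    by (simp add: assoc_mult_mat_vec[OF G0 Gi r, symmetric] G0Gi)
  \<comment> \<open>Multiplication by \<open>G0\<close> removes \<open>Gi\<close>, and each
    component becomes the polynomial identity certified by \<open>ham_maps\<close>.\<close>
  have eq: "G0 *\<^sub>v (Ham k *\<^sub>v coords x) = G0 *\<^sub>v (const (1 / k\<^sup>2) \<cdot>\<^sub>v coords y)"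
  proof (rule eq_vecI)
    fix b assume "b < dim_vec (G0 *\<^sub>v (const (1 / k\<^sup>2) \<cdot>\<^sub>v coords y))"
    then have b: "b < 64" by (simp add: dims)
    let ?b = "W0_words ! b"
    let ?g = "\<lambda>m. lin (gram_fract ?b) (Q_lin [([1], Wminus_words ! m)])"
    let ?x = "\<lambda>m. lin (\<lambda>v. lin (gram_fract v) x) (Q_lin [([1], Wminus_words ! m)])"
    let ?p = "lin (\<lambda>v. lin (gram_fract v) (Q_lin x)) (Q_lin [([1], ?b)])"
    have "?b \<in> set W0_words" using b by (simp add: length_W0_words)
    note ham = ham_maps_eval[OF xy this]
    have "(G0 *\<^sub>v (Ham k *\<^sub>v coords x)) $ b = const (1 / 4) * ((G0 *\<^sub>v u) $ b + r $ b)"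
    proof -
      have "G0 *\<^sub>v (const (1 / 4) \<cdot>\<^sub>v (u + Gi *\<^sub>v r)) = const (1 / 4) \<cdot>\<^sub>v (G0 *\<^sub>v (u + Gi *\<^sub>v r))"
        by (rule mult_mat_vec[OF G0]) simp
      also have "G0 *\<^sub>v (u + Gi *\<^sub>v r) = G0 *\<^sub>v u + r"
        by (simp only: mult_add_distrib_mat_vec[OF G0 u Gir] G0Gir)
      finally show ?thesis unfolding Ham using b by (simp add: dims carrier_vecD[OF r])
    qed
    also have "(G0 *\<^sub>v u) $ b = (\<Sum>m<12. c4 * c4 * const (inverse ((2 / k)\<^sup>2)) / Nvar\<^sup>2 *
        (of_int (minus_weight (Wminus_words ! m)) * (?g m * ?x m)))"
      unfolding G0u[OF b] by (intro sum.cong HOL.refl) (simp add: se te)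
    also have "\<dots> = c4 * c4 * const (inverse ((2 / k)\<^sup>2)) / Nvar\<^sup>2 *
        (Nvar\<^sup>2 * lin (gram_fract ?b) y - Nvar\<^sup>2 * ?p)"
      unfolding ham by (simp add: sum_distrib_left)
    \<comment> \<open>Both halves scale alike in 2/k: two factors G_0 and one inverse of G_- give
      the power 4 + 4 - 2, and G_+ gives 6.\<close>
    also have "c4 * c4 * const (inverse ((2 / k)\<^sup>2)) = c6"
    proof -
      have "a ^ 4 * a ^ 4 * inverse (a\<^sup>2) = a ^ 6" if "a \<noteq> 0" for a :: real
        using that by (simp add: field_simps flip: power_add)
      from this[of "2 / k"] show ?thesis
        using k unfolding c4_def c6_def const_mult[symmetric] by simp
    qed
    also have "r $ b = c6 * ?p" by (rule re[OF b])
    also have "const (1 / 4) * (c6 / Nvar\<^sup>2 * (Nvar\<^sup>2 * lin (gram_fract ?b) y - Nvar\<^sup>2 * ?p) + c6 * ?p) =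
        const (1 / 4) * c6 * lin (gram_fract ?b) y"
      by (simp add: field_simps)
    \<comment> \<open>The prefactor 1/4 absorbs the 4 in the surplus (2/k)^2, leaving 1/k^2.\<close>
    also have "const (1 / 4) * c6 = const (1 / k\<^sup>2) * c4"
    proof -
      have "1 / 4 * (2 / k) ^ 6 = 1 / k\<^sup>2 * (2 / k) ^ 4"
        using k by (simp add: power_divide field_simps flip: power_add)
      then show ?thesis unfolding c4_def c6_def const_mult[symmetric] by simp
    qed
    also have "const (1 / k\<^sup>2) * c4 * lin (gram_fract ?b) y = const (1 / k\<^sup>2) * (G0 *\<^sub>v coords y) $ b"
      using gram_W0_coords[OF spy b, where k = k] by (simp add: G0_def c4_def)
    also have "\<dots> = (G0 *\<^sub>v (const (1 / k\<^sup>2) \<cdot>\<^sub>v coords y)) $ b"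
      using b by (simp add: mult_mat_vec[OF G0 coords_carrier] dims)
    finally show "(G0 *\<^sub>v (Ham k *\<^sub>v coords x)) $ b = (G0 *\<^sub>v (const (1 / k\<^sup>2) \<cdot>\<^sub>v coords y)) $ b" .
  qed (simp add: dims)
  have cancel: "v = w" if "v \<in> carrier_vec 64" "w \<in> carrier_vec 64" "G0 *\<^sub>v v = G0 *\<^sub>v w" for v w
  proof -
    have "Gi *\<^sub>v (G0 *\<^sub>v v) = Gi *\<^sub>v (G0 *\<^sub>v w)" using that(3) by simp
    then show ?thesis
      using that(1,2) by (simp add: assoc_mult_mat_vec[OF Gi G0, symmetric] GiG0)
  qed
  show ?thesis
    by (rule cancel[OF _ _ eq]) (simp_all add: Ham)
qed

section \<open>The sector \<open>V\<^sub>0\<close>\<close>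

text \<open>On \<open>V\<^sub>0\<close> the matrix of \<open>2 k\<^sup>2 \<H>\<close> has rank 4 and equals \<open>V0_left V0_right\<close>. The first two
  rows of \<open>V0_right\<close> are left eigenvectors for the rational eigenvalues, the other two span the
  invariant space of functionals that carries the last factor.\<close>

definition V0_left :: "int list list list" where
  "V0_left =
    [[[-10, 0, 10], [0, 0, 3], [-2, 0, 1], [0, -2]],
     [[-10, 0, 10], [0, 0, -3], [2, 0, -1], [0, 2]],
     [[], [], [-4, 0, 2], [0, -4]],
     [[10, 0, -10], [0, 0, 3], [2, 0, -1], [0, 2]],
     [[10, 0, -10], [0, 0, -3], [-2, 0, 1], [0, -2]],
     [[], [], [4, 0, -2], [0, 4]],
     [[], [], [0, -2], [-8, 0, 4]],
     [[], [], [0, 4], [0, 0, -4]],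
     [[], [], [0, -4], [0, 0, 4]],
     [[], [], [0, 2], [8, 0, -4]],
     [[], [], [0, 2], [-8]],
     [[], [], [0, -2], [8]]]"

definition V0_right :: "int list list" where
  "V0_right =
    [[1, 1, 0, -1, -1, 0, 0, 0, 0, 0, 0, 0],
     [1, -1, 0, 1, -1, 0, 0, 0, 0, 0, 0, 0],
     [1, -1, 2, -1, 1, -2, 0, 0, 0, 0, 0, 0],
     [0, 0, 0, 0, 0, 0, 1, -1, 1, -1, 0, 0]]"

text \<open>The claimed value of 2 k^2 H on the \<open>j\<close>-th word. Zero coefficients are
  dropped because every remaining word costs Gram evaluations.\<close>

definition V0_image :: "nat \<Rightarrow> lincomb" where
  "V0_image j = filter (\<lambda>(p, w). \<not> list_all ((=) 0) p)
     (map2 (\<lambda>r w. (psum (map2 (\<lambda>a b. map ((*) (b ! j)) a) r V0_right), w)) V0_left V0_words)"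

lemma V0_words_W0: "list_all (\<lambda>w. w \<in> set W0_words) V0_words"
  by code_simp

text \<open>The product in the opposite order has the same nonzero spectrum. Divided by 2 k^2, its
  first two diagonal entries are the rational eigenvalues and the 2 by 2 block has the last factor
  as characteristic polynomial.\<close>

lemma V0_right_left:
  "list_all2 (list_all2 peq)
     (map (\<lambda>b. map (\<lambda>s. psum (map2 (\<lambda>c r. map ((*) c) (r ! s)) b V0_left)) [0, 1, 2, 3]) V0_right)
     [[[-40, 0, 40], [], [], []],
      [[], [0, 0, 12], [], []],
      [[], [], [-24, 0, 12], [0, -24]],
      [[], [], [0, -12], [-16, 0, 16]]]"
  by code_simp

text \<open>The coefficient 2 goes with the integral factorisation of 2 k^2 H, and [2, 1, 2, 1] are
  the charges of the sector. The twelve words are spread over several lemmas to keep each evaluation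
  short.\<close>

lemma ham_maps_V0_0:
  "list_all (\<lambda>j. ham_maps [2, 1, 2, 1] [([2], V0_words ! j)] (V0_image j)) [0, 1, 2]"
  by code_simp

lemma ham_maps_V0_3:
  "list_all (\<lambda>j. ham_maps [2, 1, 2, 1] [([2], V0_words ! j)] (V0_image j)) [3, 4, 5]"
  by code_simp

lemma ham_maps_V0_6:
  "list_all (\<lambda>j. ham_maps [2, 1, 2, 1] [([2], V0_words ! j)] (V0_image j)) [6, 7, 8]"
  by code_simp

lemma ham_maps_V0_9:
  "list_all (\<lambda>j. ham_maps [2, 1, 2, 1] [([2], V0_words ! j)] (V0_image j)) [9, 10, 11]"
  by code_simp

lemma ham_maps_V0: "j < 12 \<Longrightarrow> ham_maps [2, 1, 2, 1] [([2], V0_words ! j)] (V0_image j)"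
  using ham_maps_V0_0 ham_maps_V0_3 ham_maps_V0_6 ham_maps_V0_9
  by (simp add: eval_nat_numeral less_Suc_eq) (elim disjE, simp_all)

text \<open>The index \<open>t\<close> numbers the four scalar coefficients in \<open>\<O>\<^sup>a\<^sub>b\<close>, in order of appearance.\<close>

definition O_terms :: "nat \<Rightarrow> flav \<Rightarrow> flav \<Rightarrow> (int \<times> mword) list" where
  "O_terms t a b = filter (\<lambda>(e, w). e \<noteq> 0) (concat (map (\<lambda>(c, d). let e = eps c d in
    [[(e, [[Phi c, Phib a], [Phi b, Psib d]]), (- e, [[Phi b, Phib c], [Psi a, Phib d]])],
     [(e, [[Phib a, Phi b], [Phib c, Psi d]])],
     [(e, [[Phi b, Phib a], [Phi c, Psib d]])],
     [(e, [[Psi c, Phib d, Phi b, Phib a]]), (e, [[Psi c, Phib a, Phi b, Phib d]]),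
      (- e, [[Psib c, Phi d, Phib a, Phi b]]), (- e, [[Psib c, Phi b, Phib a, Phi d]])]] ! t)
    [(A1, A1), (A1, A2), (A2, A1), (A2, A2)]))"

text \<open>The words in the formula for the eigenvector need not be basis words, as
  \<open>ham_maps\<close> requires. Trying the four rotations of a single trace, or both rotations
  and both orders of two short traces, finds the basis word of the class.\<close>

definition W0_rep :: "mword \<Rightarrow> mword" where
  "W0_rep w = the (List.find (\<lambda>v. v \<in> set W0_words)
     (case w of
        [t] \<Rightarrow> map (\<lambda>t. [t]) (rotations 3 t)
      | [t, u] \<Rightarrow> [[t, u], [rotate1 t, u], [t, rotate1 u], [rotate1 t, rotate1 u],
                   [u, t], [rotate1 u, t], [u, rotate1 t], [rotate1 u, rotate1 t]]
      | _ \<Rightarrow> []))"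

definition O_lin :: "nat \<Rightarrow> flav \<Rightarrow> flav \<Rightarrow> lincomb" where
  "O_lin t a b = map (\<lambda>(e, w). ([e], W0_rep w)) (O_terms t a b)"

text \<open>Row \<open>t\<close> expresses k^2 H of the \<open>t\<close>-th vector in the four
  vectors. The first vector and the sum of the second and third are annihilated, so two eigenvalues
  vanish; the other two are k^2 gamma_+ and k^2 gamma_-.\<close>

definition O_matrix :: "int list list list" where
  "O_matrix =
    [[[], [], [], []],
     [[8], [-8, 0, 4], [0, 0, -4], [0, -2]],
     [[-8], [8, 0, -4], [0, 0, 4], [0, 2]],
     [[0, -12], [0, -12], [0, 24], [-12, 0, 6]]]"

definition O_image :: "nat \<Rightarrow> flav \<Rightarrow> flav \<Rightarrow> lincomb" where
  "O_image t a b = concat (map (\<lambda>u. let p = O_matrix ! t ! u in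
     if p = [] then [] else map (\<lambda>(q, w). (pmul p q, w)) (O_lin u a b)) [0, 1, 2, 3])"

lemma O_terms_canon:
  "list_all (\<lambda>t. list_all (\<lambda>a. list_all (\<lambda>b. list_all
     (\<lambda>(e, w). nferm (concat w) = 1 \<and> canon (W0_rep w) = canon w) (O_terms t a b)) [A1, A2]) [A1, A2])
     [0, 1, 2, 3]"
  by code_simp

text \<open>The lower index \<open>b\<close> decides the unbarred charges and the upper index
  \<open>a\<close> the barred ones. The four choices are evaluated directly instead of being related
  by flavour symmetry.\<close>

lemma ham_maps_O_11_0: "list_all (\<lambda>t. ham_maps [2, 1, 2, 1] (O_lin t A1 A1) (O_image t A1 A1)) [0, 1]"
  by code_simp

lemma ham_maps_O_11_2: "list_all (\<lambda>t. ham_maps [2, 1, 2, 1] (O_lin t A1 A1) (O_image t A1 A1)) [2]"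
  by code_simp

lemma ham_maps_O_11_3: "list_all (\<lambda>t. ham_maps [2, 1, 2, 1] (O_lin t A1 A1) (O_image t A1 A1)) [3]"
  by code_simp

lemma ham_maps_O_12_0: "list_all (\<lambda>t. ham_maps [1, 2, 2, 1] (O_lin t A1 A2) (O_image t A1 A2)) [0, 1]"
  by code_simp

lemma ham_maps_O_12_2: "list_all (\<lambda>t. ham_maps [1, 2, 2, 1] (O_lin t A1 A2) (O_image t A1 A2)) [2]"
  by code_simp

lemma ham_maps_O_12_3: "list_all (\<lambda>t. ham_maps [1, 2, 2, 1] (O_lin t A1 A2) (O_image t A1 A2)) [3]"
  by code_simp

lemma ham_maps_O_21_0: "list_all (\<lambda>t. ham_maps [2, 1, 1, 2] (O_lin t A2 A1) (O_image t A2 A1)) [0, 1]"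
  by code_simp

lemma ham_maps_O_21_2: "list_all (\<lambda>t. ham_maps [2, 1, 1, 2] (O_lin t A2 A1) (O_image t A2 A1)) [2]"
  by code_simp

lemma ham_maps_O_21_3: "list_all (\<lambda>t. ham_maps [2, 1, 1, 2] (O_lin t A2 A1) (O_image t A2 A1)) [3]"
  by code_simp

lemma ham_maps_O_22_0: "list_all (\<lambda>t. ham_maps [1, 2, 1, 2] (O_lin t A2 A2) (O_image t A2 A2)) [0, 1]"
  by code_simp

lemma ham_maps_O_22_2: "list_all (\<lambda>t. ham_maps [1, 2, 1, 2] (O_lin t A2 A2) (O_image t A2 A2)) [2]"
  by code_simp

lemma ham_maps_O_22_3: "list_all (\<lambda>t. ham_maps [1, 2, 1, 2] (O_lin t A2 A2) (O_image t A2 A2)) [3]"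
  by code_simp

lemma ham_maps_O: "t < 4 \<Longrightarrow> \<exists>c. ham_maps c (O_lin t a b) (O_image t a b)"
  using ham_maps_O_11_0 ham_maps_O_11_2 ham_maps_O_11_3 ham_maps_O_12_0 ham_maps_O_12_2 ham_maps_O_12_3
    ham_maps_O_21_0 ham_maps_O_21_2 ham_maps_O_21_3 ham_maps_O_22_0 ham_maps_O_22_2 ham_maps_O_22_3
  by (cases a; cases b) (auto simp: eval_nat_numeral less_Suc_eq)

section \<open>Characteristic polynomials\<close>

text \<open>Sylvester's determinant identity: the block matrix with diagonal blocks Y and 1 and
  off-diagonal blocks A and B is made block triangular in two ways. The powers of the variable on
  both sides avoid any comparison of \<open>n\<close> and \<open>m\<close>.\<close>

lemma char_poly_mult_commute:
  fixes A B :: "'a::idom mat"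
  assumes A: "A \<in> carrier_mat n m" and B: "B \<in> carrier_mat m n"
  shows "[:0, 1:] ^ m * char_poly (A * B) = [:0, 1:] ^ n * char_poly (B * A)"
proof -
  define h where "h = (\<lambda>a :: 'a. [:a:])"
  define Y :: "'a poly" where "Y = [:0, 1:]"
  define A' where "A' = map_mat h A"
  define B' where "B' = map_mat h B"
  have A' [simp]: "A' \<in> carrier_mat n m" and B' [simp]: "B' \<in> carrier_mat m n"
    using A B by (auto simp: A'_def B'_def)
  have hsum: "h (sum f S) = (\<Sum>x\<in>S. h (f x))" for f :: "nat \<Rightarrow> 'a" and S
  proof (induction S rule: infinite_finite_induct)
    case (insert x S)
    moreover have "h (a + b) = h a + h b" for a b by (simp add: h_def)
    ultimately show ?case by simp
  qed (simp_all add: h_def)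
  have hmult: "map_mat h (C * D) = map_mat h C * map_mat h D"
    if "C \<in> carrier_mat p q" "D \<in> carrier_mat q p" for C D p q
    using that by (intro eq_matI) (auto simp: scalar_prod_def hsum, simp add: h_def mult.commute)
  have char: "char_poly (C * D) = det (Y \<cdot>\<^sub>m 1\<^sub>m p - map_mat h C * map_mat h D)"
    if C: "C \<in> carrier_mat p q" and D: "D \<in> carrier_mat q p" for C D p q
  proof -
    have "char_poly_matrix (C * D) = Y \<cdot>\<^sub>m 1\<^sub>m p - map_mat h (C * D)"
      using C D by (intro eq_matI) (auto simp: char_poly_matrix_def Y_def h_def)
    then show ?thesis by (simp add: char_poly_def hmult[OF C D])
  qed
  have dims [simp]: "dim_row A' = n" "dim_col A' = m" "dim_row B' = m" "dim_col B' = n"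
    using carrier_matD[OF A'] carrier_matD[OF B'] by auto
  have Yc: "Y \<cdot>\<^sub>m 1\<^sub>m p \<in> carrier_mat p p" for p by simp
  have mB: "- B' \<in> carrier_mat m n" by simp
  define M where "M = four_block_mat (Y \<cdot>\<^sub>m 1\<^sub>m n) A' B' (1\<^sub>m m)"
  have M: "M \<in> carrier_mat (n + m) (n + m)" by (simp add: M_def)
  have AB [simp]: "A' * B' \<in> carrier_mat n n" and BA [simp]: "B' * A' \<in> carrier_mat m m"
    by (rule mult_carrier_mat[OF A' B'], rule mult_carrier_mat[OF B' A'])
  have YAB [simp]: "Y \<cdot>\<^sub>m 1\<^sub>m n - A' * B' \<in> carrier_mat n n"
    and YBA [simp]: "Y \<cdot>\<^sub>m 1\<^sub>m m - B' * A' \<in> carrier_mat m m"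
    by (rule minus_carrier_mat[OF AB], rule minus_carrier_mat[OF BA])
  \<comment> \<open>Both \<open>L\<close> and \<open>R\<close> clear the lower left block.
    \<open>R\<close> first scales the lower rows by \<open>Y\<close>, which avoids dividing by
    \<open>Y\<close> at the cost of the factor Y^m, its determinant.\<close>
  define L where "L = four_block_mat (1\<^sub>m n) (0\<^sub>m n m) (- B') (1\<^sub>m m)"
  define R where "R = four_block_mat (1\<^sub>m n) (0\<^sub>m n m) (- B') (Y \<cdot>\<^sub>m 1\<^sub>m m)"
  have L: "L \<in> carrier_mat (n + m) (n + m)" and R: "R \<in> carrier_mat (n + m) (n + m)"
    by (simp_all add: L_def R_def)
  have MLeq: "M * L = four_block_mat (Y \<cdot>\<^sub>m 1\<^sub>m n - A' * B') A' (0\<^sub>m m n) (1\<^sub>m m)"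
  proof -
    have "M * L = four_block_mat
      ((Y \<cdot>\<^sub>m 1\<^sub>m n) * 1\<^sub>m n + A' * (- B')) ((Y \<cdot>\<^sub>m 1\<^sub>m n) * 0\<^sub>m n m + A' * 1\<^sub>m m)
      (B' * 1\<^sub>m n + 1\<^sub>m m * (- B')) (B' * 0\<^sub>m n m + 1\<^sub>m m * 1\<^sub>m m)"
      unfolding M_def L_def by (rule mult_four_block_mat[OF Yc A' B' one_carrier_mat
        one_carrier_mat zero_carrier_mat mB one_carrier_mat])
    also have "(Y \<cdot>\<^sub>m 1\<^sub>m n) * 1\<^sub>m n + A' * (- B') = Y \<cdot>\<^sub>m 1\<^sub>m n - A' * B'"
      by (intro eq_matI) (simp_all add: A'_def B'_def, use A B in \<open>auto simp: scalar_prod_def sum_negf\<close>)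
    also have "(Y \<cdot>\<^sub>m 1\<^sub>m n) * 0\<^sub>m n m + A' * 1\<^sub>m m = A'"
      using right_mult_one_mat[OF A'] right_mult_zero_mat[of "Y \<cdot>\<^sub>m 1\<^sub>m n" n n m] by simp
    also have "B' * 1\<^sub>m n + 1\<^sub>m m * (- B') = 0\<^sub>m m n"
      using right_mult_one_mat[OF B'] left_mult_one_mat[OF mB] by (intro eq_matI) simp_all
    also have "B' * 0\<^sub>m n m + 1\<^sub>m m * 1\<^sub>m m = 1\<^sub>m m"
      using right_mult_zero_mat[OF B', of m] by simp
    finally show ?thesis .
  qed
  have RMeq: "R * M = four_block_mat (Y \<cdot>\<^sub>m 1\<^sub>m n) A' (0\<^sub>m m n) (Y \<cdot>\<^sub>m 1\<^sub>m m - B' * A')"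
  proof -
    have "R * M = four_block_mat
      (1\<^sub>m n * (Y \<cdot>\<^sub>m 1\<^sub>m n) + 0\<^sub>m n m * B') (1\<^sub>m n * A' + 0\<^sub>m n m * 1\<^sub>m m)
      ((- B') * (Y \<cdot>\<^sub>m 1\<^sub>m n) + (Y \<cdot>\<^sub>m 1\<^sub>m m) * B') ((- B') * A' + (Y \<cdot>\<^sub>m 1\<^sub>m m) * 1\<^sub>m m)"
      unfolding M_def R_def by (rule mult_four_block_mat[OF one_carrier_mat zero_carrier_mat mB Yc
        Yc A' B' one_carrier_mat])
    also have "1\<^sub>m n * (Y \<cdot>\<^sub>m 1\<^sub>m n) + 0\<^sub>m n m * B' = Y \<cdot>\<^sub>m 1\<^sub>m n"
      using left_mult_zero_mat[OF B', of n] by simp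
    also have "1\<^sub>m n * A' + 0\<^sub>m n m * 1\<^sub>m m = A'"
      using left_mult_one_mat[OF A'] by simp
    also have "(- B') * (Y \<cdot>\<^sub>m 1\<^sub>m n) + (Y \<cdot>\<^sub>m 1\<^sub>m m) * B' = 0\<^sub>m m n"
    proof -
      have "(- B') * (Y \<cdot>\<^sub>m 1\<^sub>m n) = Y \<cdot>\<^sub>m (- B')"
        using mult_smult_distrib[of "- B'" m n "1\<^sub>m n" n Y] right_mult_one_mat[OF mB] by simp
      moreover have "(Y \<cdot>\<^sub>m 1\<^sub>m m) * B' = Y \<cdot>\<^sub>m B'"
        using mult_smult_assoc_mat[of "1\<^sub>m m" m m B' n Y] left_mult_one_mat[OF B'] by simp
      ultimately show ?thesis by (intro eq_matI) simp_all
    qed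
    also have "(- B') * A' + (Y \<cdot>\<^sub>m 1\<^sub>m m) * 1\<^sub>m m = Y \<cdot>\<^sub>m 1\<^sub>m m - B' * A'"
      by (intro eq_matI) (simp_all add: A'_def B'_def, use A B in \<open>auto simp: scalar_prod_def sum_negf\<close>)
    finally show ?thesis .
  qed
  have detX: "det (Y \<cdot>\<^sub>m 1\<^sub>m p :: 'a poly mat) = Y ^ p" for p
    by (simp add: det_smult)
  have "det M = det (M * L)"
  proof -
    have "det L = 1" unfolding L_def by (subst det_four_block_mat_upper_right_zero[of _ n _ m]) simp_all
    then show ?thesis by (simp add: det_mult[OF M L])
  qed
  also have "\<dots> = char_poly (A * B)"
    unfolding MLeq char[OF A B] A'_def[symmetric] B'_def[symmetric]
    by (subst det_four_block_mat_lower_left_zero[of _ n _ m]) simp_all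
  finally have 1: "char_poly (A * B) = det M" ..
  have "Y ^ m * det M = det (R * M)"
  proof -
    have "det R = Y ^ m" unfolding R_def
      by (subst det_four_block_mat_upper_right_zero[of _ n _ m]) (simp_all add: detX)
    then show ?thesis by (simp add: det_mult[OF R M])
  qed
  also have "\<dots> = Y ^ n * char_poly (B * A)"
    unfolding RMeq char[OF B A] A'_def[symmetric] B'_def[symmetric]
    by (subst det_four_block_mat_lower_left_zero[of _ n _ m]) (simp_all add: detX)
  finally show ?thesis by (simp add: 1 Y_def)
qed

lemma det_2:
  assumes "(A :: 'a::comm_ring_1 mat) \<in> carrier_mat 2 2"
  shows "det A = A $$ (0, 0) * A $$ (1, 1) - A $$ (0, 1) * A $$ (1, 0)"
proof -
  have "det A = (\<Sum>i<2. A $$ (i, 0) * cofactor A i 0)"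
    by (rule laplace_expansion_column[OF assms]) simp
  moreover have "cofactor A 0 0 = A $$ (1, 1)" "cofactor A 1 0 = - A $$ (0, 1)"
    using assms by (auto simp: cofactor_def det_single mat_delete_def)
  ultimately show ?thesis by (simp add: numeral_2_eq_2 algebra_simps)
qed

lemma char_poly_block:
  fixes a b p q r s :: "'a::idom"
  assumes M: "M = mat_of_rows_list 4 [[a, 0, 0, 0], [0, b, 0, 0], [0, 0, p, q], [0, 0, r, s]]"
  shows "char_poly M = [:- a, 1:] * [:- b, 1:] * [:p * s - q * r, - (p + s), 1:]"
proof -
  define D1 where "D1 = mat_of_rows_list 2 [[[:- a, 1:], 0], [0, [:- b, 1:]]]"
  define D2 where "D2 = mat_of_rows_list 2 [[[:- p, 1:], [:- q:]], [[:- r:], [:- s, 1:]]]"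
  have D: "D1 \<in> carrier_mat 2 2" "D2 \<in> carrier_mat 2 2"
    by (auto simp: D1_def D2_def mat_of_rows_list_def numeral_2_eq_2)
  have less4: "i < 4 \<longleftrightarrow> i = 0 \<or> i = 1 \<or> i = 2 \<or> i = (3::nat)" for i by auto
  have "char_poly_matrix M = four_block_mat D1 (0\<^sub>m 2 2) (0\<^sub>m 2 2) D2"
  proof (rule eq_matI)
    fix i j
    assume "i < dim_row (four_block_mat D1 (0\<^sub>m 2 2) (0\<^sub>m 2 2) D2)"
      "j < dim_col (four_block_mat D1 (0\<^sub>m 2 2) (0\<^sub>m 2 2) D2)"
    then have "i < 4" "j < 4" using carrier_matD[OF D(1)] carrier_matD[OF D(2)] by simp_all
    then show "char_poly_matrix M $$ (i, j) = four_block_mat D1 (0\<^sub>m 2 2) (0\<^sub>m 2 2) D2 $$ (i, j)"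
      unfolding less4
      by (elim disjE) (simp_all add: M char_poly_matrix_def D1_def D2_def mat_of_rows_list_def)
  qed (use carrier_matD[OF D(1)] carrier_matD[OF D(2)] in
      \<open>simp_all add: M char_poly_matrix_def mat_of_rows_list_def\<close>)
  then have "char_poly M = det D1 * det D2"
    unfolding char_poly_def using det_four_block_mat_lower_left_zero[OF D(1) _ _ D(2)] by simp
  moreover have "det D1 = [:- a, 1:] * [:- b, 1:]"
    unfolding det_2[OF D(1)] by (simp add: D1_def mat_of_rows_list_def)
  moreover have "det D2 = [:p * s - q * r, - (p + s), 1:]"
    unfolding det_2[OF D(2)] by (simp add: D2_def mat_of_rows_list_def algebra_simps)
  ultimately show ?thesis by simp
qed

section \<open>Restriction to \<open>V\<^sub>0\<close>\<close>

lemma length_V0_words: "length V0_words = 12"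
  by (simp add: V0_words_def)

lemma V0_nth_W0: "j < 12 \<Longrightarrow> V0_words ! j \<in> set W0_words"
  using V0_words_W0 by (simp add: list_all_length length_V0_words)

lemma distinct_V0_words: "distinct V0_words"
  by (simp add: V0_words_def)

lemma cls_W0:
  assumes "v \<in> set W0_words" "w \<in> set W0_words" shows "cls v w = (if v = w then 1 else 0)"
proof -
  have "canon v = canon w \<longleftrightarrow> v = w"
    using distinct_canon_W0 assms by (auto simp: distinct_map inj_on_def)
  then show ?thesis using W0_nferm[OF assms(1)] by (simp add: cls_canon)
qed

lemma V0_mat_carrier [simp]: "V0_mat \<in> carrier_mat 64 12"
  by (simp add: V0_mat_def W0_basis_eq length_W0_words length_V0_words)

lemma V0_mat_entry: "i < 64 \<Longrightarrow> j < 12 \<Longrightarrow> V0_mat $$ (i, j) = of_int (cls (V0_words ! j) (W0_words ! i))"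
  by (simp add: V0_mat_def W0_basis_eq length_W0_words length_V0_words)

text \<open>The twelve words are themselves different words of the basis of W_0, so each coordinate
  of \<open>x\<close> reappears as an entry of the product. Injectivity makes a matrix representing
  H on V_0 in these words unique.\<close>

lemma V0_mat_kernel: "mat_kernel V0_mat = {0\<^sub>v 12}"
proof (intro equalityI subsetI)
  fix x assume "x \<in> mat_kernel V0_mat"
  then have x: "x \<in> carrier_vec 12" "V0_mat *\<^sub>v x = 0\<^sub>v 64"
    using mat_kernelD[OF V0_mat_carrier] by auto
  have "x $ j = 0" if j: "j < 12" for j
  proof -
    obtain i where i: "i < 64" "W0_words ! i = V0_words ! j"
      using V0_nth_W0[OF j] by (metis in_set_conv_nth length_W0_words)
    have "(V0_mat *\<^sub>v x) $ i = (\<Sum>l<12. V0_mat $$ (i, l) * x $ l)"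
      by (rule mult_mat_vec_nth[OF V0_mat_carrier x(1) i(1)])
    also have "\<dots> = (\<Sum>l<12. if l = j then x $ l else 0)"
    proof (intro sum.cong HOL.refl)
      fix l :: nat assume "l \<in> {..<12}"
      then have l: "l < 12" by simp
      have "cls (V0_words ! l) (V0_words ! j) = (if l = j then 1 else 0)"
        unfolding cls_W0[OF V0_nth_W0[OF l] V0_nth_W0[OF j]]
        using distinct_V0_words l j by (simp add: nth_eq_iff_index_eq length_V0_words)
      then show "V0_mat $$ (i, l) * x $ l = (if l = j then x $ l else 0)"
        by (simp add: V0_mat_entry i l)
    qed
    also have "\<dots> = x $ j" using j by simp
    finally show ?thesis using x(2) i(1) by simp
  qed
  then have "x = 0\<^sub>v 12" using x(1) by (intro eq_vecI) simp_all
  then show "x \<in> {0\<^sub>v 12}" by simp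
next
  fix x :: "ratfun vec" assume "x \<in> {0\<^sub>v 12}"
  then have "x = 0\<^sub>v 12" by simp
  moreover have "V0_mat *\<^sub>v 0\<^sub>v 12 = 0\<^sub>v 64"
    by (intro eq_vecI) (simp_all add: carrier_matD[OF V0_mat_carrier])
  ultimately show "x \<in> mat_kernel V0_mat" by (intro mat_kernelI[OF V0_mat_carrier]) simp_all
qed

definition V0_left_mat :: "ratfun mat" where
  "V0_left_mat = mat 12 4 (\<lambda>(i, r). peval Nvar (V0_left ! i ! r))"

definition V0_right_mat :: "ratfun mat" where
  "V0_right_mat = mat 4 12 (\<lambda>(r, j). of_int (V0_right ! r ! j))"

lemma V0_left_right_carrier [simp]:
  "V0_left_mat \<in> carrier_mat 12 4" "V0_right_mat \<in> carrier_mat 4 12"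
  by (simp_all add: V0_left_mat_def V0_right_mat_def)

lemma V0_lengths: "length V0_left = 12" "length V0_right = 4"
  "\<And>i. i < 12 \<Longrightarrow> length (V0_left ! i) = 4" "\<And>r. r < 4 \<Longrightarrow> length (V0_right ! r) = 12"
proof -
  have "list_all (\<lambda>r. length r = 4) V0_left" "list_all (\<lambda>r. length r = 12) V0_right"
    by code_simp+
  moreover show "length V0_left = 12" "length V0_right = 4"
    by (simp_all add: V0_left_def V0_right_def)
  ultimately show "\<And>i. i < 12 \<Longrightarrow> length (V0_left ! i) = 4" "\<And>r. r < 4 \<Longrightarrow> length (V0_right ! r) = 12"
    by (simp_all add: list_all_length)
qed

lemma peval_psum_map2:
  assumes "length xs = n" "length ys = n"
  shows "peval x (psum (map2 f xs ys)) = (\<Sum>r<n. peval x (f (xs ! r) (ys ! r)))"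
  using assms by (simp add: peval_psum sum_list_sum_nth lessThan_atLeast0)

text \<open>The scalar sits on the left factor so that the matrix is literally a product through
  dimension 4, as \<open>char_poly_mult_commute\<close> needs.\<close>

definition V0_matrix :: "real \<Rightarrow> ratfun mat" where
  "V0_matrix k = (const (1 / (2 * k\<^sup>2)) \<cdot>\<^sub>m V0_left_mat) * V0_right_mat"

lemma V0_matrix_carrier [simp]: "V0_matrix k \<in> carrier_mat 12 12"
  unfolding V0_matrix_def by (rule mult_carrier_mat[of _ _ 4]) simp_all

lemma lin_filter_nonzero:
  "lin h (filter (\<lambda>(p, w). \<not> list_all ((=) 0) p) xs) = lin h xs"
proof -
  have z: "list_all (\<lambda>a. a = 0) r \<Longrightarrow> peval Nvar r = 0" for r by (induction r) auto
  have "(=) (0 :: int) = (\<lambda>a. a = 0)" by auto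
  then show ?thesis by (induction xs) (auto simp: z)
qed

lemma lin_V0_image:
  assumes j: "j < 12"
  shows "lin h (V0_image j) = (\<Sum>i<12. (V0_left_mat * V0_right_mat) $$ (i, j) * h (V0_words ! i))"
proof -
  have "lin h (V0_image j) = (\<Sum>i<12. peval Nvar (psum
      (map2 (\<lambda>a b. map ((*) (b ! j)) a) (V0_left ! i) V0_right)) * h (V0_words ! i))"
    unfolding V0_image_def lin_filter_nonzero
    by (simp add: lin_def sum_list_sum_nth lessThan_atLeast0 V0_lengths length_V0_words)
  also have "\<dots> = (\<Sum>i<12. (V0_left_mat * V0_right_mat) $$ (i, j) * h (V0_words ! i))"
  proof (intro sum.cong HOL.refl arg_cong2[of _ _ _ _ "(*)"])
    fix i :: nat assume "i \<in> {..<12}"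
    then have i: "i < 12" by simp
    have "peval Nvar (psum (map2 (\<lambda>a b. map ((*) (b ! j)) a) (V0_left ! i) V0_right)) =
        (\<Sum>r<4. V0_left_mat $$ (i, r) * V0_right_mat $$ (r, j))"
      using i j by (subst peval_psum_map2[where n = 4])
        (simp_all add: V0_lengths V0_left_mat_def V0_right_mat_def mult.commute)
    also have "\<dots> = (V0_left_mat * V0_right_mat) $$ (i, j)"
      using i j by (simp add: V0_left_mat_def V0_right_mat_def scalar_prod_def lessThan_atLeast0)
    finally show "peval Nvar (psum (map2 (\<lambda>a b. map ((*) (b ! j)) a) (V0_left ! i) V0_right)) =
        (V0_left_mat * V0_right_mat) $$ (i, j)" .
  qed
  finally show ?thesis .
qed

lemma Ham_carrier: "k \<noteq> 0 \<Longrightarrow> Ham k \<in> carrier_mat 64 64"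
  using carrier_matD[OF gram_W0_inverse(1)[of k]]
  by (intro carrier_matI)
    (simp_all add: Ham_def Q_adjoint_def Q_mat_def W0_basis_eq length_W0_words)

lemma const_half_square: "const (1 / (2 * k\<^sup>2)) = 1 / (2 * const k ^ 2)" if "k \<noteq> 0"
proof -
  have "const (1 / (2 * k\<^sup>2)) * const (2 * k\<^sup>2) = 1"
    using that by (simp flip: const_mult)
  moreover have "const (2 * k\<^sup>2) = 2 * const k ^ 2"
    using const_of_int[of 2] by (simp add: const_mult const_power)
  ultimately show ?thesis using that by (simp add: eq_divide_eq)
qed

lemma Ham_V0_col:
  assumes k: "k \<noteq> 0" and i: "i < 64" and j: "j < 12"
  shows "(Ham k * V0_mat) $$ (i, j) = (V0_mat * V0_matrix k) $$ (i, j)"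
proof -
  let ?x = "coords [([1], V0_words ! j)]"
  let ?LR = "V0_left_mat * V0_right_mat"
  have LR: "?LR \<in> carrier_mat 12 12" by (rule mult_carrier_mat[of _ _ 4]) simp_all
  have x: "coords [([2], V0_words ! j)] = 2 \<cdot>\<^sub>v ?x"
    by (intro eq_vecI) (simp_all add: coords_def)
  have col: "col V0_mat j = ?x"
    using j by (intro eq_vecI) (simp_all add: V0_mat_entry coords_def carrier_matD[OF V0_mat_carrier])
  \<comment> \<open>The certificate is about the doubled word; the 2 is cancelled below.\<close>
  have "2 * (Ham k *\<^sub>v ?x) $ i = (Ham k *\<^sub>v coords [([2], V0_words ! j)]) $ i"
    unfolding x mult_mat_vec[OF Ham_carrier[OF k] coords_carrier]
    using i by (simp add: carrier_matD[OF Ham_carrier[OF k]])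
  also have "\<dots> = const (1 / k\<^sup>2) * coords (V0_image j) $ i"
    unfolding Ham_coords[OF k ham_maps_V0[OF j]]
    using i by (simp add: carrier_vecD[OF coords_carrier])
  also have "coords (V0_image j) $ i = (\<Sum>l<12. ?LR $$ (l, j) * V0_mat $$ (i, l))"
    using i by (simp add: coords_nth lin_V0_image[OF j] V0_mat_entry)
  also have "const (1 / k\<^sup>2) = 2 * const (1 / (2 * k\<^sup>2))"
    using const_of_int[of 2] const_mult[of 2 "1 / (2 * k\<^sup>2)"] by simp
  finally have "2 * (Ham k *\<^sub>v ?x) $ i =
      2 * (const (1 / (2 * k\<^sup>2)) * (\<Sum>l<12. ?LR $$ (l, j) * V0_mat $$ (i, l)))"
    by (simp only: mult.assoc)
  moreover have "(2 :: ratfun) \<noteq> 0"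
    using const_of_int[of 2] const_0_iff[of 2] by simp
  ultimately have "(Ham k *\<^sub>v ?x) $ i = const (1 / (2 * k\<^sup>2)) * (\<Sum>l<12. ?LR $$ (l, j) * V0_mat $$ (i, l))"
    using mult_left_cancel by blast
  also have "\<dots> = (V0_mat * V0_matrix k) $$ (i, j)"
  proof -
    have "V0_matrix k = const (1 / (2 * k\<^sup>2)) \<cdot>\<^sub>m ?LR"
      unfolding V0_matrix_def by (rule mult_smult_assoc_mat[of _ 12 4 _ 12]) simp_all
    then have e: "V0_matrix k $$ (l, j) = const (1 / (2 * k\<^sup>2)) * ?LR $$ (l, j)" if "l < 12" for l
      using that j carrier_matD[OF LR] by simp
    have "(V0_mat * V0_matrix k) $$ (i, j) = (\<Sum>l<12. V0_mat $$ (i, l) * V0_matrix k $$ (l, j))"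
      using i j carrier_matD[OF V0_mat_carrier] carrier_matD[OF V0_matrix_carrier[of k]]
      by (simp add: scalar_prod_def lessThan_atLeast0)
    then show ?thesis by (simp add: e sum_distrib_left ac_simps)
  qed
  finally show ?thesis
    using i j col carrier_matD[OF V0_mat_carrier] carrier_matD[OF Ham_carrier[OF k]] by simp
qed

lemma Ham_V0:
  assumes k: "k \<noteq> 0" shows "Ham k * V0_mat = V0_mat * V0_matrix k"
  using carrier_matD[OF V0_mat_carrier] carrier_matD[OF Ham_carrier[OF k]]
    carrier_matD[OF V0_matrix_carrier[of k]]
  by (intro eq_matI) (simp_all add: Ham_V0_col[OF k] del: index_mult_mat(1))

lemma Ham_preserves_V0:
  assumes k: "k \<noteq> 0" and v: "v \<in> V0" shows "Ham k *\<^sub>v v \<in> V0"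
proof -
  obtain x where x: "v = V0_mat *\<^sub>v x" "x \<in> carrier_vec 12"
    using v by (auto simp: V0_def length_V0_words)
  have "Ham k *\<^sub>v v = V0_mat *\<^sub>v (V0_matrix k *\<^sub>v x)"
    using assoc_mult_mat_vec[OF Ham_carrier[OF k] V0_mat_carrier x(2)]
      assoc_mult_mat_vec[OF V0_mat_carrier V0_matrix_carrier x(2), of k] Ham_V0[OF k] x(1) by simp
  then show ?thesis using mult_mat_vec_carrier[OF V0_matrix_carrier x(2)]
    by (auto simp: V0_def length_V0_words)
qed

text \<open>Exchanging the two factors leaves a 4 by 4 matrix; cancelling four of the twelve powers
  of the variable leaves the factor gamma^8.\<close>

lemma char_poly_V0_matrix:
  assumes k: "k \<noteq> 0"
  shows "char_poly (V0_matrix k) =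
    [:0, 1:] ^ 8 *
    [: - (20 * ((Nvar ^ 2 - 1) / const k ^ 2)), 1 :] *
    [: - (6 * (Nvar ^ 2 / const k ^ 2)), 1 :] *
    last_factor (const k) Nvar"
proof -
  define c where "c = const (1 / (2 * k\<^sup>2))"
  define K where "K = const k"
  have K: "K \<noteq> 0" using k by (simp add: K_def)
  have cK: "c = 1 / (2 * K\<^sup>2)" unfolding c_def K_def by (rule const_half_square[OF k])
  have two: "(2 :: ratfun) \<noteq> 0"
    using const_of_int[of 2] const_0_iff[of 2] by simp
  let ?T = "[[[-40, 0, 40], [], [], []],
      [[], [0, 0, 12], [], []],
      [[], [], [-24, 0, 12], [0, -24]],
      [[], [], [0, -12], [-16, 0, 16]]] :: int list list list"
  have T: "(\<Sum>l<12. V0_right_mat $$ (r, l) * V0_left_mat $$ (l, s)) = peval Nvar (?T ! r ! s)"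
    if rs: "r < 4" "s < 4" for r s
  proof -
    have len: "length [0, 1, 2, 3 :: nat] = 4" by simp
    have s: "[0, 1, 2, 3] ! s = s" using rs(2) by (auto simp: eval_nat_numeral less_Suc_eq)
    have row: "list_all2 peq (map (\<lambda>s. psum (map2 (\<lambda>c r. map ((*) c) (r ! s)) (V0_right ! r) V0_left))
        [0, 1, 2, 3]) (?T ! r)"
      using list_all2_nthD[OF V0_right_left, of r] rs(1) by (simp only: nth_map length_map V0_lengths)
    have "peq (psum (map2 (\<lambda>c r. map ((*) c) (r ! s)) (V0_right ! r) V0_left)) (?T ! r ! s)"
      using list_all2_nthD[OF row, of s] rs(2) by (simp only: nth_map length_map len s)
    then have "peval Nvar (psum (map2 (\<lambda>c r. map ((*) c) (r ! s)) (V0_right ! r) V0_left)) =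
        peval Nvar (?T ! r ! s)" by (rule peval_peq)
    then show ?thesis using rs
      by (simp add: peval_psum_map2[where n = 12] V0_lengths V0_left_mat_def V0_right_mat_def)
  qed
  let ?p = "\<lambda>r s. c * peval Nvar (?T ! r ! s)"
  have less4: "i < 4 \<longleftrightarrow> i = 0 \<or> i = 1 \<or> i = 2 \<or> i = (3::nat)" for i by auto
  have RL: "V0_right_mat * (c \<cdot>\<^sub>m V0_left_mat) = mat_of_rows_list 4
      [[?p 0 0, 0, 0, 0], [0, ?p 1 1, 0, 0], [0, 0, ?p 2 2, ?p 2 3], [0, 0, ?p 3 2, ?p 3 3]]"
  proof (rule eq_matI)
    fix r s
    assume "r < dim_row (mat_of_rows_list 4
      [[?p 0 0, 0, 0, 0], [0, ?p 1 1, 0, 0], [0, 0, ?p 2 2, ?p 2 3], [0, 0, ?p 3 2, ?p 3 3]])"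
      and "s < dim_col (mat_of_rows_list 4
      [[?p 0 0, 0, 0, 0], [0, ?p 1 1, 0, 0], [0, 0, ?p 2 2, ?p 2 3], [0, 0, ?p 3 2, ?p 3 3]])"
    then have rs: "r < 4" "s < 4" by (simp_all add: mat_of_rows_list_def)
    have "(V0_right_mat * (c \<cdot>\<^sub>m V0_left_mat)) $$ (r, s) =
        (\<Sum>l<12. V0_right_mat $$ (r, l) * (c * V0_left_mat $$ (l, s)))"
      using rs carrier_matD[OF V0_left_right_carrier(1)] carrier_matD[OF V0_left_right_carrier(2)]
      by (simp add: scalar_prod_def lessThan_atLeast0)
    also have "\<dots> = c * peval Nvar (?T ! r ! s)"
      unfolding T[OF rs, symmetric] by (simp add: sum_distrib_left ac_simps)
    finally have "(V0_right_mat * (c \<cdot>\<^sub>m V0_left_mat)) $$ (r, s) = c * peval Nvar (?T ! r ! s)" .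
    then show "(V0_right_mat * (c \<cdot>\<^sub>m V0_left_mat)) $$ (r, s) = mat_of_rows_list 4
      [[?p 0 0, 0, 0, 0], [0, ?p 1 1, 0, 0], [0, 0, ?p 2 2, ?p 2 3], [0, 0, ?p 3 2, ?p 3 3]] $$ (r, s)"
      using rs unfolding less4 by (elim disjE) (simp_all add: mat_of_rows_list_def)
  qed (simp_all add: mat_of_rows_list_def V0_right_mat_def V0_left_mat_def)
  have "[:0, 1:] ^ 4 * char_poly (V0_matrix k) =
      [:0, 1:] ^ 12 * char_poly (V0_right_mat * (c \<cdot>\<^sub>m V0_left_mat))"
    unfolding V0_matrix_def c_def by (rule char_poly_mult_commute) simp_all
  also have "([:0, 1:] :: ratfun poly) ^ 12 = [:0, 1:] ^ 4 * [:0, 1:] ^ 8"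
    by (simp flip: power_add)
  finally have eq: "[:0, 1:] ^ 4 * char_poly (V0_matrix k) = [:0, 1:] ^ 4 *
      ([:0, 1:] ^ 8 * char_poly (V0_right_mat * (c \<cdot>\<^sub>m V0_left_mat)))"
    by (simp only: mult.assoc)
  have nz: "([:0, 1:] :: ratfun poly) ^ 4 \<noteq> 0" by simp
  from mult_left_cancel[OF nz, THEN iffD1, OF eq]
  have "char_poly (V0_matrix k) = [:0, 1:] ^ 8 * char_poly (V0_right_mat * (c \<cdot>\<^sub>m V0_left_mat))" .
  also have "char_poly (V0_right_mat * (c \<cdot>\<^sub>m V0_left_mat)) =
      [:- ?p 0 0, 1:] * [:- ?p 1 1, 1:] *
      [:?p 2 2 * ?p 3 3 - ?p 2 3 * ?p 3 2, - (?p 2 2 + ?p 3 3), 1:]"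
    by (rule char_poly_block[OF RL])
  also have "?p 0 0 = 20 * ((Nvar ^ 2 - 1) / K ^ 2)"
    using K two by (simp add: cK field_simps power2_eq_square)
  also have "?p 1 1 = 6 * (Nvar ^ 2 / K ^ 2)"
    using K two by (simp add: cK field_simps power2_eq_square)
  also have "- (?p 2 2 + ?p 3 3) = 2 * ((10 - 7 * Nvar ^ 2) / K ^ 2)"
    using K two by (simp add: cK field_simps power2_eq_square)
  also have "?p 2 2 * ?p 3 3 - ?p 2 3 * ?p 3 2 = 4 * ((24 - 54 * Nvar ^ 2 + 12 * Nvar ^ 4) / K ^ 4)"
    using K two by (simp add: cK field_simps power2_eq_square power4_eq_xxxx)
  finally show ?thesis by (simp only: last_factor_def K_def mult.assoc)
qed

section \<open>The irrational eigenvalues\<close>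

text \<open>By Vieta it suffices to compare the sum and the product of the two roots. Any field with
  a root \<open>s\<close> will do, so the lemma serves the reals as well as the algebraic closure of
  the rational functions.\<close>

lemma last_factor_split:
  fixes k N s :: "'a::field"
  assumes k: "k \<noteq> 0" and s: "s ^ 2 = discr N"
  shows "last_factor k N = [: - gamma_plus k N s, 1 :] * [: - gamma_minus k N s, 1 :]"
proof -
  have "gamma_plus k N s * gamma_minus k N s = ((7 * N ^ 2 - 10) ^ 2 - s ^ 2) / k ^ 4"
    using k by (simp add: gamma_plus_def gamma_minus_def field_simps power2_eq_square power4_eq_xxxx)
  also have "(7 * N ^ 2 - 10) ^ 2 - s ^ 2 = 4 * (24 - 54 * N ^ 2 + 12 * N ^ 4)"
    unfolding s discr_def by (simp add: algebra_simps power2_eq_square power4_eq_xxxx)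
  finally have p: "4 * ((24 - 54 * N ^ 2 + 12 * N ^ 4) / k ^ 4) = gamma_plus k N s * gamma_minus k N s"
    by simp
  have q: "2 * ((10 - 7 * N ^ 2) / k ^ 2) = - (gamma_plus k N s + gamma_minus k N s)"
    using k by (simp add: gamma_plus_def gamma_minus_def field_simps)
  show ?thesis unfolding last_factor_def p q by (simp add: mult.commute)
qed

lemma discr_pos: "discr (N::real) > 0"
  unfolding discr_def by (intro add_nonneg_pos add_nonneg_nonneg) simp_all

lemma last_factor_roots:
  assumes "k \<noteq> 0"
  shows "{x. poly (last_factor k N) x = 0} = {gamma_plus_real k N, gamma_minus_real k N}"
proof -
  have "sqrt (discr N) ^ 2 = discr N" using discr_pos[of N] by simp
  note split = last_factor_split[OF assms this]
  have "poly (last_factor k N) x = (x - gamma_plus_real k N) * (x - gamma_minus_real k N)" for x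
    unfolding split gamma_plus_real_def gamma_minus_real_def by (simp add: algebra_simps)
  then show ?thesis by auto
qed

lemma gamma_minus_real_2: "gamma_minus_real k 2 = 0"
proof -
  \<comment> \<open>16 + 304 + 4 = 324 = 18^2, and 7 * 4 - 10 is 18 as well.\<close>
  have "sqrt (discr 2) = 18" by (simp add: discr_def real_sqrt_unique)
  then show ?thesis by (simp add: gamma_minus_real_def gamma_minus_def)
qed

lemma gamma_minus_real_deriv:
  assumes "k \<noteq> 0"
  shows "\<exists>D. D \<noteq> 0 \<and> (gamma_minus_real k has_real_derivative D) (at 2)"
proof -
  have sq: "sqrt (324 :: real) = 18" by (simp add: real_sqrt_unique)
  \<comment> \<open>The numerator has derivative 14 * 2 - (4 * 8 + 152 * 2) / (2 * 18) = 28 - 28/3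
    at N = 2.\<close>
  have "(gamma_minus_real k has_real_derivative (56 / 3) / k\<^sup>2) (at 2)"
    unfolding gamma_minus_real_def[abs_def] gamma_minus_def discr_def
    by (rule derivative_eq_intros HOL.refl | simp)+
      (use assms in \<open>simp_all add: sq field_simps power2_eq_square\<close>)
  moreover have "(56 / 3) / k\<^sup>2 \<noteq> 0" using assms by simp
  ultimately show ?thesis by blast
qed

lemma gamma_minus_real_nonzero:
  assumes "k \<noteq> 0" "N > 2" shows "gamma_minus_real k N \<noteq> 0"
proof
  assume "gamma_minus_real k N = 0"
  then have "7 * N\<^sup>2 - 10 = sqrt (discr N)"
    using assms(1) by (simp add: gamma_minus_real_def gamma_minus_def)
  then have "(7 * N\<^sup>2 - 10)\<^sup>2 = discr N" using discr_pos[of N] by simp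
  \<comment> \<open>The difference of the two sides is 24 times this product, and both factors are
    positive for N > 2.\<close>
  then have "(2 * N\<^sup>2 - 1) * (N\<^sup>2 - 4) = 0"
    unfolding discr_def by (simp add: algebra_simps power2_eq_square power4_eq_xxxx)
  moreover have "N\<^sup>2 > 2\<^sup>2" using assms(2) by (intro power_strict_mono) simp_all
  ultimately show False by simp
qed

lemma map_poly_last_factor:
  "map_poly to_ac (last_factor k N) = last_factor (to_ac k) (to_ac N)"
  by (simp add: last_factor_def map_poly_pCons)

section \<open>The eigenvector\<close>

text \<open>The four vectors have integer coordinates, which can be cast into any field: H acts on
  them over the rational functions, and only their combination involves the square root.\<close>

definition O_coord :: "nat \<Rightarrow> flav \<Rightarrow> flav \<Rightarrow> nat \<Rightarrow> int" where
  "O_coord t a b i = (\<Sum>(e, w)\<leftarrow>O_terms t a b. e * cls w (W0_words ! i))"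

lemma coords_O_lin:
  assumes t: "t < 4" and i: "i < 64"
  shows "coords (O_lin t a b) $ i = of_int (O_coord t a b i)"
proof -
  have t': "t \<in> set [0, 1, 2, 3]" using t by (auto simp: eval_nat_numeral less_Suc_eq)
  have "c \<in> set [A1, A2]" for c by (cases c) simp_all
  then have "\<forall>(e, w)\<in>set (O_terms t a b). nferm (concat w) = 1 \<and> canon (W0_rep w) = canon w"
    using O_terms_canon t' unfolding list_all_iff by blast
  then have "lin (\<lambda>w. of_int (cls w (W0_words ! i))) (map (\<lambda>(e, w). ([e], W0_rep w)) xs) =
      of_int (\<Sum>(e, w)\<leftarrow>xs. e * cls w (W0_words ! i))" if "set xs \<subseteq> set (O_terms t a b)" for xs
    using that
  proof (induction xs)
    case (Cons x xs)
    obtain e w where x: "x = (e, w)" by (cases x)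
    have w: "nferm (concat w) = 1" "canon (W0_rep w) = canon w" using Cons.prems x by auto
    have "nferm (concat (W0_rep w)) = 1" using canon_nferm[OF w(2)[symmetric]] w(1) by simp
    then have "cls (W0_rep w) (W0_words ! i) = cls w (W0_words ! i)"
      using w by (simp add: cls_canon)
    then show ?case using Cons by (simp add: x)
  qed simp
  then show ?thesis using i by (simp add: coords_nth O_lin_def O_coord_def)
qed

lemma Ovec_nth:
  fixes k N s :: "'a::field"
  assumes i: "i < 64"
  defines "g \<equiv> k ^ 2 * gamma_minus k N s"
  shows "Ovec k N s a b $ i = 10 / 7 * of_int (O_coord 0 a b i)
    - (6 * N ^ 2 + 2 - g) / 7 * of_int (O_coord 1 a b i)
    + (6 * N ^ 2 - 8 - g) / 7 * of_int (O_coord 2 a b i)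
    - (16 * N ^ 2 - 8 - g) / (14 * N) * of_int (O_coord 3 a b i)"
proof -
  have "A1 \<noteq> A2" by simp
  then show ?thesis
    using i unfolding Ovec_def g_def
    by (simp add: W0_basis_eq length_W0_words O_coord_def O_terms_def Let_def algebra_simps
        add_divide_distrib diff_divide_distrib)
qed

lemma lin_O_image:
  assumes "t < 4"
  shows "lin h (O_image t a b) = (\<Sum>u<4. peval Nvar (O_matrix ! t ! u) * lin h (O_lin u a b))"
proof -
  have *: "lin h (if p = [] then [] else map (\<lambda>(q, w). (pmul p q, w)) xs) = peval Nvar p * lin h xs" for p xs
    by (induction xs) (auto simp: algebra_simps)
  show ?thesis unfolding O_image_def Let_def
    by (simp add: * eval_nat_numeral)
qed

lemma Ham_O_lin:
  assumes k: "k \<noteq> 0" and t: "t < 4" and i: "i < 64"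
  shows "(\<Sum>j<64. to_ac (Ham k $$ (i, j)) * of_int (O_coord t a b j)) =
    (\<Sum>u<4. to_ac (peval Nvar (O_matrix ! t ! u)) * of_int (O_coord u a b i)) / to_ac (const k) ^ 2"
proof -
  obtain c where c: "ham_maps c (O_lin t a b) (O_image t a b)" using ham_maps_O[OF t] by blast
  have "(\<Sum>j<64. Ham k $$ (i, j) * of_int (O_coord t a b j)) = (Ham k *\<^sub>v coords (O_lin t a b)) $ i"
    unfolding mult_mat_vec_nth[OF Ham_carrier[OF k] coords_carrier i]
    by (simp add: coords_O_lin[OF t])
  also have "\<dots> = const (1 / k\<^sup>2) * coords (O_image t a b) $ i"
    unfolding Ham_coords[OF k c] using i by (simp add: carrier_vecD[OF coords_carrier])
  also have "coords (O_image t a b) $ i = (\<Sum>u<4. peval Nvar (O_matrix ! t ! u) * of_int (O_coord u a b i))"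
    using i by (simp add: coords_nth lin_O_image[OF t] coords_O_lin[symmetric])
  also have "const (1 / k\<^sup>2) = inverse (const k ^ 2)"
  proof -
    have "const (1 / k\<^sup>2) * const k ^ 2 = 1" using k by (simp flip: const_mult const_power)
    then show ?thesis by (metis inverse_unique mult.commute)
  qed
  finally have "to_ac (\<Sum>j<64. Ham k $$ (i, j) * of_int (O_coord t a b j)) =
      to_ac (inverse (const k ^ 2) * (\<Sum>u<4. peval Nvar (O_matrix ! t ! u) * of_int (O_coord u a b i)))"
    by simp
  then show ?thesis by (simp add: to_ac_sum field_simps)
qed

text \<open>The coefficients of \<open>\<O>\<^sup>a\<^sub>b\<close> form a left eigenvector of \<open>O_matrix\<close> with eigenvalue
  \<open>g = k\<^sup>2 \<gamma>\<^sub>-\<close>, by the quadratic equation satisfied by \<open>g\<close>.\<close>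

lemma O_coefficients_eigen:
  fixes N s :: "'a::field"
  assumes s: "s ^ 2 = discr N" and nz: "N \<noteq> 0" "(2::'a) \<noteq> 0" "(7::'a) \<noteq> 0"
  defines "g \<equiv> 7 * N ^ 2 - 10 - s"
  defines "c0 \<equiv> 10 / 7" and "c1 \<equiv> - ((6 * N ^ 2 + 2 - g) / 7)"
    and "c2 \<equiv> (6 * N ^ 2 - 8 - g) / 7" and "c3 \<equiv> - ((16 * N ^ 2 - 8 - g) / (14 * N))"
  shows "8 * c1 - 8 * c2 - 12 * N * c3 = g * c0"
    "(4 * N ^ 2 - 8) * c1 - (4 * N ^ 2 - 8) * c2 - 12 * N * c3 = g * c1"
    "- 4 * N ^ 2 * c1 + 4 * N ^ 2 * c2 + 24 * N * c3 = g * c2"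
    "- 2 * N * c1 + 2 * N * c2 + (6 * N ^ 2 - 12) * c3 = g * c3"
proof -
  have s2: "s * s = N ^ 4 + 76 * N ^ 2 + 4" using s by (simp add: discr_def power2_eq_square)
  have 14: "(14::'a) = 2 * 7" by simp
  have nz14: "(14::'a) \<noteq> 0" unfolding 14 mult_eq_0_iff using nz by blast
  \<comment> \<open>Cleared of denominators, the coefficients are polynomials in N and g, and each
    eigenvalue equation follows from these forms and, where g^2 occurs, from the quadratic equation
    for g.\<close>
  have e: "7 * c0 = 10" "7 * c1 = - (6 * N ^ 2 + 2 - g)" "7 * c2 = 6 * N ^ 2 - 8 - g"
    "14 * (N * c3) = - (16 * N ^ 2 - 8 - g)"
  proof -
    have div: "7 * (x / 7) = x" "14 * (N * (x / (14 * N))) = x" for x using nz nz14 by simp_all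
    show "7 * c0 = 10" "7 * c1 = - (6 * N ^ 2 + 2 - g)" "7 * c2 = 6 * N ^ 2 - 8 - g"
      "14 * (N * c3) = - (16 * N ^ 2 - 8 - g)"
      unfolding c0_def c1_def c2_def c3_def mult_minus_right div by (rule HOL.refl)+
  qed
  \<comment> \<open>The last factor of the characteristic polynomial at g / k^2, multiplied by
    k^4.\<close>
  have gg: "g * g = (14 * N ^ 2 - 20) * g - (48 * N ^ 4 - 216 * N ^ 2 + 96)"
    unfolding g_def using s2 by (simp add: algebra_simps power2_eq_square power4_eq_xxxx)
  have cancel: "x = y" if "14 * x = 14 * y" for x y :: 'a using that nz14 by simp
  show "8 * c1 - 8 * c2 - 12 * N * c3 = g * c0"
  proof (rule cancel)
    have "14 * (8 * c1 - 8 * c2 - 12 * N * c3) = 16 * (7 * c1) - 16 * (7 * c2) - 12 * (14 * (N * c3))"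
      by (simp add: algebra_simps)
    also have "\<dots> = 2 * g * 10" unfolding e by (simp add: algebra_simps)
    also have "\<dots> = 14 * (g * c0)" unfolding e(1)[symmetric] by (simp add: algebra_simps)
    finally show "14 * (8 * c1 - 8 * c2 - 12 * N * c3) = 14 * (g * c0)" .
  qed
  show "(4 * N ^ 2 - 8) * c1 - (4 * N ^ 2 - 8) * c2 - 12 * N * c3 = g * c1"
  proof (rule cancel)
    have "14 * ((4 * N ^ 2 - 8) * c1 - (4 * N ^ 2 - 8) * c2 - 12 * N * c3) =
        2 * (4 * N ^ 2 - 8) * (7 * c1) - 2 * (4 * N ^ 2 - 8) * (7 * c2) - 12 * (14 * (N * c3))"
      by (simp add: algebra_simps)
    also have "\<dots> = 2 * (g * g) - 2 * g * (6 * N ^ 2 + 2)"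
      unfolding e gg by (simp add: algebra_simps power2_eq_square power4_eq_xxxx)
    also have "\<dots> = 2 * g * (7 * c1)" unfolding e by (simp add: algebra_simps)
    finally show "14 * ((4 * N ^ 2 - 8) * c1 - (4 * N ^ 2 - 8) * c2 - 12 * N * c3) = 14 * (g * c1)"
      by (simp add: algebra_simps)
  qed
  show "- 4 * N ^ 2 * c1 + 4 * N ^ 2 * c2 + 24 * N * c3 = g * c2"
  proof (rule cancel)
    have "14 * (- 4 * N ^ 2 * c1 + 4 * N ^ 2 * c2 + 24 * N * c3) =
        - 8 * N ^ 2 * (7 * c1) + 8 * N ^ 2 * (7 * c2) + 24 * (14 * (N * c3))"
      by (simp add: algebra_simps)
    also have "\<dots> = 2 * g * (6 * N ^ 2 - 8) - 2 * (g * g)"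
      unfolding e gg by (simp add: algebra_simps power2_eq_square power4_eq_xxxx)
    also have "\<dots> = 2 * g * (7 * c2)" unfolding e by (simp add: algebra_simps)
    finally show "14 * (- 4 * N ^ 2 * c1 + 4 * N ^ 2 * c2 + 24 * N * c3) = 14 * (g * c2)"
      by (simp add: algebra_simps)
  qed
  show "- 2 * N * c1 + 2 * N * c2 + (6 * N ^ 2 - 12) * c3 = g * c3"
  proof -
    \<comment> \<open>Here \<open>c3\<close> itself has to be cleared of its denominator, hence the
      additional factor N.\<close>
    have "14 * N * (- 2 * N * c1 + 2 * N * c2 + (6 * N ^ 2 - 12) * c3) =
        - 4 * N ^ 2 * (7 * c1) + 4 * N ^ 2 * (7 * c2) + (6 * N ^ 2 - 12) * (14 * (N * c3))"
      by (simp add: algebra_simps power2_eq_square)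
    also have "\<dots> = g * g - g * (16 * N ^ 2 - 8)"
      unfolding e gg by (simp add: algebra_simps power2_eq_square power4_eq_xxxx)
    also have "\<dots> = g * (14 * (N * c3))" unfolding e by (simp add: algebra_simps)
    also have "\<dots> = 14 * N * (g * c3)" by (simp add: algebra_simps)
    finally show ?thesis using nz nz14 by simp
  qed
qed

lemma Ham_Ovec:
  fixes s :: "ratfun alg_closure"
  assumes k: "k \<noteq> 0" and s: "s ^ 2 = to_ac (discr Nvar)"
  shows "map_mat to_ac (Ham k) *\<^sub>v Ovec (to_ac (const k)) (to_ac Nvar) s a b =
    gamma_minus (to_ac (const k)) (to_ac Nvar) s \<cdot>\<^sub>v Ovec (to_ac (const k)) (to_ac Nvar) s a b"
proof (rule eq_vecI)
  define K where "K = to_ac (const k)"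
  define N where "N = to_ac Nvar"
  define g where "g = 7 * N ^ 2 - 10 - s"
  define c0 c1 c2 c3 where "c0 = (10 / 7 :: ratfun alg_closure)" and "c1 = - ((6 * N ^ 2 + 2 - g) / 7)"
    and "c2 = (6 * N ^ 2 - 8 - g) / 7" and "c3 = - ((16 * N ^ 2 - 8 - g) / (14 * N))"
  have K: "K \<noteq> 0" using k by (simp add: K_def)
  have gm: "gamma_minus K N s = g / K ^ 2" by (simp add: gamma_minus_def g_def)
  have O: "Ovec K N s a b $ i = c0 * of_int (O_coord 0 a b i) + c1 * of_int (O_coord 1 a b i)
      + c2 * of_int (O_coord 2 a b i) + c3 * of_int (O_coord 3 a b i)" if "i < 64" for i
  proof -
    have kg: "K ^ 2 * gamma_minus K N s = g" using K by (simp add: gm)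
    show ?thesis
      unfolding Ovec_nth[OF that] kg c0_def c1_def c2_def c3_def
      by (simp only: mult_minus_left add_uminus_conv_diff)
  qed
  have dim: "Ovec K N s a b \<in> carrier_vec 64"
    unfolding Ovec_def W0_basis_eq length_W0_words by (rule vec_carrier)
  have H: "map_mat to_ac (Ham k) \<in> carrier_mat 64 64" using Ham_carrier[OF k] by simp
  \<comment> \<open>Nonzero integers stay nonzero as constant rational functions and then in the
    closure; this is needed for the denominators 7 and 14.\<close>
  have nz: "(m :: ratfun alg_closure) \<noteq> 0" if "m = of_int z" "z \<noteq> 0" for m z
  proof -
    have "const (of_int z) \<noteq> 0" using that(2) by simp
    then have "to_ac (of_int z :: ratfun) \<noteq> 0" by (simp only: const_of_int to_ac_eq_0_iff not_False_eq_True)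
    then show ?thesis unfolding that(1) to_ac_of_int .
  qed
  have sN: "s ^ 2 = discr N" using s by (simp add: discr_def N_def)
  have N0: "N \<noteq> 0" by (simp add: N_def)
  have two: "(2 :: ratfun alg_closure) \<noteq> 0" by (rule nz[of _ 2]) simp_all
  have seven: "(7 :: ratfun alg_closure) \<noteq> 0" by (rule nz[of _ 7]) simp_all
  note eig = O_coefficients_eigen[OF sN N0 two seven, folded g_def,
      folded c0_def c1_def c2_def c3_def]
  fix i assume "i < dim_vec (gamma_minus (to_ac (const k)) (to_ac Nvar) s \<cdot>\<^sub>v
      Ovec (to_ac (const k)) (to_ac Nvar) s a b)"
  then have i: "i < 64" using carrier_vecD[OF dim] by (simp add: K_def N_def)
  let ?o = "\<lambda>t i. of_int (O_coord t a b i) :: ratfun alg_closure"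
  have h: "(\<Sum>j<64. to_ac (Ham k $$ (i, j)) * ?o t j) =
      (\<Sum>u<4. to_ac (peval Nvar (O_matrix ! t ! u)) * ?o u i) / K ^ 2" if "t < 4" for t
    unfolding K_def by (rule Ham_O_lin[OF k that i])
  have s4: "(\<Sum>u<4. f u) = f 0 + f 1 + f 2 + f 3" for f :: "nat \<Rightarrow> ratfun alg_closure"
    by (simp add: eval_nat_numeral)
  have "(map_mat to_ac (Ham k) *\<^sub>v Ovec K N s a b) $ i =
      (\<Sum>j<64. to_ac (Ham k $$ (i, j)) * (c0 * ?o 0 j + c1 * ?o 1 j + c2 * ?o 2 j + c3 * ?o 3 j))"
    unfolding mult_mat_vec_nth[OF H dim i]
    using i carrier_matD[OF Ham_carrier[OF k]] by (intro sum.cong HOL.refl) (simp add: O)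
  also have "\<dots> = c0 * (\<Sum>j<64. to_ac (Ham k $$ (i, j)) * ?o 0 j) + c1 * (\<Sum>j<64. to_ac (Ham k $$ (i, j)) * ?o 1 j)
      + c2 * (\<Sum>j<64. to_ac (Ham k $$ (i, j)) * ?o 2 j) + c3 * (\<Sum>j<64. to_ac (Ham k $$ (i, j)) * ?o 3 j)"
  proof -
    have "(\<Sum>j<n. h j * (c0 * a j + c1 * b j + c2 * c j + c3 * d j)) = c0 * (\<Sum>j<n. h j * a j)
        + c1 * (\<Sum>j<n. h j * b j) + c2 * (\<Sum>j<n. h j * c j) + c3 * (\<Sum>j<n. h j * d j)"
      for n :: nat and h a b c d :: "nat \<Rightarrow> ratfun alg_closure"
      by (induction n) (simp_all add: algebra_simps)
    then show ?thesis .
  qed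
  \<comment> \<open>Collecting the coefficient of each of the four vectors gives the row vector of
    the \<open>c\<close>'s times \<open>O_matrix\<close>.\<close>
  also have "\<dots> = ((8 * c1 - 8 * c2 - 12 * N * c3) * ?o 0 i
      + ((4 * N ^ 2 - 8) * c1 - (4 * N ^ 2 - 8) * c2 - 12 * N * c3) * ?o 1 i
      + (- 4 * N ^ 2 * c1 + 4 * N ^ 2 * c2 + 24 * N * c3) * ?o 2 i
      + (- 2 * N * c1 + 2 * N * c2 + (6 * N ^ 2 - 12) * c3) * ?o 3 i) / K ^ 2"
  proof -
    have h0: "(\<Sum>j<64. to_ac (Ham k $$ (i, j)) * ?o 0 j) = 0"
      by (simp add: h s4 O_matrix_def)
    have h1: "(\<Sum>j<64. to_ac (Ham k $$ (i, j)) * ?o 1 j) =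
        (8 * ?o 0 i + (4 * N ^ 2 - 8) * ?o 1 i - 4 * N ^ 2 * ?o 2 i - 2 * N * ?o 3 i) / K ^ 2"
      by (simp add: h s4 O_matrix_def N_def power2_eq_square algebra_simps)
    have h2: "(\<Sum>j<64. to_ac (Ham k $$ (i, j)) * ?o 2 j) =
        - (8 * ?o 0 i + (4 * N ^ 2 - 8) * ?o 1 i - 4 * N ^ 2 * ?o 2 i - 2 * N * ?o 3 i) / K ^ 2"
      by (simp add: h s4 O_matrix_def N_def power2_eq_square algebra_simps)
    have h3: "(\<Sum>j<64. to_ac (Ham k $$ (i, j)) * ?o 3 j) =
        (- 12 * N * ?o 0 i - 12 * N * ?o 1 i + 24 * N * ?o 2 i + (6 * N ^ 2 - 12) * ?o 3 i) / K ^ 2"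
      by (simp add: h s4 O_matrix_def N_def power2_eq_square algebra_simps)
    have div: "c0 * 0 + c1 * (E / M) + c2 * (- E / M) + c3 * (F / M) = (c1 * E - c2 * E + c3 * F) / M"
      for E F M :: "ratfun alg_closure"
      by (simp add: add_divide_distrib diff_divide_distrib)
    show ?thesis unfolding h0 h1 h2 h3 div
      by (intro arg_cong2[of _ _ _ _ "(/)"] HOL.refl) (simp add: algebra_simps)
  qed
  also have "\<dots> = (g * c0 * ?o 0 i + g * c1 * ?o 1 i + g * c2 * ?o 2 i + g * c3 * ?o 3 i) / K ^ 2"
    by (simp only: eig)
  also have "\<dots> = gamma_minus K N s * Ovec K N s a b $ i"
    unfolding gm O[OF i] by (simp add: distrib_left add_divide_distrib ac_simps)
  finally show "(map_mat to_ac (Ham k) *\<^sub>v Ovec (to_ac (const k)) (to_ac Nvar) s a b) $ i =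
    (gamma_minus (to_ac (const k)) (to_ac Nvar) s \<cdot>\<^sub>v Ovec (to_ac (const k)) (to_ac Nvar) s a b) $ i"
    using i carrier_vecD[OF dim] by (simp add: K_def N_def)
next
  have "dim_vec (Ovec (to_ac (const k)) (to_ac Nvar) s a b) = 64"
    unfolding Ovec_def W0_basis_eq length_W0_words by (rule dim_vec)
  then show "dim_vec (map_mat to_ac (Ham k) *\<^sub>v Ovec (to_ac (const k)) (to_ac Nvar) s a b) =
    dim_vec (gamma_minus (to_ac (const k)) (to_ac Nvar) s \<cdot>\<^sub>v Ovec (to_ac (const k)) (to_ac Nvar) s a b)"
    by (simp add: carrier_matD[OF Ham_carrier[OF k]])
qed

text \<open>The formal square root is an arbitrary \<open>s\<close> in the algebraic closure.
  Replacing \<open>s\<close> by its negative exchanges the two irrational eigenvalues, so the choice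
  of the root is only a choice of which one is called gamma_-.\<close>

theorem mainTheorem2:
  fixes k :: real
  assumes "k \<noteq> 0"
  shows
    "mat_kernel V0_mat = {0\<^sub>v 12} \<and>
     (\<forall>v\<in>V0. Ham k *\<^sub>v v \<in> V0) \<and>
     (\<exists>M \<in> carrier_mat 12 12. Ham k * V0_mat = V0_mat * M \<and>
        char_poly M =
          [:0, 1:] ^ 8 *
          [: - (20 * ((Nvar ^ 2 - 1) / const k ^ 2)), 1 :] *
          [: - (6 * (Nvar ^ 2 / const k ^ 2)), 1 :] *
          last_factor (const k) Nvar) \<and>
     (\<forall>N. {x. poly (last_factor k N) x = 0} = {gamma_plus_real k N, gamma_minus_real k N}) \<and>
     gamma_minus_real k 2 = 0 \<and> (\<exists>D. D \<noteq> 0 \<and> (gamma_minus_real k has_real_derivative D) (at 2)) \<and>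
     (\<forall>N>2. gamma_minus_real k N \<noteq> 0) \<and>
     (\<forall>s :: ratfun alg_closure. s ^ 2 = to_ac (discr Nvar) \<longrightarrow>
        map_poly to_ac (last_factor (const k) Nvar) =
          [: - gamma_plus (to_ac (const k)) (to_ac Nvar) s, 1 :] *
          [: - gamma_minus (to_ac (const k)) (to_ac Nvar) s, 1 :] \<and>
        (\<forall>a b. map_mat to_ac (Ham k) *\<^sub>v Ovec (to_ac (const k)) (to_ac Nvar) s a b =
           gamma_minus (to_ac (const k)) (to_ac Nvar) s
             \<cdot>\<^sub>v Ovec (to_ac (const k)) (to_ac Nvar) s a b))"
proof (intro conjI ballI allI impI)
  show "mat_kernel V0_mat = {0\<^sub>v 12}" by (rule V0_mat_kernel)
  show "Ham k *\<^sub>v v \<in> V0" if "v \<in> V0" for v by (rule Ham_preserves_V0[OF assms that])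
  show "\<exists>M \<in> carrier_mat 12 12. Ham k * V0_mat = V0_mat * M \<and>
        char_poly M =
          [:0, 1:] ^ 8 *
          [: - (20 * ((Nvar ^ 2 - 1) / const k ^ 2)), 1 :] *
          [: - (6 * (Nvar ^ 2 / const k ^ 2)), 1 :] *
          last_factor (const k) Nvar"
    by (intro bexI[of _ "V0_matrix k"] conjI Ham_V0[OF assms] char_poly_V0_matrix[OF assms]
        V0_matrix_carrier)
  show "{x. poly (last_factor k N) x = 0} = {gamma_plus_real k N, gamma_minus_real k N}" for N
    by (rule last_factor_roots[OF assms])
  show "gamma_minus_real k 2 = 0" by (rule gamma_minus_real_2)
  show "\<exists>D. D \<noteq> 0 \<and> (gamma_minus_real k has_real_derivative D) (at 2)"
    by (rule gamma_minus_real_deriv[OF assms])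
  show "gamma_minus_real k N \<noteq> 0" if "2 < N" for N
    by (rule gamma_minus_real_nonzero[OF assms that])
  fix s :: "ratfun alg_closure" assume s: "s ^ 2 = to_ac (discr Nvar)"
  have "s ^ 2 = discr (to_ac Nvar)" unfolding s by (simp add: discr_def)
  moreover have "to_ac (const k) \<noteq> 0" using assms by simp
  ultimately show "map_poly to_ac (last_factor (const k) Nvar) =
      [: - gamma_plus (to_ac (const k)) (to_ac Nvar) s, 1 :] *
      [: - gamma_minus (to_ac (const k)) (to_ac Nvar) s, 1 :]"
    unfolding map_poly_last_factor by (intro last_factor_split)
  show "map_mat to_ac (Ham k) *\<^sub>v Ovec (to_ac (const k)) (to_ac Nvar) s a b =
      gamma_minus (to_ac (const k)) (to_ac Nvar) s \<cdot>\<^sub>v Ovec (to_ac (const k)) (to_ac Nvar) s a b" for a b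
    by (rule Ham_Ovec[OF assms s])
qed

end
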